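(* Let $t\geq 1$ and $k\geq 4$ be integers and let $n=t(k-1)+2$. Then, for $i\ge 0$, $\beta_{i,2(i+1)}(I(\mathrm{GA}(t,k)'))=0$ if and only if $i\geq t$. Moreover, \[\beta_{t-1,2t}(I(\mathrm{GA}(t,k)'))=\frac{n}{2}\,(t(k-3)+1).\]
   Context: For integers $t\ge 1$, $k\ge 2$, put $n=t(k-1)+2$. $\mathrm{GA}(t,k)'$ is the simple graph with vertex set $\mathbb Z_n$ in which $a$ and $b$ are adjacent iff $b-a\in\{1+jt \mid j\in\{1,2,\dots,k-2\}\}$ modulo $n$. (This set is closed under negation modulo $n$. Equivalently, for integers $0\le i<j<n$, $\{i,j\}$ is an edge iff $j-i\equiv 1 \pmod t$ and $j-i\notin\{1,n-1\}$.) Let $\mathbb K$ be an arbitrary field. For a graph $G$ with vertices $x_1,\dots,x_n$, the edge ideal is $I(G)=\langle x_ix_j \mid \{x_i,x_j\}\in E(G)\rangle\subseteq R=\mathbb K[x_1,\dots,x_n]$. $\beta_{i,j}(I(G))$ denotes the graded Betti number of the ideal $I(G)$ (not of $R/I(G)$): the number of generators of degree $j$ in the $i$-th free module ($i\ge 0$) of the minimal graded free resolution $\cdots\to F_1\to F_0\to I(G)\to 0$. *)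

theory Defs
  imports Complex_Main "HOL-Library.Poly_Mapping" "HOL-Library.FuncSet" "HOL-Number_Theory.Cong"
begin

section \<open>Polynomials with variables indexed by a set of vertices\<close>

type_synonym ('v, 'k) mpoly = "('v \<Rightarrow>\<^sub>0 nat) \<Rightarrow>\<^sub>0 'k"

definition mon_deg :: "('v \<Rightarrow>\<^sub>0 nat) \<Rightarrow> nat" where
  "mon_deg s = (\<Sum>v\<in>Poly_Mapping.keys s. Poly_Mapping.lookup s v)"

definition Var :: "'v \<Rightarrow> ('v, 'k::field) mpoly" where
  "Var v = Poly_Mapping.single (Poly_Mapping.single v 1) 1"

definition poly_ring :: "'v set \<Rightarrow> ('v, 'k::field) mpoly set" where
  "poly_ring V = {p. \<forall>s\<in>Poly_Mapping.keys p. Poly_Mapping.keys s \<subseteq> V}"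

definition ideal_gen :: "'v set \<Rightarrow> ('v, 'k::field) mpoly set \<Rightarrow> ('v, 'k) mpoly set" where
  "ideal_gen V S =
     {\<Sum>g\<in>A. c g * g | A c. finite A \<and> A \<subseteq> S \<and> (\<forall>g\<in>A. c g \<in> poly_ring V)}"


section \<open>Minimal graded free resolutions and graded Betti numbers\<close>

text \<open>
  The free module of rank \<open>r\<close> over the polynomial ring \<open>R = poly_ring V\<close> is \<open>R\<^sup>r\<close>, and a linear map
  between two of these is given by a matrix, \<open>A l m\<close> being the \<open>l\<close>-th coordinate of the image of
  the \<open>m\<close>-th basis vector.
\<close>

definition free_mod :: "'v set \<Rightarrow> nat \<Rightarrow> (nat \<Rightarrow> ('v, 'k::field) mpoly) set" where
  "free_mod V r = {..<r} \<rightarrow>\<^sub>E poly_ring V"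

definition free_zero :: "nat \<Rightarrow> nat \<Rightarrow> ('v, 'k::field) mpoly" where
  "free_zero r = (\<lambda>l\<in>{..<r}. 0)"

definition mat_map ::
  "nat \<Rightarrow> nat \<Rightarrow> (nat \<Rightarrow> nat \<Rightarrow> ('v, 'k::field) mpoly) \<Rightarrow>
   (nat \<Rightarrow> ('v, 'k) mpoly) \<Rightarrow> nat \<Rightarrow> ('v, 'k) mpoly" where
  "mat_map r s A v = (\<lambda>l\<in>{..<r}. \<Sum>m<s. A l m * v m)"

definition aug_map ::
  "nat \<Rightarrow> (nat \<Rightarrow> ('v, 'k::field) mpoly) \<Rightarrow> (nat \<Rightarrow> ('v, 'k) mpoly) \<Rightarrow> ('v, 'k) mpoly" where
  "aug_map s e v = (\<Sum>m<s. e m * v m)"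

text \<open>
  In a graded free resolution \<open>\<dots> \<rightarrow> F\<^sub>1 \<rightarrow> F\<^sub>0 \<rightarrow> I \<rightarrow> 0\<close> of a homogeneous ideal \<open>I\<close>,
  the module \<open>F\<^sub>i\<close> has rank \<open>r i\<close> and its \<open>l\<close>-th basis element has degree \<open>d i l\<close>; the map
  \<open>F\<^sub>0 \<rightarrow> I\<close> is given by the images \<open>e m\<close> of the basis elements, and \<open>F\<^bsub>i+1\<^esub> \<rightarrow> F\<^sub>i\<close> by the matrix
  \<open>\<phi> i\<close>. All maps preserve degrees, so an entry \<open>\<phi> i l m\<close> is homogeneous of degree
  \<open>d (i+1) m - d i l\<close>, and zero if this number is negative.
\<close>

definition graded_free_resolution ::
  "'v set \<Rightarrow> ('v, 'k::field) mpoly set \<Rightarrow> (nat \<Rightarrow> nat) \<Rightarrow> (nat \<Rightarrow> nat \<Rightarrow> nat) \<Rightarrow>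
   (nat \<Rightarrow> ('v, 'k) mpoly) \<Rightarrow> (nat \<Rightarrow> nat \<Rightarrow> nat \<Rightarrow> ('v, 'k) mpoly) \<Rightarrow> bool" where
  "graded_free_resolution V I r d e \<phi> \<longleftrightarrow>
     (\<forall>m<r 0. e m \<in> poly_ring V \<and> (\<forall>s\<in>Poly_Mapping.keys (e m). mon_deg s = d 0 m)) \<and>
     (\<forall>i. \<forall>l<r i. \<forall>m<r (Suc i).
        \<phi> i l m \<in> poly_ring V \<and> (\<forall>s\<in>Poly_Mapping.keys (\<phi> i l m). d i l + mon_deg s = d (Suc i) m)) \<and>
     aug_map (r 0) e ` free_mod V (r 0) = I \<and>
     {v \<in> free_mod V (r 0). aug_map (r 0) e v = 0}
       = mat_map (r 0) (r 1) (\<phi> 0) ` free_mod V (r 1) \<and>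
     (\<forall>i. {v \<in> free_mod V (r (Suc i)). mat_map (r i) (r (Suc i)) (\<phi> i) v = free_zero (r i)}
            = mat_map (r (Suc i)) (r (Suc (Suc i))) (\<phi> (Suc i)) ` free_mod V (r (Suc (Suc i))))"

text \<open>
  Minimality, \<open>im (F\<^bsub>i+1\<^esub> \<rightarrow> F\<^sub>i) \<subseteq> \<mm> F\<^sub>i\<close> with \<open>\<mm>\<close> the ideal generated by the variables, says that
  the matrix entries have no constant term.
\<close>

definition minimal_graded_free_resolution ::
  "'v set \<Rightarrow> ('v, 'k::field) mpoly set \<Rightarrow> (nat \<Rightarrow> nat) \<Rightarrow> (nat \<Rightarrow> nat \<Rightarrow> nat) \<Rightarrow>
   (nat \<Rightarrow> ('v, 'k) mpoly) \<Rightarrow> (nat \<Rightarrow> nat \<Rightarrow> nat \<Rightarrow> ('v, 'k) mpoly) \<Rightarrow> bool" where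
  "minimal_graded_free_resolution V I r d e \<phi> \<longleftrightarrow>
     graded_free_resolution V I r d e \<phi> \<and>
     (\<forall>i. \<forall>l<r i. \<forall>m<r (Suc i). Poly_Mapping.lookup (\<phi> i l m) 0 = 0)"

text \<open>
  The definite description is justified by the existence of a minimal graded free resolution of a
  homogeneous ideal (for finite \<open>V\<close>) and its uniqueness up to isomorphism.
\<close>

definition graded_betti :: "'v set \<Rightarrow> ('v, 'k::field) mpoly set \<Rightarrow> nat \<Rightarrow> nat \<Rightarrow> nat" where
  "graded_betti V I i j =
     (THE b. \<exists>r d e \<phi>. minimal_graded_free_resolution V I r d e \<phi> \<and>
                      b = card {l. l < r i \<and> d i l = j})"


section \<open>Edge ideals and the graph\<close>

text \<open>A graph is given by its set \<open>V\<close> of vertices and its set \<open>E\<close> of edges, which are two-element sets.\<close>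

definition edge_ideal :: "'v set \<Rightarrow> 'v set set \<Rightarrow> ('v, 'k::field) mpoly set" where
  "edge_ideal V E = ideal_gen V {Var a * Var b | a b. {a, b} \<in> E}"

text \<open>The vertices of \<open>GA(t,k)'\<close> are the standard representatives of the residues modulo \<open>n\<close>.\<close>

definition GA_size :: "nat \<Rightarrow> nat \<Rightarrow> nat" where
  "GA_size t k = t * (k - 1) + 2"

definition GA'_verts :: "nat \<Rightarrow> nat \<Rightarrow> int set" where
  "GA'_verts t k = {0..<int (GA_size t k)}"

definition GA'_edges :: "nat \<Rightarrow> nat \<Rightarrow> int set set" where
  "GA'_edges t k =
     {{a, b} | a b. a \<in> GA'_verts t k \<and> b \<in> GA'_verts t k \<and>
        (\<exists>j\<in>{1..k - 2}. [b - a = 1 + int j * int t] (mod int (GA_size t k)))}"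

end

theory Submission
  imports Defs
begin

text \<open>
  In homological position \<open>i\<close> a minimal resolution of an edge ideal has no generators of degree larger
  than \<open>2(i + 1)\<close>, and those of degree exactly \<open>2(i + 1)\<close> are counted by the induced matchings with
  \<open>i + 1\<close> edges. This is visible in the Taylor resolution, whose basis in position \<open>i\<close> consists of the
  sets of \<open>i + 1\<close> edges, with the number of covered vertices as degree: a set of maximal degree is a
  matching, and modulo the variables the only boundaries among the matchings come from a matching
  together with one further edge on the same vertices, so they identify exactly those matchings
  that are not induced with zero (\<open>card_degree_eq_induced_matchings\<close>). The Taylor complex is exact
  because each of its multigraded strands is the chain complex of a full simplex, which is a cone
  (\<open>taylor_exact\<close>). Comparison maps between the Taylor resolution and any minimal resolution exist and
  are mutually inverse up to homotopy (\<open>chain_map_exists\<close>, \<open>homotopy_exists\<close>); taking constant terms,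
  they turn into inverse linear maps between the space spanned by the induced matchings and the one
  spanned by the generators in question. Thus all minimal resolutions give the same number. That
  there is one follows by cancelling unit entries in the Taylor resolution until none is left
  (\<open>cancel_unit\<close>).

  It remains to find the induced matchings of the graph. An induced matching leaves some vertex
  uncovered; cut the circle there and read the graph from left to right. Two covered vertices at
  positions \<open>p < q\<close> are then adjacent if and only if \<open>q - p\<close> is congruent to \<open>1\<close> modulo \<open>t\<close> and different from \<open>1\<close>. Two
  edges whose left ends are congruent modulo \<open>t\<close> would be joined by a third edge, so there are at most
  \<open>t\<close> edges (\<open>card_induced_matching_le\<close>). If there are exactly \<open>t\<close>, all residues occur among the left ends
  and among the right ends, and the absence of further edges forces each of these two sets to
  consist of consecutive positions (\<open>covered_positions\<close>). Conversely, two arcs of \<open>t\<close> consecutive vertices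
  with a gap on both sides span an induced matching with \<open>t\<close> edges. Choosing the first vertices of the
  two arcs in order can be done in \<open>n(n - 2t - 1) = n(t(k - 3) + 1)\<close> ways, and each matching arises twice.
\<close>

section \<open>Homogeneous polynomials\<close>

lemma mon_deg_superset:
  assumes "finite A" "Poly_Mapping.keys s \<subseteq> A"
  shows "mon_deg s = (\<Sum>v\<in>A. Poly_Mapping.lookup s v)"
  unfolding mon_deg_def using assms
  by (intro sum.mono_neutral_left) (auto simp: in_keys_iff)

lemma mon_deg_add: "mon_deg (s + t) = mon_deg s + mon_deg t"
proof -
  let ?A = "Poly_Mapping.keys s \<union> Poly_Mapping.keys t"
  have fin: "finite ?A" by simp
  have sub: "Poly_Mapping.keys (s + t) \<subseteq> ?A" by (rule keys_add)
  show ?thesis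
    using mon_deg_superset[OF fin sub] mon_deg_superset[OF fin, of s] mon_deg_superset[OF fin, of t]
    by (simp add: lookup_add sum.distrib)
qed

lemma mon_deg_zero [simp]: "mon_deg 0 = 0"
  by (simp add: mon_deg_def)

lemma mon_deg_eq_0_iff [simp]: "mon_deg s = 0 \<longleftrightarrow> s = 0"
  by (auto simp: mon_deg_def in_keys_iff intro!: poly_mapping_eqI)

lemma keys_add_nat:
  fixes s t :: "'v \<Rightarrow>\<^sub>0 nat"
  shows "Poly_Mapping.keys (s + t) = Poly_Mapping.keys s \<union> Poly_Mapping.keys t"
  by (auto simp: in_keys_iff lookup_add)

lemma keys_multE:
  assumes "s \<in> Poly_Mapping.keys (p * q)"
  obtains a b where "s = a + b" "a \<in> Poly_Mapping.keys p" "b \<in> Poly_Mapping.keys q"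
  using assms keys_mult[of p q] by blast

lemma keys_sumE:
  assumes "s \<in> Poly_Mapping.keys (sum f A)"
  obtains a where "a \<in> A" "s \<in> Poly_Mapping.keys (f a)"
proof -
  have "(\<Sum>a\<in>A. Poly_Mapping.lookup (f a) s) \<noteq> 0"
    using assms by (simp add: in_keys_iff lookup_sum)
  then obtain a where "a \<in> A" "Poly_Mapping.lookup (f a) s \<noteq> 0"
    by (meson sum.neutral)
  thus ?thesis using that by (auto simp: in_keys_iff)
qed

lemma poly_ring_zero [simp]: "0 \<in> poly_ring V"
  and poly_ring_one [simp]: "1 \<in> poly_ring V"
  and poly_ring_single: "Poly_Mapping.keys s \<subseteq> V \<Longrightarrow> Poly_Mapping.single s c \<in> poly_ring V"
  by (auto simp: poly_ring_def)

lemma poly_ring_add: "p \<in> poly_ring V \<Longrightarrow> q \<in> poly_ring V \<Longrightarrow> p + q \<in> poly_ring V"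
  using keys_add[of p q] by (auto simp: poly_ring_def)

lemma poly_ring_uminus: "p \<in> poly_ring V \<Longrightarrow> - p \<in> poly_ring V"
  by (auto simp: poly_ring_def in_keys_iff)

lemma poly_ring_diff: "p \<in> poly_ring V \<Longrightarrow> q \<in> poly_ring V \<Longrightarrow> p - q \<in> poly_ring V"
  using poly_ring_add[of p V "- q"] by (simp add: poly_ring_uminus)

lemma poly_ring_mult: "p \<in> poly_ring V \<Longrightarrow> q \<in> poly_ring V \<Longrightarrow> p * q \<in> poly_ring V"
  unfolding poly_ring_def by (auto elim!: keys_multE simp: keys_add_nat) blast+

lemma poly_ring_sum: "(\<And>a. a \<in> A \<Longrightarrow> f a \<in> poly_ring V) \<Longrightarrow> sum f A \<in> poly_ring V"
  unfolding poly_ring_def by (auto elim!: keys_sumE)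

text \<open>
  The entries of a degree-preserving matrix between graded free modules: a basis element of
  degree \<open>b\<close> is mapped to combinations of basis elements of degree \<open>a\<close> with coefficients that are
  homogeneous of degree \<open>b - a\<close>. Stating the degree additively makes the coefficient zero, and not
  constant, when \<open>a > b\<close>.
\<close>

definition homp :: "'v set \<Rightarrow> nat \<Rightarrow> nat \<Rightarrow> ('v, 'k::field) mpoly \<Rightarrow> bool" where
  "homp V a b p \<longleftrightarrow> p \<in> poly_ring V \<and> (\<forall>s\<in>Poly_Mapping.keys p. a + mon_deg s = b)"

lemma homp_poly_ring: "homp V a b p \<Longrightarrow> p \<in> poly_ring V"
  by (simp add: homp_def)

lemma homp_zero [simp]: "homp V a b 0"
  by (simp add: homp_def)

lemma homp_one [simp]: "homp V a a 1"
  by (simp add: homp_def)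

lemma homp_diff: "homp V a b p \<Longrightarrow> homp V a b q \<Longrightarrow> homp V a b (p - q)"
  unfolding homp_def by (auto simp: poly_ring_diff in_keys_iff lookup_minus)

lemma homp_mult: "homp V a b p \<Longrightarrow> homp V b c q \<Longrightarrow> homp V a c (p * q)"
  unfolding homp_def by (auto simp: poly_ring_mult mon_deg_add elim!: keys_multE) 

lemma homp_sum: "(\<And>i. i \<in> A \<Longrightarrow> homp V a b (f i)) \<Longrightarrow> homp V a b (sum f A)"
  unfolding homp_def by (auto simp: poly_ring_sum elim!: keys_sumE)

lemma homp_const: "homp V a a (Poly_Mapping.single 0 c)"
  by (auto simp: homp_def poly_ring_single)

lemma homp_same_degree:
  assumes "homp V a a p"
  shows "p = Poly_Mapping.single 0 (Poly_Mapping.lookup p 0)"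
proof (rule poly_mapping_eqI)
  fix s
  show "Poly_Mapping.lookup p s = Poly_Mapping.lookup (Poly_Mapping.single 0 (Poly_Mapping.lookup p 0)) s"
    using assms by (cases "s = 0") (auto simp: homp_def in_keys_iff lookup_single)
qed

lemma homp_const_term:
  assumes "homp V a b p" "a \<noteq> b"
  shows "Poly_Mapping.lookup p 0 = 0"
  using assms by (force simp: homp_def in_keys_iff)

lemma lookup_single_mult:
  fixes p :: "('v, 'k::field) mpoly"
  shows "Poly_Mapping.lookup (Poly_Mapping.single m c * p) (m + s) = c * Poly_Mapping.lookup p s"
proof -
  have "Poly_Mapping.lookup (Poly_Mapping.single m c * p) (m + s)
     = (\<Sum>l. (c when m = l) * (\<Sum>q. Poly_Mapping.lookup p q when m + s = l + q))"
    by (simp add: lookup_mult lookup_single)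
  also have "\<dots> = (\<Sum>l. (c * (\<Sum>q. Poly_Mapping.lookup p q when m + s = l + q)) when m = l)"
    by (simp add: when_mult)
  also have "\<dots> = c * (\<Sum>q. Poly_Mapping.lookup p q when s = q)"
    by simp
  also have "\<dots> = c * Poly_Mapping.lookup p s"
    by simp
  finally show ?thesis .
qed

lemma lookup_single_mult_eq_0:
  fixes p :: "('v, 'k::field) mpoly"
  assumes "\<And>u. s \<noteq> m + u"
  shows "Poly_Mapping.lookup (Poly_Mapping.single m c * p) s = 0"
proof (rule ccontr)
  assume "\<not> ?thesis"
  hence "s \<in> Poly_Mapping.keys (Poly_Mapping.single m c * p)" by (simp add: in_keys_iff)
  then obtain a b where "s = a + b" "a \<in> Poly_Mapping.keys (Poly_Mapping.single m c)"
    by (rule keys_multE)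
  thus False using assms by (auto split: if_splits)
qed

lemma const_term_mult:
  fixes p q :: "('v, 'k::field) mpoly"
  shows "Poly_Mapping.lookup (p * q) 0 = Poly_Mapping.lookup p 0 * Poly_Mapping.lookup q 0"
proof -
  let ?c = "Poly_Mapping.single 0 (Poly_Mapping.lookup p 0)"
  have "Poly_Mapping.lookup ((p - ?c) * q) 0 = 0"
  proof (rule ccontr)
    assume "\<not> ?thesis"
    hence "0 \<in> Poly_Mapping.keys ((p - ?c) * q)" by (simp add: in_keys_iff)
    then obtain a b where ab: "0 = a + b" "a \<in> Poly_Mapping.keys (p - ?c)"
      by (rule keys_multE)
    hence "mon_deg a = 0" by (metis mon_deg_add mon_deg_zero add_is_0)
    hence "a = 0" by simp
    thus False using ab(2) by (simp add: in_keys_iff lookup_minus)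
  qed
  moreover have "p * q = ?c * q + (p - ?c) * q" by (simp add: algebra_simps)
  moreover have "Poly_Mapping.lookup (?c * q) 0 = Poly_Mapping.lookup p 0 * Poly_Mapping.lookup q 0"
    using lookup_single_mult[of 0 _ q 0] by simp
  ultimately show ?thesis by (simp add: lookup_add)
qed

text \<open>With \<open>a\<close> the degree of a basis element, the part of its coefficient that contributes to total degree \<open>b\<close>.\<close>

definition part :: "nat \<Rightarrow> nat \<Rightarrow> ('v, 'k::field) mpoly \<Rightarrow> ('v, 'k) mpoly" where
  "part a b p = (\<Sum>s\<in>{s \<in> Poly_Mapping.keys p. a + mon_deg s = b}.
                   Poly_Mapping.single s (Poly_Mapping.lookup p s))"

lemma lookup_part:
  "Poly_Mapping.lookup (part a b p) s = (if a + mon_deg s = b then Poly_Mapping.lookup p s else 0)"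
proof -
  have "Poly_Mapping.lookup (part a b p) s
     = (\<Sum>u\<in>{u \<in> Poly_Mapping.keys p. a + mon_deg u = b}. if u = s then Poly_Mapping.lookup p u else 0)"
    unfolding part_def by (simp add: lookup_sum lookup_single when_def)
  also have "\<dots> = (if a + mon_deg s = b then Poly_Mapping.lookup p s else 0)"
    by (subst sum.delta) (auto simp: in_keys_iff)
  finally show ?thesis .
qed

lemma homp_part: "p \<in> poly_ring V \<Longrightarrow> homp V a b (part a b p)"
  by (auto simp: homp_def poly_ring_def in_keys_iff lookup_part split: if_splits)

lemma part_add: "part a b (p + q) = part a b p + part a b q"
  by (rule poly_mapping_eqI) (simp add: lookup_part lookup_add)

lemma part_sum: "part a b (sum f A) = (\<Sum>i\<in>A. part a b (f i))"
  by (rule poly_mapping_eqI) (simp add: lookup_part lookup_sum)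

lemma part_homp: "homp V a b p \<Longrightarrow> part a b p = p"
  by (rule poly_mapping_eqI) (force simp: lookup_part homp_def in_keys_iff)

lemma part_mult:
  assumes "homp V a b p"
  shows "part a c (p * q) = p * part b c q"
proof -
  let ?r = "q - part b c q"
  have "part a c (p * ?r) = 0"
  proof (rule poly_mapping_eqI)
    fix s
    have False if "a + mon_deg s = c" "Poly_Mapping.lookup (p * ?r) s \<noteq> 0"
    proof -
      have "s \<in> Poly_Mapping.keys (p * ?r)" using that by (simp add: in_keys_iff)
      then obtain u v where uv: "s = u + v" "u \<in> Poly_Mapping.keys p" "v \<in> Poly_Mapping.keys ?r"
        by (rule keys_multE)
      have "a + mon_deg u = b" using assms uv(2) by (simp add: homp_def)
      hence "b + mon_deg v = c" using that(1) uv(1) by (simp add: mon_deg_add)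
      thus False using uv(3) by (simp add: in_keys_iff lookup_minus lookup_part)
    qed
    thus "Poly_Mapping.lookup (part a c (p * ?r)) s = Poly_Mapping.lookup 0 s"
      by (auto simp: lookup_part)
  qed
  moreover have "part a c (p * part b c q) = p * part b c q"
  proof (rule poly_mapping_eqI)
    fix s
    have "a + mon_deg s = c" if "Poly_Mapping.lookup (p * part b c q) s \<noteq> 0"
    proof -
      have "s \<in> Poly_Mapping.keys (p * part b c q)" using that by (simp add: in_keys_iff)
      then obtain u v where uv: "s = u + v" "u \<in> Poly_Mapping.keys p" "v \<in> Poly_Mapping.keys (part b c q)"
        by (rule keys_multE)
      thus ?thesis using assms by (auto simp: homp_def mon_deg_add in_keys_iff lookup_part split: if_splits)
    qed
    thus "Poly_Mapping.lookup (part a c (p * part b c q)) s = Poly_Mapping.lookup (p * part b c q) s"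
      by (auto simp: lookup_part)
  qed
  moreover have "p * q = p * part b c q + p * ?r" by (simp add: algebra_simps)
  ultimately show ?thesis by (simp add: part_add)
qed

section \<open>Graded free resolutions on finite sets of basis elements\<close>

definition mv :: "'b set \<Rightarrow> ('a \<Rightarrow> 'b \<Rightarrow> 'r::comm_ring_1) \<Rightarrow> ('b \<Rightarrow> 'r) \<Rightarrow> 'a \<Rightarrow> 'r" where
  "mv K A v l = (\<Sum>k\<in>K. A l k * v k)"

definition mm :: "'b set \<Rightarrow> ('a \<Rightarrow> 'b \<Rightarrow> 'r::comm_ring_1) \<Rightarrow> ('b \<Rightarrow> 'c \<Rightarrow> 'r) \<Rightarrow> 'a \<Rightarrow> 'c \<Rightarrow> 'r" where
  "mm K A B l m = (\<Sum>k\<in>K. A l k * B k m)"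

lemma mm_column: "mm K A B l m = mv K A (\<lambda>k. B k m) l"
  by (simp add: mm_def mv_def)

lemma mv_mv: "mv K A (mv L B v) = mv L (mm K A B) v"
  unfolding mv_def mm_def
  by (rule ext) (simp add: sum_distrib_left sum_distrib_right mult.assoc sum.swap[of _ L K])

lemma mv_cong:
  "(\<And>k. k \<in> K \<Longrightarrow> A l k = A' l k) \<Longrightarrow> (\<And>k. k \<in> K \<Longrightarrow> v k = v' k) \<Longrightarrow> mv K A v l = mv K A' v' l"
  unfolding mv_def by (intro sum.cong) auto

lemma mv_diff: "mv K A (\<lambda>k. v k - w k) l = mv K A v l - mv K A w l"
  by (simp add: mv_def algebra_simps sum_subtractf)

lemma mv_diff_matrix: "mv K (\<lambda>l k. A l k - B l k) v l = mv K A v l - mv K B v l"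
  by (simp add: mv_def algebra_simps sum_subtractf)

lemma mv_add_matrix: "mv K (\<lambda>l k. A l k + B l k) v l = mv K A v l + mv K B v l"
  by (simp add: mv_def algebra_simps sum.distrib)

lemma mv_id:
  assumes "finite K" "l \<in> K"
  shows "mv K (\<lambda>l k. if l = k then 1 else 0) v l = v l"
proof -
  have "mv K (\<lambda>l k. if l = k then 1 else 0) v l = (\<Sum>k\<in>K. if l = k then v k else 0)"
    unfolding mv_def by (intro sum.cong) auto
  thus ?thesis using assms by (simp add: sum.delta)
qed

lemma mv_unit:
  assumes "finite K" "m \<in> K"
  shows "mv K A (\<lambda>k. if k = m then 1 else 0) l = A l m"
proof -
  have "mv K A (\<lambda>k. if k = m then 1 else 0) l = (\<Sum>k\<in>K. if k = m then A l k else 0)"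
    unfolding mv_def by (intro sum.cong) auto
  thus ?thesis using assms by (simp add: sum.delta')
qed

definition polyvec :: "'v set \<Rightarrow> 'b set \<Rightarrow> ('b \<Rightarrow> ('v, 'k::field) mpoly) \<Rightarrow> bool" where
  "polyvec V K v \<longleftrightarrow> (\<forall>k\<in>K. v k \<in> poly_ring V)"

lemma polyvec_mv:
  "(\<And>k. k \<in> K \<Longrightarrow> l \<in> L \<Longrightarrow> A l k \<in> poly_ring V) \<Longrightarrow> polyvec V K v \<Longrightarrow> l \<in> L \<Longrightarrow> mv K A v l \<in> poly_ring V"
  unfolding polyvec_def mv_def by (intro poly_ring_sum poly_ring_mult) auto

text \<open>
  The ring itself is the module in position \<open>0\<close>, with basis \<open>{z}\<close>, so that the augmentation
  becomes the first matrix. Exactness then reads the same in every position once the elements of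
  the ideal are taken as the cycles in position \<open>0\<close>.
\<close>

fun cycle ::
  "('v, 'k::field) mpoly set \<Rightarrow> 'b \<Rightarrow> (nat \<Rightarrow> 'b set) \<Rightarrow> (nat \<Rightarrow> 'b \<Rightarrow> 'b \<Rightarrow> ('v, 'k) mpoly) \<Rightarrow>
   nat \<Rightarrow> ('b \<Rightarrow> ('v, 'k) mpoly) \<Rightarrow> bool" where
  "cycle I z B D 0 v \<longleftrightarrow> v z \<in> I"
| "cycle I z B D (Suc i) v \<longleftrightarrow> (\<forall>l\<in>B i. mv (B (Suc i)) (D i) v l = 0)"

locale resolution =
  fixes V :: "'v set" and I :: "('v, 'k::field) mpoly set" and z :: 'b
    and B :: "nat \<Rightarrow> 'b set" and d :: "nat \<Rightarrow> 'b \<Rightarrow> nat"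
    and D :: "nat \<Rightarrow> 'b \<Rightarrow> 'b \<Rightarrow> ('v, 'k) mpoly"
  assumes finite_basis: "finite (B i)"
    and basis_0: "B 0 = {z}"
    and degree_0: "d 0 z = 0"
    and entry_homp: "l \<in> B i \<Longrightarrow> m \<in> B (Suc i) \<Longrightarrow> homp V (d i l) (d (Suc i) m) (D i l m)"
    and exact: "polyvec V (B i) v \<Longrightarrow>
      cycle I z B D i v \<longleftrightarrow>
        (\<exists>w. polyvec V (B (Suc i)) w \<and> (\<forall>b\<in>B i. v b = mv (B (Suc i)) (D i) w b))"
begin

lemma entry_poly: "l \<in> B i \<Longrightarrow> m \<in> B (Suc i) \<Longrightarrow> D i l m \<in> poly_ring V"
  using entry_homp homp_poly_ring by blast

lemma cycle_cong:
  assumes "\<And>b. b \<in> B i \<Longrightarrow> v b = v' b"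
  shows "cycle I z B D i v \<longleftrightarrow> cycle I z B D i v'"
proof (cases i)
  case 0
  thus ?thesis using assms basis_0 by simp
next
  case (Suc j)
  have "mv (B (Suc j)) (D j) v l = mv (B (Suc j)) (D j) v' l" for l
    by (rule mv_cong) (use assms Suc in auto)
  thus ?thesis using Suc by simp
qed

lemma boundary_cycle:
  assumes "polyvec V (B (Suc i)) w"
  shows "cycle I z B D i (mv (B (Suc i)) (D i) w)"
  using assms by (subst exact) (auto simp: polyvec_def[of _ "B i"] intro!: polyvec_mv entry_poly)

lemma column_cycle:
  assumes "m \<in> B (Suc i)"
  shows "cycle I z B D i (\<lambda>l. D i l m)"
proof -
  have "cycle I z B D i (mv (B (Suc i)) (D i) (\<lambda>k. if k = m then 1 else 0))"
    by (rule boundary_cycle) (simp add: polyvec_def)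
  thus ?thesis by (simp add: mv_unit[OF finite_basis assms] cong: cycle_cong)
qed

text \<open>Since the maps preserve degrees, it suffices to keep the part of a preimage of the right degree.\<close>

lemma homogeneous_lift:
  assumes v: "\<And>b. b \<in> B i \<Longrightarrow> homp V (d i b) a (v b)" and cyc: "cycle I z B D i v"
  shows "\<exists>w. (\<forall>m\<in>B (Suc i). homp V (d (Suc i) m) a (w m)) \<and> (\<forall>b\<in>B i. v b = mv (B (Suc i)) (D i) w b)"
proof -
  have "polyvec V (B i) v" using v by (auto simp: polyvec_def intro: homp_poly_ring)
  then obtain w where w: "polyvec V (B (Suc i)) w" "\<forall>b\<in>B i. v b = mv (B (Suc i)) (D i) w b"
    using cyc exact by blast
  let ?w = "\<lambda>m. part (d (Suc i) m) a (w m)"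
  have "v b = mv (B (Suc i)) (D i) ?w b" if b: "b \<in> B i" for b
  proof -
    have "v b = part (d i b) a (v b)" using v[OF b] by (simp add: part_homp)
    also have "\<dots> = (\<Sum>m\<in>B (Suc i). part (d i b) a (D i b m * w m))"
      using w(2) b by (simp add: mv_def part_sum)
    also have "\<dots> = mv (B (Suc i)) (D i) ?w b"
      unfolding mv_def by (intro sum.cong part_mult[OF entry_homp[OF b]]) auto
    finally show ?thesis .
  qed
  moreover have "homp V (d (Suc i) m) a (?w m)" if "m \<in> B (Suc i)" for m
    using w(1) that by (simp add: polyvec_def homp_part)
  ultimately show ?thesis by (intro exI[of _ ?w]) blast
qed

end

section \<open>Comparison maps and homotopies\<close>

locale resolution_pair =
  P: resolution V I zP P dP DP + Q: resolution V I zQ Q dQ DQ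
  for V :: "'v set" and I :: "('v, 'k::field) mpoly set" and zP :: 'p and P dP DP and zQ :: 'q and Q dQ DQ
begin

abbreviation degree_preserving :: "nat \<Rightarrow> nat \<Rightarrow> ('q \<Rightarrow> 'p \<Rightarrow> ('v, 'k) mpoly) \<Rightarrow> bool" where
  "degree_preserving j i f \<equiv> (\<forall>l\<in>Q j. \<forall>m\<in>P i. homp V (dQ j l) (dP i m) (f l m))"

abbreviation commutes :: "nat \<Rightarrow> ('q \<Rightarrow> 'p \<Rightarrow> ('v, 'k) mpoly) \<Rightarrow> ('q \<Rightarrow> 'p \<Rightarrow> ('v, 'k) mpoly) \<Rightarrow> bool" where
  "commutes i f f' \<equiv> (\<forall>l\<in>Q i. \<forall>m\<in>P (Suc i). mm (Q (Suc i)) (DQ i) f' l m = mm (P i) f (DP i) l m)"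

lemma homp_mm_column:
  assumes "degree_preserving j i f" "l \<in> Q j" "m \<in> P (Suc i)"
  shows "homp V (dQ j l) (dP (Suc i) m) (mm (P i) f (DP i) l m)"
  unfolding mm_def using assms by (intro homp_sum homp_mult[of V _ "dP i k" for k]) (auto intro: P.entry_homp)

lemma chain_map_exists:
  "\<exists>f. f 0 zQ zP = 1 \<and> (\<forall>i. degree_preserving i i (f i) \<and> commutes i (f i) (f (Suc i)))"
proof -
  \<comment> \<open>Preserving cycles is the induction hypothesis: it makes the images of the columns of the
    differential liftable, and it passes to the lift.\<close>
  define R where "R i f \<longleftrightarrow> degree_preserving i i f \<and> (i = 0 \<longrightarrow> f zQ zP = 1) \<and>
    (\<forall>v. polyvec V (P i) v \<longrightarrow> cycle I zP P DP i v \<longrightarrow> cycle I zQ Q DQ i (mv (P i) f v))" for i f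
  have "\<exists>f. \<forall>i. R i (f i) \<and> commutes i (f i) (f (Suc i))"
  proof (rule dependent_nat_choice)
    show "\<exists>f. R 0 f"
      by (rule exI[of _ "\<lambda>_ _. 1"])
         (simp add: R_def P.basis_0 Q.basis_0 P.degree_0 Q.degree_0 mv_def)
  next
    fix f i assume f: "R i f"
    have "\<exists>w. (\<forall>l\<in>Q (Suc i). homp V (dQ (Suc i) l) (dP (Suc i) m) (w l)) \<and>
          (\<forall>l\<in>Q i. mm (P i) f (DP i) l m = mv (Q (Suc i)) (DQ i) w l)" if m: "m \<in> P (Suc i)" for m
    proof (rule Q.homogeneous_lift)
      show "homp V (dQ i l) (dP (Suc i) m) (mm (P i) f (DP i) l m)" if "l \<in> Q i" for l
        using f m that by (intro homp_mm_column) (auto simp: R_def)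
      have "polyvec V (P i) (\<lambda>l. DP i l m)" using m by (auto simp: polyvec_def intro: P.entry_poly)
      thus "cycle I zQ Q DQ i (\<lambda>l. mm (P i) f (DP i) l m)"
        using f P.column_cycle[OF m] unfolding R_def mm_column by blast
    qed
    then obtain w where w: "\<And>m. m \<in> P (Suc i) \<Longrightarrow> \<forall>l\<in>Q (Suc i). homp V (dQ (Suc i) l) (dP (Suc i) m) (w m l)"
        "\<And>m. m \<in> P (Suc i) \<Longrightarrow> \<forall>l\<in>Q i. mm (P i) f (DP i) l m = mv (Q (Suc i)) (DQ i) (w m) l"
      by metis
    define f' where "f' l m = w m l" for l m
    have com: "commutes i f f'" using w(2) by (simp add: mm_column[of "Q (Suc i)"] f'_def)
    have "mv (Q (Suc i)) (DQ i) (mv (P (Suc i)) f' v) l = 0"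
      if v: "cycle I zP P DP (Suc i) v" and l: "l \<in> Q i" for v l
    proof -
      have "mv (Q (Suc i)) (DQ i) (mv (P (Suc i)) f' v) l = mv (P (Suc i)) (mm (Q (Suc i)) (DQ i) f') v l"
        by (simp add: mv_mv)
      also have "\<dots> = mv (P (Suc i)) (mm (P i) f (DP i)) v l"
        by (rule mv_cong) (use com l in auto)
      also have "\<dots> = mv (P i) f (mv (P (Suc i)) (DP i) v) l" by (simp add: mv_mv)
      also have "\<dots> = mv (P i) f (\<lambda>_. 0) l" by (rule mv_cong) (use v in auto)
      finally show ?thesis by (simp add: mv_def)
    qed
    hence "R (Suc i) f'" using w(1) by (auto simp: R_def f'_def)
    with com show "\<exists>f'. R (Suc i) f' \<and> commutes i f f'" by blast
  qed
  then obtain f where f: "\<And>i. R i (f i)" "\<And>i. commutes i (f i) (f (Suc i))" by blast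
  from f(1)[of 0] have "f 0 zQ zP = 1" by (simp add: R_def)
  moreover have "degree_preserving i i (f i)" for i using f(1)[of i] by (simp add: R_def)
  ultimately show ?thesis using f(2) by blast
qed

text \<open>
  The difference \<open>u\<close> of two chain maps that agree in position \<open>0\<close> satisfies the hypotheses.
\<close>

lemma homotopy_exists:
  assumes deg: "\<And>i. degree_preserving i i (u i)" and com: "\<And>i. commutes i (u i) (u (Suc i))"
    and zero: "u 0 zQ zP = 0"
  shows "\<exists>h. \<forall>i. degree_preserving (Suc i) i (h i) \<and>
    (\<forall>l\<in>Q (Suc i). \<forall>m\<in>P (Suc i).
        u (Suc i) l m = mm (Q (Suc (Suc i))) (DQ (Suc i)) (h (Suc i)) l m + mm (P i) (h i) (DP i) l m)"
proof -
  \<comment> \<open>On cycles the second summand of the homotopy relation vanishes.\<close>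
  define R where "R i h \<longleftrightarrow> degree_preserving (Suc i) i h \<and>
    (\<forall>v. polyvec V (P i) v \<longrightarrow> cycle I zP P DP i v \<longrightarrow>
        (\<forall>l\<in>Q i. mv (P i) (u i) v l = mv (Q (Suc i)) (DQ i) (mv (P i) h v) l))" for i h
  have "\<exists>h. \<forall>i. R i (h i) \<and> (\<forall>l\<in>Q (Suc i). \<forall>m\<in>P (Suc i).
        u (Suc i) l m = mm (Q (Suc (Suc i))) (DQ (Suc i)) (h (Suc i)) l m + mm (P i) (h i) (DP i) l m)"
  proof (rule dependent_nat_choice)
    show "\<exists>h. R 0 h"
      by (rule exI[of _ "\<lambda>_ _. 0"])
         (simp add: R_def P.basis_0 Q.basis_0 zero mv_def)
  next
    fix h i assume h: "R i h"
    let ?e = "\<lambda>l m. u (Suc i) l m - mm (P i) h (DP i) l m"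
    have "\<exists>w. (\<forall>l\<in>Q (Suc (Suc i)). homp V (dQ (Suc (Suc i)) l) (dP (Suc i) m) (w l)) \<and>
          (\<forall>l\<in>Q (Suc i). ?e l m = mv (Q (Suc (Suc i))) (DQ (Suc i)) w l)" if m: "m \<in> P (Suc i)" for m
    proof (rule Q.homogeneous_lift)
      show "homp V (dQ (Suc i) l) (dP (Suc i) m) (?e l m)" if "l \<in> Q (Suc i)" for l
        using h m that deg by (intro homp_diff homp_mm_column) (auto simp: R_def)
      have pv: "polyvec V (P i) (\<lambda>l. DP i l m)" using m by (auto simp: polyvec_def intro: P.entry_poly)
      have "mv (Q (Suc i)) (DQ i) (\<lambda>l. ?e l m) l = 0" if l: "l \<in> Q i" for l
      proof -
        have "mv (Q (Suc i)) (DQ i) (\<lambda>l. ?e l m) l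
            = mm (Q (Suc i)) (DQ i) (u (Suc i)) l m - mv (Q (Suc i)) (DQ i) (mv (P i) h (\<lambda>l. DP i l m)) l"
          by (simp add: mv_diff mm_column)
        also have "\<dots> = mm (P i) (u i) (DP i) l m - mv (P i) (u i) (\<lambda>l. DP i l m) l"
          using com l m h pv P.column_cycle[OF m] by (simp add: R_def)
        finally show ?thesis by (simp add: mm_column)
      qed
      thus "cycle I zQ Q DQ (Suc i) (\<lambda>l. ?e l m)" by simp
    qed
    then obtain w where w: "\<And>m. m \<in> P (Suc i) \<Longrightarrow> \<forall>l\<in>Q (Suc (Suc i)). homp V (dQ (Suc (Suc i)) l) (dP (Suc i) m) (w m l)"
        "\<And>m. m \<in> P (Suc i) \<Longrightarrow> \<forall>l\<in>Q (Suc i). ?e l m = mv (Q (Suc (Suc i))) (DQ (Suc i)) (w m) l"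
      by metis
    define h' where "h' l m = w m l" for l m
    have rel: "\<forall>l\<in>Q (Suc i). \<forall>m\<in>P (Suc i).
        u (Suc i) l m = mm (Q (Suc (Suc i))) (DQ (Suc i)) h' l m + mm (P i) h (DP i) l m"
      using w(2) by (force simp: mm_column[of "Q (Suc (Suc i))"] h'_def algebra_simps)
    have "mv (P (Suc i)) (u (Suc i)) v l = mv (Q (Suc (Suc i))) (DQ (Suc i)) (mv (P (Suc i)) h' v) l"
      if v: "cycle I zP P DP (Suc i) v" and l: "l \<in> Q (Suc i)" for v l
    proof -
      have "mv (P (Suc i)) (u (Suc i)) v l
          = mv (P (Suc i)) (\<lambda>l m. mm (Q (Suc (Suc i))) (DQ (Suc i)) h' l m + mm (P i) h (DP i) l m) v l"
        by (rule mv_cong) (use rel l in auto)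
      also have "\<dots> = mv (Q (Suc (Suc i))) (DQ (Suc i)) (mv (P (Suc i)) h' v) l
          + mv (P i) h (mv (P (Suc i)) (DP i) v) l"
        by (simp add: mv_add_matrix mv_mv)
      also have "mv (P i) h (mv (P (Suc i)) (DP i) v) l = mv (P i) h (\<lambda>_. 0) l"
        by (rule mv_cong) (use v in auto)
      finally show ?thesis by (simp add: mv_def[of "P i"])
    qed
    hence "R (Suc i) h'" using w(1) by (auto simp: R_def h'_def)
    with rel show "\<exists>h'. R (Suc i) h' \<and> (\<forall>l\<in>Q (Suc i). \<forall>m\<in>P (Suc i).
        u (Suc i) l m = mm (Q (Suc (Suc i))) (DQ (Suc i)) h' l m + mm (P i) h (DP i) l m)" by blast
  qed
  thus ?thesis unfolding R_def by blast
qed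

end

text \<open>
  Comparison maps in both directions are mutually inverse up to homotopy, as both their composite
  and the identity lift the identity of the ring.
\<close>

lemma (in resolution_pair) composite_homotopic_to_identity:
  assumes f: "\<And>i. degree_preserving i i (f i)" "\<And>i. commutes i (f i) (f (Suc i))" "f 0 zQ zP = 1"
    and g: "\<And>i l m. l \<in> P i \<Longrightarrow> m \<in> Q i \<Longrightarrow> homp V (dP i l) (dQ i m) (g i l m)"
      "\<And>i l m. l \<in> P i \<Longrightarrow> m \<in> Q (Suc i) \<Longrightarrow> mm (P (Suc i)) (DP i) (g (Suc i)) l m = mm (Q i) (g i) (DQ i) l m"
      "g 0 zP zQ = 1"
  shows "\<exists>h. \<forall>i. (\<forall>l\<in>P (Suc i). \<forall>m\<in>P i. homp V (dP (Suc i) l) (dP i m) (h i l m)) \<and>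
    (\<forall>l\<in>P (Suc i). \<forall>m\<in>P (Suc i).
        mm (Q (Suc i)) (g (Suc i)) (f (Suc i)) l m - (if l = m then 1 else 0) =
        mm (P (Suc (Suc i))) (DP (Suc i)) (h (Suc i)) l m + mm (P i) (h i) (DP i) l m)"
proof -
  interpret PP: resolution_pair V I zP P dP DP zP P dP DP ..
  define u where "u i l m = mm (Q i) (g i) (f i) l m - (if l = m then 1 else 0)" for i l m
  have "\<exists>h. \<forall>i. PP.degree_preserving (Suc i) i (h i) \<and>
    (\<forall>l\<in>P (Suc i). \<forall>m\<in>P (Suc i).
        u (Suc i) l m = mm (P (Suc (Suc i))) (DP (Suc i)) (h (Suc i)) l m + mm (P i) (h i) (DP i) l m)"
  proof (rule PP.homotopy_exists)
    show "PP.degree_preserving i i (u i)" for i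
      unfolding u_def mm_def
    proof (intro ballI homp_diff homp_sum)
      fix l m k assume "l \<in> P i" "m \<in> P i" "k \<in> Q i"
      thus "homp V (dP i l) (dP i m) (g i l k * f i k m)"
        using f(1) g(1) by (blast intro: homp_mult)
    qed auto
    show "u 0 zP zP = 0" using f(3) g(3) by (simp add: u_def mm_def Q.basis_0)
    show "PP.commutes i (u i) (u (Suc i))" for i
    proof (intro ballI)
      fix l m assume l: "l \<in> P i" and m: "m \<in> P (Suc i)"
      have "mm (P (Suc i)) (DP i) (u (Suc i)) l m
          = mv (P (Suc i)) (DP i) (mv (Q (Suc i)) (g (Suc i)) (\<lambda>k. f (Suc i) k m)) l - DP i l m"
        unfolding mm_column u_def by (simp add: mv_diff mv_unit[OF P.finite_basis m])
      also have "mv (P (Suc i)) (DP i) (mv (Q (Suc i)) (g (Suc i)) (\<lambda>k. f (Suc i) k m)) l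
          = mv (Q (Suc i)) (mm (Q i) (g i) (DQ i)) (\<lambda>k. f (Suc i) k m) l"
        unfolding mv_mv by (rule mv_cong) (use g(2) l in auto)
      also have "\<dots> = mv (Q i) (g i) (mv (Q (Suc i)) (DQ i) (\<lambda>k. f (Suc i) k m)) l"
        by (simp add: mv_mv)
      also have "\<dots> = mv (Q i) (g i) (mv (P i) (f i) (\<lambda>k. DP i k m)) l"
        by (rule mv_cong) (use f(2) m in \<open>auto simp: mm_column\<close>)
      also have "\<dots> - DP i l m = mm (P i) (u i) (DP i) l m"
        unfolding mm_column u_def
        by (simp add: mv_diff_matrix mv_id[OF P.finite_basis l] mv_mv mm_def[abs_def] mv_def[of "Q i"])
      finally show "mm (P (Suc i)) (DP i) (u (Suc i)) l m = mm (P i) (u i) (DP i) l m" .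
    qed
  qed
  thus ?thesis by (simp add: u_def)
qed

section \<open>The Taylor resolution of an edge ideal\<close>

text \<open>In characteristic two, antisymmetry alone leaves the diagonal arbitrary.\<close>

lemma antisymmetric_double_sum:
  fixes G :: "'a \<Rightarrow> 'a \<Rightarrow> 'r::ab_group_add"
  assumes "finite A" "\<And>x. G x x = 0" "\<And>x y. x \<in> A \<Longrightarrow> y \<in> A \<Longrightarrow> G x y = - G y x"
  shows "(\<Sum>x\<in>A. \<Sum>y\<in>A. G x y) = 0"
  using assms(1,3)
proof (induction A)
  case (insert a A)
  have "(\<Sum>x\<in>insert a A. \<Sum>y\<in>insert a A. G x y)
      = G a a + (\<Sum>y\<in>A. G a y) + ((\<Sum>x\<in>A. G x a) + (\<Sum>x\<in>A. \<Sum>y\<in>A. G x y))"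
    using insert.hyps by (simp add: sum.distrib)
  also have "(\<Sum>x\<in>A. G x a) = - (\<Sum>y\<in>A. G a y)"
    unfolding sum_negf[symmetric] by (rule sum.cong) (use insert.prems in blast)+
  also have "(\<Sum>x\<in>A. \<Sum>y\<in>A. G x y) = 0"
    by (rule insert.IH) (use insert.prems in blast)
  finally show ?case using assms(2) by simp
qed simp

text \<open>
  The chain complex of the full simplex on \<open>F\<close>. As a chain \<open>c\<close> is given by its coefficients, that of its
  boundary at the face \<open>T\<close> collects the contributions of the faces that are one vertex larger.
\<close>

definition sign :: "('e \<Rightarrow> nat) \<Rightarrow> 'e set \<Rightarrow> 'e \<Rightarrow> 'k::field" where
  "sign rk S e = (- 1) ^ card {f \<in> S. rk f < rk e}"

definition boundary :: "('e \<Rightarrow> nat) \<Rightarrow> 'e set \<Rightarrow> ('e set \<Rightarrow> 'k::field) \<Rightarrow> 'e set \<Rightarrow> 'k" where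
  "boundary rk F c T = (\<Sum>e\<in>F - T. sign rk (insert e T) e * c (insert e T))"

lemma sign_singleton [simp]: "sign rk {e} e = 1"
proof -
  have "{f \<in> {e}. rk f < rk e} = {}" by auto
  thus ?thesis unfolding sign_def by (metis card.empty power_0)
qed

lemma sign_swap:
  assumes "finite T" "rk e < rk f" "e \<notin> T" "f \<notin> T"
  shows "sign rk (insert f (insert e T)) e = (sign rk (insert e T) e :: 'k::field)"
    and "sign rk (insert f (insert e T)) f = - (sign rk (insert f T) f :: 'k::field)"
proof -
  have "{x \<in> insert f (insert e T). rk x < rk e} = {x \<in> insert e T. rk x < rk e}"
    using assms by auto
  thus "sign rk (insert f (insert e T)) e = (sign rk (insert e T) e :: 'k::field)"
    unfolding sign_def by simp
  have "{x \<in> insert f (insert e T). rk x < rk f} = insert e {x \<in> insert f T. rk x < rk f}"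
    using assms by auto
  moreover have "e \<notin> {x \<in> insert f T. rk x < rk f}" using assms by auto
  moreover have "finite {x \<in> insert f T. rk x < rk f}" using assms(1) by simp
  ultimately show "sign rk (insert f (insert e T)) f = - (sign rk (insert f T) f :: 'k::field)"
    unfolding sign_def by (simp del: insert_iff)
qed

lemma boundary_boundary:
  fixes c :: "'e set \<Rightarrow> 'k::field"
  assumes "finite F" "finite T" "inj_on rk F"
  shows "boundary rk F (boundary rk F c) T = 0"
proof -
  define G :: "'e \<Rightarrow> 'e \<Rightarrow> 'k" where
    "G e f = (if e = f then 0 else sign rk (insert e T) e *
      (sign rk (insert f (insert e T)) f * c (insert f (insert e T))))" for e f
  have "boundary rk F (boundary rk F c) T = (\<Sum>e\<in>F - T. \<Sum>f\<in>F - T. G e f)"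
    unfolding boundary_def
  proof (intro sum.cong refl)
    fix e assume e: "e \<in> F - T"
    have "(\<Sum>f\<in>F - T. G e f) = (\<Sum>f\<in>F - insert e T. G e f)"
      using assms(1) by (intro sum.mono_neutral_right) (auto simp: G_def)
    also have "\<dots> = sign rk (insert e T) e *
        (\<Sum>f\<in>F - insert e T. sign rk (insert f (insert e T)) f * c (insert f (insert e T)))"
      unfolding sum_distrib_left by (intro sum.cong) (auto simp: G_def)
    finally show "sign rk (insert e T) e *
        (\<Sum>f\<in>F - insert e T. sign rk (insert f (insert e T)) f * c (insert f (insert e T)))
        = (\<Sum>f\<in>F - T. G e f)" ..
  qed
  also have "\<dots> = 0"
  proof (rule antisymmetric_double_sum)
    fix e f assume ef: "e \<in> F - T" "f \<in> F - T"
    have *: "G e f = - G f e" if "rk e < rk f" "e \<in> F - T" "f \<in> F - T" for e f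
      using that sign_swap[OF assms(2) that(1), where 'k = 'k]
      by (auto simp: G_def insert_commute[of e f])
    show "G e f = - G f e"
    proof (cases "e = f")
      case False
      hence "rk e \<noteq> rk f" using ef assms(3) by (auto dest: inj_onD)
      thus ?thesis using *[of e f] *[of f e] ef by (cases "rk e < rk f") auto
    qed (simp add: G_def)
  qed (use assms in \<open>auto simp: G_def\<close>)
  finally show ?thesis .
qed

text \<open>The cone with the least vertex \<open>e\<^sub>0\<close> as apex is a contraction of the simplex.\<close>

lemma boundary_cone:
  fixes c :: "'e set \<Rightarrow> 'k::field"
  assumes F: "finite F" and e0: "e0 \<in> F" "\<And>f. f \<in> F \<Longrightarrow> rk e0 \<le> rk f" "inj_on rk F"
    and T: "T \<subseteq> F" and cyc: "e0 \<in> T \<Longrightarrow> boundary rk F c (T - {e0}) = 0"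
  shows "boundary rk F (\<lambda>S. if e0 \<in> S then c (S - {e0}) else 0) T = c T"
proof -
  have finT: "finite T" using T F finite_subset by blast
  have sign_e0: "sign rk (insert e0 T) e0 = (1::'k)" if "T \<subseteq> F" for T
  proof -
    have "{f \<in> insert e0 T. rk f < rk e0} = {}" using e0(2) that by force
    thus ?thesis unfolding sign_def by (metis card.empty power_0)
  qed
  let ?w = "\<lambda>S. if e0 \<in> S then c (S - {e0}) else 0"
  show ?thesis
  proof (cases "e0 \<in> T")
    case False
    have "boundary rk F ?w T = (\<Sum>e\<in>F - T. if e = e0 then sign rk (insert e T) e * c T else 0)"
      unfolding boundary_def using False by (intro sum.cong) auto
    also have "\<dots> = c T" using F e0(1) False sign_e0[OF T] by (simp add: sum.delta)
    finally show ?thesis .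
  next
    case True
    define T' where "T' = T - {e0}"
    have T': "T = insert e0 T'" "e0 \<notin> T'" "T' \<subseteq> F" "finite T'"
      using True T finT by (auto simp: T'_def)
    have "boundary rk F ?w T = (\<Sum>e\<in>F - T. - (sign rk (insert e T') e * c (insert e T')))"
      unfolding boundary_def
    proof (intro sum.cong refl)
      fix e assume e: "e \<in> F - T"
      hence "e \<noteq> e0" using True by auto
      hence "rk e0 < rk e" using e0 e by (metis DiffD1 inj_onD le_neq_implies_less)
      hence "sign rk (insert e T) e = - (sign rk (insert e T') e :: 'k)"
        using sign_swap(2)[of T' rk e0 e] T' e by auto
      moreover have "insert e T - {e0} = insert e T'" using T' \<open>e \<noteq> e0\<close> by auto
      ultimately show "sign rk (insert e T) e * ?w (insert e T) = - (sign rk (insert e T') e * c (insert e T'))"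
        using True by simp
    qed
    also have "\<dots> = - (boundary rk F c T' - c T)"
    proof -
      have "F - T' = insert e0 (F - T)" using T' e0(1) by auto
      hence "boundary rk F c T' = sign rk (insert e0 T') e0 * c (insert e0 T')
          + (\<Sum>e\<in>F - T. sign rk (insert e T') e * c (insert e T'))"
        unfolding boundary_def using True F by simp
      thus ?thesis using sign_e0[OF T'(3)] T'(1) by (simp add: sum_negf)
    qed
    finally show ?thesis using cyc True by (simp add: T'_def)
  qed
qed

definition sqf_mon :: "'v set \<Rightarrow> 'v \<Rightarrow>\<^sub>0 nat" where
  "sqf_mon U = (\<Sum>u\<in>U. Poly_Mapping.single u 1)"

lemma lookup_sqf_mon:
  assumes "finite U"
  shows "Poly_Mapping.lookup (sqf_mon U) u = (if u \<in> U then 1 else 0)"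
proof -
  have "Poly_Mapping.lookup (sqf_mon U) u = (\<Sum>x\<in>U. if x = u then 1 else 0)"
    unfolding sqf_mon_def by (simp only: lookup_sum lookup_single when_def)
  thus ?thesis using assms by (simp add: sum.delta' cong: if_cong)
qed

lemma keys_sqf_mon: "finite U \<Longrightarrow> Poly_Mapping.keys (sqf_mon U) = U"
  by (auto simp: in_keys_iff lookup_sqf_mon split: if_splits)

lemma mon_deg_sqf_mon: "finite U \<Longrightarrow> mon_deg (sqf_mon U) = card U"
  by (simp add: mon_deg_def keys_sqf_mon lookup_sqf_mon)

text \<open>
  At most one summand is nonzero, as \<open>T\<close> determines the edge that it lacks. The monomial is the quotient
  of the least common multiples of the edge monomials in \<open>S\<close> and in \<open>T\<close>.
\<close>

definition taylor :: "('v set \<Rightarrow> nat) \<Rightarrow> nat \<Rightarrow> 'v set set \<Rightarrow> 'v set set \<Rightarrow> ('v, 'k::field) mpoly" where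
  "taylor rk i T S = (\<Sum>e\<in>S. if T = S - {e}
     then Poly_Mapping.single (sqf_mon (\<Union>S - \<Union>T)) (sign rk S e) else 0)"

definition faces :: "'v set set \<Rightarrow> nat \<Rightarrow> 'v set set set" where
  "faces E i = {S. S \<subseteq> E \<and> card S = i}"

locale finite_graph =
  fixes V :: "'v set" and E :: "'v set set"
  assumes finite_V: "finite V" and edges_sub: "e \<in> E \<Longrightarrow> e \<subseteq> V" and card_edge: "e \<in> E \<Longrightarrow> card e = 2"
begin

lemma finite_E: "finite E"
  by (rule finite_subset[of _ "Pow V"]) (use finite_V edges_sub in auto)

lemma finite_faces: "finite (faces E i)"
  using finite_E by (auto simp: faces_def intro: finite_subset[of _ "Pow E"])

lemma finite_face: "S \<subseteq> E \<Longrightarrow> finite S"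
  using finite_E finite_subset by blast

lemma Union_sub: "S \<subseteq> E \<Longrightarrow> \<Union>S \<subseteq> V"
  using edges_sub by blast

lemma finite_covered: "S \<subseteq> E \<Longrightarrow> finite (\<Union>S)"
  by (rule finite_subset[OF Union_sub finite_V])

lemma card_covered_le:
  assumes "S \<subseteq> E"
  shows "card (\<Union>S) \<le> 2 * card S"
proof -
  have "card (\<Union>S) \<le> (\<Sum>e\<in>S. card e)" by (rule card_Union_le_sum_card)
  also have "\<dots> = (\<Sum>e\<in>S. 2)" using assms card_edge by (intro sum.cong) auto
  finally show ?thesis by simp
qed

text \<open>
  As \<open>m\<close> edges cover at most \<open>2m\<close> vertices, there is no room for an overlap.
\<close>

lemma matching_disjoint:
  assumes "M \<subseteq> E" "card (\<Union>M) = 2 * card M" "f \<in> M"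
  shows "f \<inter> \<Union>(M - {f}) = {}"
proof -
  let ?R = "\<Union>(M - {f})"
  have fin: "finite f" "finite ?R" and f2: "card f = 2" "finite M"
    using finite_covered[of "{f}"] finite_covered[of "M - {f}"] finite_face assms card_edge by auto
  have "card ?R \<le> 2 * (card M - 1)" using card_covered_le[of "M - {f}"] assms f2 by auto
  moreover have "card (f \<union> ?R) = 2 * card M"
    using assms by (simp add: insert_absorb flip: Union_insert)
  moreover have "card f + card ?R = card (f \<union> ?R) + card (f \<inter> ?R)"
    using fin by (rule card_Un_Int)
  moreover have "card M > 0" using assms(3) f2 by (auto simp: card_gt_0_iff)
  ultimately have "card (f \<inter> ?R) = 0" using f2 by linarith
  thus ?thesis using fin by simp
qed

end

locale ordered_graph = finite_graph V E for V :: "'v set" and E :: "'v set set" +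
  fixes rk :: "'v set \<Rightarrow> nat"
  assumes inj_rk: "inj_on rk E"
begin

lemma taylor_remove:
  assumes "S \<subseteq> E" "e \<in> S"
  shows "taylor rk i (S - {e}) S = Poly_Mapping.single (sqf_mon (\<Union>S - \<Union>(S - {e}))) (sign rk S e)"
proof -
  have "(S - {e} = S - {f}) = (f = e)" if "f \<in> S" for f using that assms by blast
  hence "taylor rk i (S - {e}) S = (\<Sum>f\<in>S. if f = e
     then Poly_Mapping.single (sqf_mon (\<Union>S - \<Union>(S - {e}))) (sign rk S f) else 0)"
    unfolding taylor_def by (intro sum.cong) auto
  thus ?thesis using assms finite_face[of S] by (simp add: sum.delta')
qed

lemma taylor_nonzero:
  assumes "taylor rk i T S \<noteq> (0 :: ('v, 'k::field) mpoly)"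
  obtains e where "e \<in> S" "T = S - {e}"
proof -
  have "\<exists>e\<in>S. T = S - {e}"
  proof (rule ccontr)
    assume "\<not> ?thesis"
    hence "taylor rk i T S = (0 :: ('v, 'k) mpoly)" unfolding taylor_def by (intro sum.neutral) auto
    thus False using assms by simp
  qed
  thus ?thesis using that by blast
qed

lemma taylor_homp:
  assumes "S \<subseteq> E"
  shows "homp V (card (\<Union>T)) (card (\<Union>S)) (taylor rk i T S :: ('v, 'k::field) mpoly)"
proof (cases "taylor rk i T S = (0 :: ('v, 'k) mpoly)")
  case False
  then obtain e where e: "e \<in> S" "T = S - {e}" by (rule taylor_nonzero)
  have fin: "finite (\<Union>S - \<Union>T)" "finite (\<Union>S)" using finite_covered[OF assms] by auto
  have "\<Union>T \<subseteq> \<Union>S" using e by auto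
  hence "card (\<Union>T) + card (\<Union>S - \<Union>T) = card (\<Union>S)"
    using fin by (simp add: card_Diff_subset card_mono finite_subset)
  thus ?thesis unfolding e(2) taylor_remove[OF assms e(1)]
    using fin Union_sub[OF assms] e(2)
    by (auto simp: homp_def mon_deg_sqf_mon keys_sqf_mon intro!: poly_ring_single)
qed simp

lemma mv_taylor:
  fixes v :: "'v set set \<Rightarrow> ('v, 'k::field) mpoly"
  assumes "T \<in> faces E i"
  shows "mv (faces E (Suc i)) (taylor rk i) v T
    = (\<Sum>e\<in>E - T. Poly_Mapping.single (sqf_mon (\<Union>(insert e T) - \<Union>T)) (sign rk (insert e T) e) * v (insert e T))"
proof -
  have T: "T \<subseteq> E" "card T = i" "finite T" using assms finite_face by (auto simp: faces_def)
  let ?g = "\<lambda>S. taylor rk i T S * v S"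
  have "mv (faces E (Suc i)) (taylor rk i) v T = sum ?g ((\<lambda>e. insert e T) ` (E - T))"
    unfolding mv_def
  proof (rule sum.mono_neutral_right[OF finite_faces])
    show "(\<lambda>e. insert e T) ` (E - T) \<subseteq> faces E (Suc i)" using T by (auto simp: faces_def)
    show "\<forall>S\<in>faces E (Suc i) - (\<lambda>e. insert e T) ` (E - T). taylor rk i T S * v S = 0"
    proof
      fix S assume S: "S \<in> faces E (Suc i) - (\<lambda>e. insert e T) ` (E - T)"
      have "taylor rk i T S = (0 :: ('v, 'k) mpoly)"
      proof (rule ccontr)
        assume "taylor rk i T S \<noteq> (0 :: ('v, 'k) mpoly)"
        then obtain e where "e \<in> S" "T = S - {e}" by (rule taylor_nonzero)
        hence "S = insert e T" "e \<in> E - T" using S by (auto simp: faces_def)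
        thus False using S by blast
      qed
      thus "taylor rk i T S * v S = 0" by simp
    qed
  qed
  also have "\<dots> = (\<Sum>e\<in>E - T. ?g (insert e T))"
    by (subst sum.reindex) (auto intro!: inj_onI)
  also have "\<dots> = (\<Sum>e\<in>E - T. Poly_Mapping.single (sqf_mon (\<Union>(insert e T) - \<Union>T)) (sign rk (insert e T) e) * v (insert e T))"
  proof (intro sum.cong refl)
    fix e assume e: "e \<in> E - T"
    show "?g (insert e T) = Poly_Mapping.single (sqf_mon (\<Union>(insert e T) - \<Union>T)) (sign rk (insert e T) e) * v (insert e T)"
    proof -
      have "taylor rk i (insert e T - {e}) (insert e T) = (Poly_Mapping.single
          (sqf_mon (\<Union>(insert e T) - \<Union>(insert e T - {e}))) (sign rk (insert e T) e) :: ('v, 'k) mpoly)"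
        by (rule taylor_remove) (use e T in auto)
      moreover have "insert e T - {e} = T" using e by auto
      ultimately show ?thesis by simp
    qed
  qed
  finally show ?thesis .
qed

text \<open>
  The Taylor complex is graded by the exponent vectors \<open>a\<close>, a basis element \<open>S\<close> having as multidegree
  the least common multiple of the edge monomials in \<open>S\<close>. Its strand in multidegree \<open>a\<close> is the
  simplex on the edges whose monomial divides \<open>a\<close>.
\<close>

definition edges_below :: "('v \<Rightarrow>\<^sub>0 nat) \<Rightarrow> 'v set set" where
  "edges_below a = {e \<in> E. \<forall>u\<in>e. 0 < Poly_Mapping.lookup a u}"

definition strand :: "('v set set \<Rightarrow> ('v, 'k::field) mpoly) \<Rightarrow> ('v \<Rightarrow>\<^sub>0 nat) \<Rightarrow> 'v set set \<Rightarrow> 'k" where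
  "strand v a S = (if S \<subseteq> edges_below a then Poly_Mapping.lookup (v S) (a - sqf_mon (\<Union>S)) else 0)"

lemma edges_below_sub: "edges_below a \<subseteq> E"
  by (auto simp: edges_below_def)

lemma finite_edges_below: "finite (edges_below a)"
  using edges_below_sub finite_E finite_subset by blast

lemma below_iff:
  assumes "S \<subseteq> E"
  shows "S \<subseteq> edges_below a \<longleftrightarrow> sqf_mon (\<Union>S) + (a - sqf_mon (\<Union>S)) = a"
proof
  assume "S \<subseteq> edges_below a"
  hence "\<And>u. u \<in> \<Union>S \<Longrightarrow> 0 < Poly_Mapping.lookup a u" by (auto simp: edges_below_def)
  thus "sqf_mon (\<Union>S) + (a - sqf_mon (\<Union>S)) = a"
    using finite_covered[OF assms]
    by (intro poly_mapping_eqI) (auto simp: lookup_add lookup_minus lookup_sqf_mon Suc_leI)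
next
  assume *: "sqf_mon (\<Union>S) + (a - sqf_mon (\<Union>S)) = a"
  have "0 < Poly_Mapping.lookup a u" if "u \<in> \<Union>S" for u
    using arg_cong[OF *, of "\<lambda>s. Poly_Mapping.lookup s u"] finite_covered[OF assms] that
    by (auto simp: lookup_add lookup_sqf_mon)
  thus "S \<subseteq> edges_below a" using assms by (auto simp: edges_below_def)
qed

lemma below_shift: "S \<subseteq> E \<Longrightarrow> S \<subseteq> edges_below (sqf_mon (\<Union>S) + s)"
  using finite_covered[of S] by (auto simp: edges_below_def lookup_add lookup_sqf_mon)

lemma strand_shift: "S \<subseteq> E \<Longrightarrow> strand v (sqf_mon (\<Union>S) + s) S = Poly_Mapping.lookup (v S) s"
  by (simp add: strand_def below_shift)

lemma eq_iff_strands: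
  assumes "S \<subseteq> E"
  shows "v S = w S \<longleftrightarrow> (\<forall>a. strand v a S = strand w a S)"
proof
  assume *: "\<forall>a. strand v a S = strand w a S"
  show "v S = w S"
  proof (rule poly_mapping_eqI)
    fix s
    show "Poly_Mapping.lookup (v S) s = Poly_Mapping.lookup (w S) s"
      using *[rule_format, of "sqf_mon (\<Union>S) + s"] assms by (simp add: strand_shift)
  qed
qed (simp add: strand_def)

lemma strand_mv_taylor:
  assumes T: "T \<in> faces E i" "T \<subseteq> edges_below a"
  shows "strand (mv (faces E (Suc i)) (taylor rk i) v) a T = boundary rk (edges_below a) (strand v a) T"
proof -
  have TE: "T \<subseteq> E" using T by (simp add: faces_def)
  let ?s = "a - sqf_mon (\<Union>T)"
  have a: "sqf_mon (\<Union>T) + ?s = a" using T(2) below_iff[OF TE] by blast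
  have split: "sqf_mon (\<Union>(insert e T)) = sqf_mon (\<Union>T) + sqf_mon (\<Union>(insert e T) - \<Union>T)"
    if "e \<in> E" for e
    using finite_covered[of "insert e T"] finite_covered[OF TE] that TE
    by (intro poly_mapping_eqI) (auto simp: lookup_add lookup_sqf_mon)
  have "strand (mv (faces E (Suc i)) (taylor rk i) v) a T
     = (\<Sum>e\<in>E - T. Poly_Mapping.lookup (Poly_Mapping.single (sqf_mon (\<Union>(insert e T) - \<Union>T))
          (sign rk (insert e T) e) * v (insert e T)) ?s)"
    using T by (simp add: strand_def mv_taylor lookup_sum)
  also have "\<dots> = (\<Sum>e\<in>edges_below a - T. Poly_Mapping.lookup (Poly_Mapping.single
          (sqf_mon (\<Union>(insert e T) - \<Union>T)) (sign rk (insert e T) e) * v (insert e T)) ?s)"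
  proof (rule sum.mono_neutral_right)
    show "\<forall>e\<in>E - T - (edges_below a - T). Poly_Mapping.lookup (Poly_Mapping.single
          (sqf_mon (\<Union>(insert e T) - \<Union>T)) (sign rk (insert e T) e) * v (insert e T)) ?s = 0"
    proof
      fix e assume e: "e \<in> E - T - (edges_below a - T)"
      show "Poly_Mapping.lookup (Poly_Mapping.single
          (sqf_mon (\<Union>(insert e T) - \<Union>T)) (sign rk (insert e T) e) * v (insert e T)) ?s = 0"
      proof (rule lookup_single_mult_eq_0)
        fix u
        show "?s \<noteq> sqf_mon (\<Union>(insert e T) - \<Union>T) + u"
        proof
          assume "?s = sqf_mon (\<Union>(insert e T) - \<Union>T) + u"
          hence "a = sqf_mon (\<Union>(insert e T)) + u"
            using a split[of e] e by (metis DiffD1 add.assoc)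
          hence "insert e T \<subseteq> edges_below a" using below_shift[of "insert e T" u] e TE by auto
          thus False using e by auto
        qed
      qed
    qed
  qed (use finite_E edges_below_sub in auto)
  also have "\<dots> = boundary rk (edges_below a) (strand v a) T"
    unfolding boundary_def
  proof (intro sum.cong refl)
    fix e assume e: "e \<in> edges_below a - T"
    hence eE: "e \<in> E" using edges_below_sub by auto
    have sub: "insert e T \<subseteq> edges_below a" "insert e T \<subseteq> E" using e T(2) eE TE by auto
    let ?m = "sqf_mon (\<Union>(insert e T) - \<Union>T)" and ?u = "a - sqf_mon (\<Union>(insert e T))"
    have "sqf_mon (\<Union>T) + (?m + ?u) = sqf_mon (\<Union>T) + ?s"
      using below_iff[OF sub(2)] sub(1) split[OF eE] a by (simp add: add.assoc)
    hence "?s = ?m + ?u" by simp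
    thus "Poly_Mapping.lookup (Poly_Mapping.single ?m (sign rk (insert e T) e) * v (insert e T)) ?s
        = sign rk (insert e T) e * strand v a (insert e T)"
      using sub(1) by (simp add: lookup_single_mult strand_def)
  qed
  finally show ?thesis .
qed

text \<open>
  Strand by strand, this is \<open>boundary_boundary\<close>.
\<close>

lemma taylor_squared:
  assumes "T \<in> faces E i"
  shows "mv (faces E (Suc i)) (taylor rk i) (mv (faces E (Suc (Suc i))) (taylor rk (Suc i)) w) T = 0"
proof -
  have TE: "T \<subseteq> E" "finite T" using assms finite_face by (auto simp: faces_def)
  let ?v = "mv (faces E (Suc (Suc i))) (taylor rk (Suc i)) w"
  have "strand (mv (faces E (Suc i)) (taylor rk i) ?v) a T = strand (\<lambda>_. 0) a T" for a
  proof (cases "T \<subseteq> edges_below a")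
    case True
    have "boundary rk (edges_below a) (strand ?v a) T
        = boundary rk (edges_below a) (boundary rk (edges_below a) (strand w a)) T"
      unfolding boundary_def[of _ _ "strand ?v a"] boundary_def[of _ _ "boundary _ _ _"]
    proof (intro sum.cong refl)
      fix e assume e: "e \<in> edges_below a - T"
      hence "insert e T \<in> faces E (Suc i)" using assms edges_below_sub TE by (auto simp: faces_def)
      thus "sign rk (insert e T) e * strand ?v a (insert e T)
          = sign rk (insert e T) e * boundary rk (edges_below a) (strand w a) (insert e T)"
        using e True by (simp add: strand_mv_taylor)
    qed
    also have "\<dots> = 0"
      by (rule boundary_boundary[OF finite_edges_below TE(2)])
         (use inj_rk edges_below_sub inj_on_subset in blast)
    finally show ?thesis using True assms by (simp add: strand_mv_taylor strand_def[of "\<lambda>_. 0"])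
  qed (simp add: strand_def)
  thus ?thesis using eq_iff_strands[OF TE(1), of "mv (faces E (Suc i)) (taylor rk i) ?v" "\<lambda>_. 0"] by simp
qed

text \<open>
  Strand by strand, a cycle is the boundary of the cone over it. The apex, the first edge whose
  monomial divides \<open>a\<close>, depends on the multidegree \<open>a\<close>, so the preimage \<open>w\<close> is put together coefficient
  by coefficient.
\<close>

lemma taylor_exact:
  assumes v: "polyvec V (faces E (Suc i)) v"
    and cyc: "\<And>T. T \<in> faces E i \<Longrightarrow> mv (faces E (Suc i)) (taylor rk i) v T = 0"
  shows "\<exists>w. polyvec V (faces E (Suc (Suc i))) w \<and>
    (\<forall>T\<in>faces E (Suc i). v T = mv (faces E (Suc (Suc i))) (taylor rk (Suc i)) w T)"
proof -
  define e0 where "e0 a = arg_min_on rk (edges_below a)" for a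
  have e0: "e0 a \<in> edges_below a" "\<And>f. f \<in> edges_below a \<Longrightarrow> rk (e0 a) \<le> rk f"
    if "edges_below a \<noteq> {}" for a
    using arg_min_if_finite[OF finite_edges_below that, of rk]
      arg_min_least[OF finite_edges_below that] by (auto simp: e0_def)
  define c where "c S s = (let a = sqf_mon (\<Union>S) + s in
      if e0 a \<in> S then strand v a (S - {e0 a}) else 0)" for S s
  \<comment> \<open>Only finitely many multidegrees occur in \<open>v\<close>.\<close>
  define W where "W S = (\<Union>e\<in>S. (\<lambda>s. s + sqf_mon (\<Union>(S - {e})) - sqf_mon (\<Union>S)) ` Poly_Mapping.keys (v (S - {e})))" for S
  have supp: "{s. c S s \<noteq> 0} \<subseteq> W S" if S: "S \<subseteq> E" for S
  proof
    fix s assume "s \<in> {s. c S s \<noteq> 0}"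
    hence s: "c S s \<noteq> 0" by simp
    let ?a = "sqf_mon (\<Union>S) + s"
    let ?e = "e0 ?a"
    have e: "?e \<in> S" "strand v ?a (S - {?e}) \<noteq> 0" using s by (auto simp: c_def Let_def split: if_splits)
    let ?u = "?a - sqf_mon (\<Union>(S - {?e}))"
    have u: "?u \<in> Poly_Mapping.keys (v (S - {?e}))" and sub: "S - {?e} \<subseteq> edges_below ?a"
      using e(2) by (auto simp: strand_def in_keys_iff split: if_splits)
    have "sqf_mon (\<Union>(S - {?e})) + ?u = ?a" using below_iff[of "S - {?e}" ?a] sub S by blast
    hence "s = ?u + sqf_mon (\<Union>(S - {?e})) - sqf_mon (\<Union>S)"
      by (metis add.commute add_diff_cancel_left')
    thus "s \<in> W S" using e(1) u unfolding W_def by blast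
  qed
  have finW: "finite {s. c S s \<noteq> 0}" if "S \<subseteq> E" for S
    by (rule finite_subset[OF supp[OF that]]) (use finite_face[OF that] in \<open>auto simp: W_def\<close>)
  define w where "w S = Abs_poly_mapping (c S)" for S
  have lookup_w: "Poly_Mapping.lookup (w S) s = c S s" if "S \<subseteq> E" for S s
    unfolding w_def using finW[OF that] by simp
  have "w S \<in> poly_ring V" if S: "S \<in> faces E (Suc (Suc i))" for S
    unfolding poly_ring_def
  proof safe
    fix s x assume s: "s \<in> Poly_Mapping.keys (w S)" and x: "x \<in> Poly_Mapping.keys s"
    have SE: "S \<subseteq> E" "card S = Suc (Suc i)" using S by (auto simp: faces_def)
    have "s \<in> W S" using supp[OF SE(1)] s by (auto simp: in_keys_iff lookup_w[OF SE(1)])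
    then obtain e u where e: "e \<in> S" "u \<in> Poly_Mapping.keys (v (S - {e}))"
        "s = u + sqf_mon (\<Union>(S - {e})) - sqf_mon (\<Union>S)" by (auto simp: W_def)
    have "S - {e} \<in> faces E (Suc i)" using SE e(1) finite_face[OF SE(1)] by (auto simp: faces_def)
    hence "v (S - {e}) \<in> poly_ring V" using v by (simp add: polyvec_def)
    hence "Poly_Mapping.keys u \<subseteq> V" using e(2) by (auto simp: poly_ring_def)
    moreover have "x \<in> Poly_Mapping.keys u \<or> x \<in> \<Union>(S - {e})"
    proof -
      have "finite (\<Union>(S - {e}))" by (rule finite_subset[OF _ finite_covered[OF SE(1)]]) auto
      thus ?thesis using x unfolding e(3)
        by (auto simp: in_keys_iff lookup_minus lookup_add lookup_sqf_mon split: if_splits)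
    qed
    ultimately show "x \<in> V" using Union_sub[OF SE(1)] by blast
  qed
  hence "polyvec V (faces E (Suc (Suc i))) w" by (simp add: polyvec_def)
  moreover have "v T = mv (faces E (Suc (Suc i))) (taylor rk (Suc i)) w T" if T: "T \<in> faces E (Suc i)" for T
  proof -
    have TE: "T \<subseteq> E" "T \<noteq> {}" using T by (auto simp: faces_def)
    have "strand v a T = strand (mv (faces E (Suc (Suc i))) (taylor rk (Suc i)) w) a T" for a
    proof (cases "T \<subseteq> edges_below a")
      case True
      hence ne: "edges_below a \<noteq> {}" using TE by auto
      have w: "strand w a S = (if e0 a \<in> S then strand v a (S - {e0 a}) else 0)"
        if "S \<subseteq> edges_below a" for S
      proof -
        have "S \<subseteq> E" using that edges_below_sub by auto
        thus ?thesis using that below_iff[of S a] by (simp add: strand_def[of w] lookup_w c_def)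
      qed
      have "strand (mv (faces E (Suc (Suc i))) (taylor rk (Suc i)) w) a T
          = boundary rk (edges_below a) (strand w a) T"
        using T True by (rule strand_mv_taylor)
      also have "\<dots> = boundary rk (edges_below a) (\<lambda>S. if e0 a \<in> S then strand v a (S - {e0 a}) else 0) T"
        unfolding boundary_def using True by (intro sum.cong refl) (subst w, auto)
      also have "\<dots> = strand v a T"
      proof (rule boundary_cone)
        show "finite (edges_below a)" "e0 a \<in> edges_below a" "T \<subseteq> edges_below a"
          using finite_edges_below e0(1)[OF ne] True by auto
        show "rk (e0 a) \<le> rk f" if "f \<in> edges_below a" for f using e0(2)[OF ne that] .
        show "inj_on rk (edges_below a)" using inj_rk edges_below_sub inj_on_subset by blast
        assume "e0 a \<in> T"
        hence "T - {e0 a} \<in> faces E i" using T finite_face[OF TE(1)] by (auto simp: faces_def)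
        thus "boundary rk (edges_below a) (strand v a) (T - {e0 a}) = 0"
          using True cyc strand_mv_taylor[of "T - {e0 a}" i a v] by (force simp: strand_def)
      qed
      finally show ?thesis ..
    qed (simp add: strand_def)
    thus ?thesis using eq_iff_strands[OF TE(1)] by blast
  qed
  ultimately show ?thesis by blast
qed

lemma mv_taylor_0:
  "mv (faces E (Suc 0)) (taylor rk 0) w {} = (\<Sum>e\<in>E. Poly_Mapping.single (sqf_mon e) 1 * w {e})"
  by (subst mv_taylor) (auto simp: faces_def finite_subset intro!: sum.cong)

lemma edge_ideal_iff:
  "p \<in> edge_ideal V E \<longleftrightarrow>
    (\<exists>w. (\<forall>e\<in>E. w e \<in> poly_ring V) \<and> p = (\<Sum>e\<in>E. Poly_Mapping.single (sqf_mon e) 1 * w e))"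
  (is "?l \<longleftrightarrow> ?r")
proof -
  let ?m = "\<lambda>e. Poly_Mapping.single (sqf_mon e) (1::'a)"
  have inj: "inj_on ?m E"
  proof (rule inj_onI)
    fix e f assume ef: "e \<in> E" "f \<in> E" "?m e = ?m f"
    have "finite e" "finite f" using ef(1,2) edges_sub finite_V finite_subset by blast+
    moreover have "Poly_Mapping.keys (?m e) = Poly_Mapping.keys (?m f)" using ef(3) by simp
    ultimately show "e = f" using keys_sqf_mon by (metis keys_single singleton_inject zero_neq_one)
  qed
  have pair: "Var a * Var b = ?m {a, b}" if "{a, b} \<in> E" for a b
  proof -
    have "a \<noteq> b" using card_edge[OF that] by auto
    thus ?thesis by (simp add: Var_def mult_single sqf_mon_def)
  qed
  have gens: "{Var a * Var b | a b. {a, b} \<in> E} = ?m ` E"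
  proof
    show "?m ` E \<subseteq> {Var a * Var b | a b. {a, b} \<in> E}"
    proof
      fix x assume "x \<in> ?m ` E"
      then obtain e where e: "e \<in> E" "x = ?m e" by auto
      obtain a b where "e = {a, b}" using card_edge[OF e(1)] by (meson card_2_iff)
      hence "x = Var a * Var b" "{a, b} \<in> E" using e pair[of a b] by auto
      thus "x \<in> {Var a * Var b | a b. {a, b} \<in> E}" by blast
    qed
  qed (use pair in auto)
  have eq: "p \<in> edge_ideal V E \<longleftrightarrow> (\<exists>A c. p = (\<Sum>g\<in>A. c g * g) \<and> finite A \<and> A \<subseteq> ?m ` E \<and> (\<forall>g\<in>A. c g \<in> poly_ring V))"
    unfolding edge_ideal_def ideal_gen_def gens by auto
  show ?thesis
  proof
    assume ?l
    then obtain A c where A: "p = (\<Sum>g\<in>A. c g * g)" "finite A" "A \<subseteq> ?m ` E" "\<forall>g\<in>A. c g \<in> poly_ring V"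
      unfolding eq by blast
    let ?w = "\<lambda>e. if ?m e \<in> A then c (?m e) else 0"
    have "p = (\<Sum>g\<in>?m ` E. if g \<in> A then c g * g else 0)"
      unfolding A(1) using A(3) finite_E
      by (simp add: sum.inter_restrict[symmetric] Int_absorb1)
    also have "\<dots> = (\<Sum>e\<in>E. ?m e * ?w e)"
      by (subst sum.reindex[OF inj]) (auto intro!: sum.cong simp: mult.commute)
    finally show ?r using A(4) by (intro exI[of _ ?w]) auto
  next
    assume ?r
    then obtain w where w: "\<forall>e\<in>E. w e \<in> poly_ring V" "p = (\<Sum>e\<in>E. ?m e * w e)" by blast
    let ?c = "\<lambda>g. w (the_inv_into E ?m g)"
    have "p = (\<Sum>g\<in>?m ` E. ?c g * g)"
      unfolding w(2) by (subst sum.reindex[OF inj]) (auto intro!: sum.cong simp: the_inv_into_f_f[OF inj] mult.commute)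
    moreover have "\<forall>g\<in>?m ` E. ?c g \<in> poly_ring V" using w(1) by (auto simp: the_inv_into_f_f[OF inj])
    ultimately show ?l unfolding eq using finite_E by (intro exI[of _ "?m ` E"] exI[of _ ?c]) simp
  qed
qed

lemma faces_0: "faces E 0 = {{}}"
  using finite_face by (auto simp: faces_def)

theorem taylor_resolution:
  "resolution V (edge_ideal V E) {} (faces E) (\<lambda>i S. card (\<Union>S)) (taylor rk)"
proof
  fix i and v :: "'v set set \<Rightarrow> ('v, 'a) mpoly"
  assume v: "polyvec V (faces E i) v"
  show "cycle (edge_ideal V E) {} (faces E) (taylor rk) i v \<longleftrightarrow>
        (\<exists>w. polyvec V (faces E (Suc i)) w \<and> (\<forall>T\<in>faces E i. v T = mv (faces E (Suc i)) (taylor rk i) w T))"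
  proof (cases i)
    case 0
    have f1: "faces E (Suc 0) = (\<lambda>e. {e}) ` E"
      by (auto simp: faces_def card_Suc_eq)
    have "(\<exists>w. (\<forall>e\<in>E. w e \<in> poly_ring V) \<and> v {} = (\<Sum>e\<in>E. Poly_Mapping.single (sqf_mon e) 1 * w e))
      \<longleftrightarrow> (\<exists>w. (\<forall>e\<in>E. w {e} \<in> poly_ring V) \<and> v {} = (\<Sum>e\<in>E. Poly_Mapping.single (sqf_mon e) 1 * w {e}))"
      (is "(\<exists>w. ?P w) \<longleftrightarrow> (\<exists>w. ?Q w)")
    proof
      assume "\<exists>w. ?P w"
      then obtain w where w: "?P w" ..
      show "\<exists>w. ?Q w" by (rule exI[of _ "\<lambda>S. w (the_elem S)"]) (use w in simp)
    next
      assume "\<exists>w. ?Q w"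
      then obtain w where w: "?Q w" ..
      show "\<exists>w. ?P w" by (rule exI[of _ "\<lambda>e. w {e}"]) (use w in simp)
    qed
    thus ?thesis unfolding 0 cycle.simps edge_ideal_iff faces_0 polyvec_def
      by (simp add: mv_taylor_0) (simp add: f1)
  next
    case (Suc j)
    show ?thesis
    proof
      assume "cycle (edge_ideal V E) {} (faces E) (taylor rk) i v"
      thus "\<exists>w. polyvec V (faces E (Suc i)) w \<and> (\<forall>T\<in>faces E i. v T = mv (faces E (Suc i)) (taylor rk i) w T)"
        using v taylor_exact[of j v] unfolding Suc by simp
    next
      assume "\<exists>w. polyvec V (faces E (Suc i)) w \<and> (\<forall>T\<in>faces E i. v T = mv (faces E (Suc i)) (taylor rk i) w T)"
      then obtain w where w: "\<forall>T\<in>faces E i. v T = mv (faces E (Suc i)) (taylor rk i) w T" by blast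
      have "mv (faces E (Suc j)) (taylor rk j) v T
          = mv (faces E (Suc j)) (taylor rk j) (mv (faces E (Suc (Suc j))) (taylor rk (Suc j)) w) T" for T
        by (rule mv_cong) (use w Suc in auto)
      thus "cycle (edge_ideal V E) {} (faces E) (taylor rk) i v"
        unfolding Suc by (simp add: taylor_squared)
    qed
  qed
qed (auto simp: finite_faces faces_0 faces_def[of _ "Suc _"] taylor_homp)

end

section \<open>Cancelling units: existence of minimal resolutions\<close>

text \<open>
  Positions start at \<open>1\<close> because the matrix in position \<open>0\<close> is the augmentation.
\<close>

definition minimal_entries ::
  "(nat \<Rightarrow> 'b set) \<Rightarrow> (nat \<Rightarrow> 'b \<Rightarrow> 'b \<Rightarrow> ('v, 'k::field) mpoly) \<Rightarrow> bool" where
  "minimal_entries B D \<longleftrightarrow>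
    (\<forall>i. \<forall>l\<in>B (Suc i). \<forall>m\<in>B (Suc (Suc i)). Poly_Mapping.lookup (D (Suc i) l m) 0 = 0)"

lemma mv_remove:
  "finite K \<Longrightarrow> m \<in> K \<Longrightarrow> mv K A v l = A l m * v m + mv (K - {m}) A v l"
  by (simp add: mv_def sum.remove)

text \<open>
  A unit entry splits off a trivial summand \<open>0 \<rightarrow> R \<rightarrow> R \<rightarrow> 0\<close>; on the remaining basis elements
  the differential is the Schur complement of the unit.
\<close>

lemma (in resolution) cancel_unit:
  assumes l0: "l0 \<in> B (Suc j)" and m0: "m0 \<in> B (Suc (Suc j))"
    and unit: "Poly_Mapping.lookup (D (Suc j) l0 m0) 0 \<noteq> 0"
  shows "\<exists>D'. resolution V I z (B(Suc j := B (Suc j) - {l0}, Suc (Suc j) := B (Suc (Suc j)) - {m0})) d D'"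
proof -
  define p where "p = Suc j"
  define q where "q = Suc p"
  note pq = p_def q_def
  have l0p: "l0 \<in> B p" and m0q: "m0 \<in> B q" using l0 m0 by (auto simp: pq)
  have finp: "finite (B p)" and finq: "finite (B q)" using finite_basis by auto
  define c where "c = Poly_Mapping.lookup (D p l0 m0) 0"
  have c0: "c \<noteq> 0" using unit by (simp add: c_def p_def)
  have hom0: "homp V (d p l0) (d q m0) (D p l0 m0)" using entry_homp l0 m0 by (simp add: pq)
  hence deg: "d p l0 = d q m0" using c0 homp_const_term c_def by blast
  hence Dc: "D p l0 m0 = Poly_Mapping.single 0 c" using hom0 homp_same_degree c_def by metis
  define \<kappa> where "\<kappa> = (Poly_Mapping.single 0 (1 / c) :: ('v, 'k) mpoly)"
  have \<kappa>: "\<kappa> * D p l0 m0 = 1" "D p l0 m0 * \<kappa> = 1"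
    using c0 by (simp_all add: Dc \<kappa>_def mult_single)
  have \<kappa>R: "\<kappa> \<in> poly_ring V" by (simp add: \<kappa>_def poly_ring_single)
  have entry: "D i l m \<in> poly_ring V" if "l \<in> B i" "m \<in> B (Suc i)" for i l m
    using entry_poly that by blast
  define S where "S l m = D p l m - D p l m0 * \<kappa> * D p l0 m" for l m
  define B' where "B' = B(p := B p - {l0}, q := B q - {m0})"
  define D' where "D' = D(p := S)"
  have B'p: "B' p = B p - {l0}" and B'q: "B' q = B q - {m0}" and B'o: "\<And>i. i \<noteq> p \<Longrightarrow> i \<noteq> q \<Longrightarrow> B' i = B i"
    and D'p: "D' p = S" and D'o: "\<And>i. i \<noteq> p \<Longrightarrow> D' i = D i"
    by (auto simp: B'_def D'_def q_def)
  have B'sub: "B' i \<subseteq> B i" for i by (auto simp: B'_def)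

  \<comment> \<open>Row \<open>l0\<close> of an equation determines the coordinate \<open>m0\<close>.\<close>
  have solve: "w m0 = - \<kappa> * mv (B q - {m0}) (D p) w l0" if "mv (B q) (D p) w l0 = 0" for w
  proof -
    have "D p l0 m0 * w m0 = - mv (B q - {m0}) (D p) w l0"
      using that mv_remove[OF finq m0q, of "D p" w l0] by (simp add: eq_neg_iff_add_eq_0)
    hence "\<kappa> * D p l0 m0 * w m0 = - \<kappa> * mv (B q - {m0}) (D p) w l0" by (simp add: mult.assoc)
    thus ?thesis by (simp add: \<kappa>)
  qed
  have schur: "mv (B q) (D p) w l = mv (B q - {m0}) S w l" if "mv (B q) (D p) w l0 = 0" for w l
  proof -
    have "mv (B q - {m0}) S w l = mv (B q - {m0}) (D p) w l - D p l m0 * \<kappa> * mv (B q - {m0}) (D p) w l0"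
      unfolding mv_def S_def
      by (simp add: sum_subtractf sum_distrib_left left_diff_distrib mult.assoc)
    also have "\<dots> = mv (B q - {m0}) (D p) w l + D p l m0 * w m0"
      unfolding solve[OF that] by (simp add: mult.assoc)
    finally show ?thesis using mv_remove[OF finq m0q, of "D p" w l] by simp
  qed
  define ext where "ext w = w(m0 := - \<kappa> * mv (B q - {m0}) (D p) w l0)" for w
  have ext_off: "mv (B q - {m0}) A (ext w) l = mv (B q - {m0}) A w l"
    for A :: "'b \<Rightarrow> 'b \<Rightarrow> ('v, 'k) mpoly" and w l
    by (rule mv_cong) (auto simp: ext_def)
  have ext_l0: "mv (B q) (D p) (ext w) l0 = 0" for w
  proof -
    have "mv (B q) (D p) (ext w) l0
        = D p l0 m0 * (- \<kappa> * mv (B q - {m0}) (D p) w l0) + mv (B q - {m0}) (D p) w l0"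
      using mv_remove[OF finq m0q, of "D p" "ext w" l0] ext_off by (simp add: ext_def)
    also have "D p l0 m0 * (- \<kappa> * mv (B q - {m0}) (D p) w l0)
        = - (D p l0 m0 * \<kappa>) * mv (B q - {m0}) (D p) w l0" by (simp add: mult.assoc)
    finally show ?thesis by (simp add: \<kappa>)
  qed
  have ext_schur: "mv (B q) (D p) (ext w) l = mv (B q - {m0}) S w l" for w l
    using schur[OF ext_l0] ext_off by simp
  have ext_poly: "polyvec V (B q) (ext w)" if w: "polyvec V (B q - {m0}) w" for w
  proof -
    have "mv (B q - {m0}) (D p) w l0 \<in> poly_ring V"
      by (rule polyvec_mv[where L = "{l0}"]) (use w entry[of _ p] l0p in \<open>auto simp: q_def\<close>)
    hence "- \<kappa> * mv (B q - {m0}) (D p) w l0 \<in> poly_ring V"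
      using \<kappa>R by (intro poly_ring_mult poly_ring_uminus)
    thus ?thesis using w by (auto simp: polyvec_def ext_def)
  qed
  have pad_mv: "mv (B p) A (v(l0 := 0)) l = mv (B p - {l0}) A v l"
    for A :: "'b \<Rightarrow> 'b \<Rightarrow> ('v, 'k) mpoly" and v l
  proof -
    have "mv (B p - {l0}) A (v(l0 := 0)) l = mv (B p - {l0}) A v l" by (rule mv_cong) auto
    thus ?thesis using mv_remove[OF finp l0p, of A "v(l0 := 0)" l] by simp
  qed
  have pad_poly: "polyvec V (B p) (v(l0 := 0))" if "polyvec V (B p - {l0}) v" for v
    using that by (auto simp: polyvec_def)

  \<comment> \<open>Only the positions \<open>j\<close> to \<open>q + 1\<close> notice the change. Vectors pass between the old and the new
    modules by \<open>ext\<close> in position \<open>q\<close> and by padding with zero in position \<open>p\<close>.\<close>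
  have "resolution V I z B' d D'"
  proof
    show "finite (B' i)" for i using B'sub finite_basis finite_subset by blast
    show "B' 0 = {z}" using B'o[of 0] basis_0 by (simp add: pq)
    show "d 0 z = 0" by (rule degree_0)
    show "homp V (d i l) (d (Suc i) m) (D' i l m)" if lm: "l \<in> B' i" "m \<in> B' (Suc i)" for i l m
    proof (cases "i = p")
      case True
      have lm': "l \<in> B p" "m \<in> B q" using lm B'sub True by (auto simp: q_def)
      have "homp V (d p l) (d q m0) (D p l m0)" "homp V (d p l0) (d q m) (D p l0 m)"
           "homp V (d p l) (d q m) (D p l m)"
        using lm' l0p m0q entry_homp by (auto simp: q_def)
      moreover have "homp V (d q m0) (d q m0) \<kappa>" unfolding \<kappa>_def by (rule homp_const)
      ultimately have "homp V (d p l) (d q m) (S l m)"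
        unfolding S_def deg by (intro homp_diff homp_mult)
      thus ?thesis using True by (simp add: D'p q_def)
    next
      case False
      thus ?thesis using lm subsetD[OF B'sub] by (simp add: D'o entry_homp)
    qed
    fix i and v :: "'b \<Rightarrow> ('v, 'k) mpoly" assume v: "polyvec V (B' i) v"
    consider "i < j \<or> i > Suc q" | "i = j" | "i = p" | "i = q" | "i = Suc q" by (auto simp: pq; linarith)
    thus "cycle I z B' D' i v \<longleftrightarrow>
        (\<exists>w. polyvec V (B' (Suc i)) w \<and> (\<forall>b\<in>B' i. v b = mv (B' (Suc i)) (D' i) w b))"
    proof cases
      case 1
      hence "B' i = B i" "B' (Suc i) = B (Suc i)" "D' i = D i" by (auto simp: pq intro!: B'o D'o)
      moreover have "cycle I z B' D' i v \<longleftrightarrow> cycle I z B D i v"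
        using 1 by (cases i) (auto simp: pq B'_def D'_def)
      ultimately show ?thesis using exact v by simp
    next
      case 2
      have eq: "B' i = B i" "D' i = D i" "B' (Suc i) = B p - {l0}"
        using 2 by (auto simp: pq B'_def D'_def)
      have "cycle I z B' D' i v \<longleftrightarrow> cycle I z B D i v"
        using 2 by (cases i) (auto simp: pq B'_def D'_def)
      also have "\<dots> \<longleftrightarrow> (\<exists>w. polyvec V (B p) w \<and> (\<forall>b\<in>B j. v b = mv (B p) (D j) w b))"
        using exact[of i v] v eq 2 by (simp add: p_def)
      also have "\<dots> \<longleftrightarrow> (\<exists>w. polyvec V (B p - {l0}) w \<and> (\<forall>b\<in>B j. v b = mv (B p - {l0}) (D j) w b))"
      proof
        assume "\<exists>w. polyvec V (B p) w \<and> (\<forall>b\<in>B j. v b = mv (B p) (D j) w b)"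
        then obtain w where w: "polyvec V (B p) w" "\<forall>b\<in>B j. v b = mv (B p) (D j) w b" by blast
        \<comment> \<open>Subtracting a multiple of column \<open>m0\<close>, which is a cycle, clears the coordinate \<open>l0\<close>.\<close>
        define w' where "w' k = w k - D p k m0 * (\<kappa> * w l0)" for k
        have "D p l0 m0 * (\<kappa> * w l0) = w l0" using \<kappa> by (simp flip: mult.assoc)
        hence w'0: "w' l0 = 0" by (simp add: w'_def)
        have "v b = mv (B p - {l0}) (D j) w' b" if b: "b \<in> B j" for b
        proof -
          have col: "mv (B p) (D j) (\<lambda>k. D p k m0) b = 0"
            using column_cycle[of m0 p] m0q b by (simp add: pq)
          have "mv (B p) (D j) w' b = mv (B p) (D j) w b - mv (B p) (D j) (\<lambda>k. D p k m0) b * (\<kappa> * w l0)"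
            unfolding w'_def mv_diff by (simp add: mv_def sum_distrib_right mult.assoc)
          thus ?thesis using w(2) b col mv_remove[OF finp l0p, of "D j" w' b] w'0 by simp
        qed
        moreover have "polyvec V (B p - {l0}) w'"
          using w(1) l0p m0q \<kappa>R entry[of _ p m0]
          by (auto simp: polyvec_def w'_def q_def intro!: poly_ring_diff poly_ring_mult)
        ultimately show "\<exists>w. polyvec V (B p - {l0}) w \<and> (\<forall>b\<in>B j. v b = mv (B p - {l0}) (D j) w b)" by blast
      next
        assume "\<exists>w. polyvec V (B p - {l0}) w \<and> (\<forall>b\<in>B j. v b = mv (B p - {l0}) (D j) w b)"
        then obtain w where "polyvec V (B p - {l0}) w" "\<forall>b\<in>B j. v b = mv (B p - {l0}) (D j) w b" by blast
        thus "\<exists>w. polyvec V (B p) w \<and> (\<forall>b\<in>B j. v b = mv (B p) (D j) w b)"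
          by (intro exI[of _ "w(l0 := 0)"]) (simp add: pad_mv pad_poly)
      qed
      finally show ?thesis using 2 eq by simp
    next
      case 3
      have eq: "B' i = B p - {l0}" "D' i = S" "B' (Suc i) = B q - {m0}"
        using 3 B'p B'q D'p by (auto simp: q_def)
      have "cycle I z B' D' i v \<longleftrightarrow> (\<forall>l\<in>B j. mv (B p - {l0}) (D j) v l = 0)"
        using 3 B'o[of j] B'p D'o[of j] by (simp add: pq)
      also have "\<dots> \<longleftrightarrow> cycle I z B D p (v(l0 := 0))" using pad_mv by (simp add: p_def)
      also have "\<dots> \<longleftrightarrow> (\<exists>w. polyvec V (B q) w \<and> (\<forall>b\<in>B p. (v(l0 := 0)) b = mv (B q) (D p) w b))"
        unfolding q_def using pad_poly v eq by (intro exact) simp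
      also have "\<dots> \<longleftrightarrow> (\<exists>w. polyvec V (B q - {m0}) w \<and> (\<forall>b\<in>B p - {l0}. v b = mv (B q - {m0}) S w b))"
      proof
        assume "\<exists>w. polyvec V (B q) w \<and> (\<forall>b\<in>B p. (v(l0 := 0)) b = mv (B q) (D p) w b)"
        then obtain w where w: "polyvec V (B q) w" "\<And>b. b \<in> B p \<Longrightarrow> (v(l0 := 0)) b = mv (B q) (D p) w b" by blast
        have "mv (B q) (D p) w l0 = 0" using w(2)[OF l0p] by simp
        hence "v b = mv (B q - {m0}) S w b" if "b \<in> B p - {l0}" for b
          using w(2)[of b] schur[of w b] that by simp
        moreover have "polyvec V (B q - {m0}) w" using w(1) by (simp add: polyvec_def)
        ultimately show "\<exists>w. polyvec V (B q - {m0}) w \<and> (\<forall>b\<in>B p - {l0}. v b = mv (B q - {m0}) S w b)" by blast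
      next
        assume "\<exists>w. polyvec V (B q - {m0}) w \<and> (\<forall>b\<in>B p - {l0}. v b = mv (B q - {m0}) S w b)"
        then obtain w where w: "polyvec V (B q - {m0}) w" "\<forall>b\<in>B p - {l0}. v b = mv (B q - {m0}) S w b" by blast
        have "(v(l0 := 0)) b = mv (B q) (D p) (ext w) b" if "b \<in> B p" for b
        proof (cases "b = l0")
          case True
          thus ?thesis by (simp only: fun_upd_same ext_l0)
        next
          case False
          thus ?thesis using w(2) that by (simp add: ext_schur)
        qed
        thus "\<exists>w. polyvec V (B q) w \<and> (\<forall>b\<in>B p. (v(l0 := 0)) b = mv (B q) (D p) w b)"
          using ext_poly[OF w(1)] by blast
      qed
      finally show ?thesis using 3 eq by simp
    next
      case 4
      have eq: "B' i = B q - {m0}" "D' i = D q" "B' (Suc i) = B (Suc q)"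
        using 4 B'q by (auto simp: q_def B'_def D'_def)
      have pv: "polyvec V (B q) (ext v)" using v eq by (simp add: ext_poly)
      have "cycle I z B' D' i v \<longleftrightarrow> (\<forall>l\<in>B p - {l0}. mv (B q - {m0}) S v l = 0)"
        using 4 B'p B'q D'p by (simp add: q_def)
      also have "\<dots> \<longleftrightarrow> cycle I z B D q (ext v)"
        using ext_schur[of v] ext_l0[of v] by (auto simp: q_def)
      also have "\<dots> \<longleftrightarrow> (\<exists>w. polyvec V (B (Suc q)) w \<and> (\<forall>b\<in>B q. ext v b = mv (B (Suc q)) (D q) w b))"
        using exact[OF pv] .
      also have "\<dots> \<longleftrightarrow> (\<exists>w. polyvec V (B (Suc q)) w \<and> (\<forall>b\<in>B q - {m0}. v b = mv (B (Suc q)) (D q) w b))"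
      proof
        assume "\<exists>w. polyvec V (B (Suc q)) w \<and> (\<forall>b\<in>B q. ext v b = mv (B (Suc q)) (D q) w b)"
        moreover have "ext v b = v b" if "b \<in> B q - {m0}" for b using that by (simp add: ext_def)
        ultimately show "\<exists>w. polyvec V (B (Suc q)) w \<and> (\<forall>b\<in>B q - {m0}. v b = mv (B (Suc q)) (D q) w b)"
          by (metis DiffD1)
      next
        assume "\<exists>w. polyvec V (B (Suc q)) w \<and> (\<forall>b\<in>B q - {m0}. v b = mv (B (Suc q)) (D q) w b)"
        then obtain w where w: "polyvec V (B (Suc q)) w" "\<forall>b\<in>B q - {m0}. v b = mv (B (Suc q)) (D q) w b" by blast
        let ?u = "mv (B (Suc q)) (D q) w"
        have "mv (B q) (D p) ?u l0 = 0" using boundary_cycle[OF w(1)] l0p by (simp add: q_def)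
        hence "?u m0 = - \<kappa> * mv (B q - {m0}) (D p) ?u l0" by (rule solve)
        also have "mv (B q - {m0}) (D p) ?u l0 = mv (B q - {m0}) (D p) v l0"
          by (rule mv_cong) (use w(2) in auto)
        finally have "ext v b = ?u b" if "b \<in> B q" for b using w(2) that by (auto simp: ext_def)
        thus "\<exists>w. polyvec V (B (Suc q)) w \<and> (\<forall>b\<in>B q. ext v b = mv (B (Suc q)) (D q) w b)"
          using w(1) by blast
      qed
      finally show ?thesis using 4 eq by simp
    next
      case 5
      have eq: "B' i = B i" "D' i = D i" "B' (Suc i) = B (Suc i)"
        using 5 by (auto simp: pq B'_def D'_def)
      have pv: "polyvec V (B (Suc q)) v" using v 5 eq by simp
      have "cycle I z B' D' i v \<longleftrightarrow> (\<forall>l\<in>B q - {m0}. mv (B (Suc q)) (D q) v l = 0)"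
        using 5 B'q B'o[of "Suc q"] D'o[of q] by (simp add: pq)
      also have "\<dots> \<longleftrightarrow> cycle I z B D i v"
      proof
        assume off: "\<forall>l\<in>B q - {m0}. mv (B (Suc q)) (D q) v l = 0"
        let ?u = "mv (B (Suc q)) (D q) v"
        have "mv (B q) (D p) ?u l0 = 0" using boundary_cycle[OF pv] l0p by (simp add: q_def)
        hence "?u m0 = - \<kappa> * mv (B q - {m0}) (D p) ?u l0" by (rule solve)
        also have "mv (B q - {m0}) (D p) ?u l0 = mv (B q - {m0}) (D p) (\<lambda>_. 0) l0"
          by (rule mv_cong) (use off in auto)
        finally have "?u m0 = 0" by (simp add: mv_def[of "B q - {m0}"])
        thus "cycle I z B D i v" using off 5 by auto
      qed (use 5 in auto)
      also have "\<dots> \<longleftrightarrow> (\<exists>w. polyvec V (B (Suc i)) w \<and> (\<forall>b\<in>B i. v b = mv (B (Suc i)) (D i) w b))"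
        by (rule exact) (use v eq in simp)
      finally show ?thesis using eq by simp
    qed
  qed
  thus ?thesis unfolding B'_def pq by blast
qed

text \<open>Each cancellation lowers the total rank, so the process stops at a minimal resolution.\<close>

lemma minimal_resolution_exists:
  assumes "resolution V I z B d D" "\<And>i. i > N \<Longrightarrow> B i = {}"
  shows "\<exists>B' D'. resolution V I z B' d D' \<and> minimal_entries B' D'"
  using assms
proof (induction "\<Sum>i\<le>N. card (B i)" arbitrary: B D rule: less_induct)
  case less
  interpret resolution V I z B d D by fact
  show ?case
  proof (cases "minimal_entries B D")
    case True
    thus ?thesis using less.prems by blast
  next
    case False
    then obtain j l0 m0 where j: "l0 \<in> B (Suc j)" "m0 \<in> B (Suc (Suc j))"
        "Poly_Mapping.lookup (D (Suc j) l0 m0) 0 \<noteq> 0"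
      unfolding minimal_entries_def by blast
    let ?B = "B(Suc j := B (Suc j) - {l0}, Suc (Suc j) := B (Suc (Suc j)) - {m0})"
    obtain D' where D': "resolution V I z ?B d D'" using cancel_unit[OF j] by blast
    have jN: "Suc j \<le> N" using less.prems(2)[of "Suc j"] j(1) by force
    have "(\<Sum>i\<le>N. card (?B i)) < (\<Sum>i\<le>N. card (B i))"
    proof (rule sum_strict_mono_ex1)
      show "\<forall>i\<in>{..N}. card (?B i) \<le> card (B i)"
        using finite_basis by (auto intro!: card_mono)
      have "card (B (Suc j) - {l0}) < card (B (Suc j))"
        using finite_basis j(1) by (intro psubset_card_mono) auto
      thus "\<exists>i\<in>{..N}. card (?B i) < card (B i)" using jN by (intro bexI[of _ "Suc j"]) auto
    qed simp
    moreover have "?B i = {}" if "i > N" for i using less.prems(2)[OF that] by (auto simp: fun_upd_def)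
    ultimately show ?thesis using less.hyps[OF _ D'] by blast
  qed
qed

lemma (in resolution) reindex:
  assumes h: "\<And>i. bij_betw (h i) (A i) (B i)" and A0: "A 0 = {z'}"
  shows "resolution V I z' A (\<lambda>i l. d i (h i l)) (\<lambda>i l m. D i (h i l) (h (Suc i) m))"
proof -
  define g where "g i = the_inv_into (A i) (h i)" for i
  have gh: "g i (h i a) = a" if "a \<in> A i" for i a
    using h[of i] that by (simp add: g_def bij_betw_def the_inv_into_f_f)
  have hA: "h i a \<in> B i" if "a \<in> A i" for i a using h[of i] that by (auto simp: bij_betw_def)
  have hz: "h 0 z' = z" using hA[of z' 0] A0 basis_0 by simp
  have B_img: "B i = h i ` A i" for i using h[of i] by (simp add: bij_betw_def)
  let ?D = "\<lambda>i l m. D i (h i l) (h (Suc i) m)"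
  have mv_eq: "mv (A (Suc i)) (?D i) w l = mv (B (Suc i)) (D i) (\<lambda>b. w (g (Suc i) b)) (h i l)" for i w l
    unfolding mv_def B_img using h[of "Suc i"]
    by (subst sum.reindex) (auto simp: bij_betw_def gh intro!: sum.cong)
  show ?thesis
  proof
    show "finite (A i)" for i using h[of i] finite_basis bij_betw_finite by blast
    show "A 0 = {z'}" by fact
    show "d 0 (h 0 z') = 0" using hz degree_0 by simp
    show "homp V (d i (h i l)) (d (Suc i) (h (Suc i) m)) (?D i l m)" if "l \<in> A i" "m \<in> A (Suc i)" for i l m
      using that hA by (intro entry_homp)
    fix i and v :: "_ \<Rightarrow> ('v, 'k) mpoly" assume v: "polyvec V (A i) v"
    let ?v = "\<lambda>b. v (g i b)"
    have v': "polyvec V (B i) ?v" using v by (auto simp: polyvec_def B_img gh)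
    have "cycle I z' A ?D i v \<longleftrightarrow> cycle I z B D i ?v"
    proof (cases i)
      case 0
      thus ?thesis using gh[of z' 0] hz A0 by simp
    next
      case (Suc j)
      thus ?thesis by (simp add: mv_eq) (simp add: B_img[of j])
    qed
    also have "\<dots> \<longleftrightarrow> (\<exists>w. polyvec V (B (Suc i)) w \<and> (\<forall>b\<in>B i. ?v b = mv (B (Suc i)) (D i) w b))"
      by (rule exact[OF v'])
    also have "\<dots> \<longleftrightarrow> (\<exists>w. polyvec V (A (Suc i)) w \<and> (\<forall>a\<in>A i. v a = mv (A (Suc i)) (?D i) w a))"
    proof
      assume "\<exists>w. polyvec V (B (Suc i)) w \<and> (\<forall>b\<in>B i. ?v b = mv (B (Suc i)) (D i) w b)"
      then obtain w where w: "polyvec V (B (Suc i)) w" "\<forall>b\<in>B i. ?v b = mv (B (Suc i)) (D i) w b" by blast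
      have "mv (A (Suc i)) (?D i) (\<lambda>a. w (h (Suc i) a)) l = mv (B (Suc i)) (D i) w (h i l)" for l
        unfolding mv_eq by (rule mv_cong) (auto simp: B_img gh)
      thus "\<exists>w. polyvec V (A (Suc i)) w \<and> (\<forall>a\<in>A i. v a = mv (A (Suc i)) (?D i) w a)"
        using w by (intro exI[of _ "\<lambda>a. w (h (Suc i) a)"]) (auto simp: polyvec_def B_img gh)
    next
      assume "\<exists>w. polyvec V (A (Suc i)) w \<and> (\<forall>a\<in>A i. v a = mv (A (Suc i)) (?D i) w a)"
      then obtain w where w: "polyvec V (A (Suc i)) w" "\<forall>a\<in>A i. v a = mv (A (Suc i)) (?D i) w a" by blast
      thus "\<exists>w. polyvec V (B (Suc i)) w \<and> (\<forall>b\<in>B i. ?v b = mv (B (Suc i)) (D i) w b)"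
        by (intro exI[of _ "\<lambda>b. w (g (Suc i) b)"]) (auto simp: polyvec_def B_img gh mv_eq)
    qed
    finally show "cycle I z' A ?D i v \<longleftrightarrow>
      (\<exists>w. polyvec V (A (Suc i)) w \<and> (\<forall>a\<in>A i. v a = mv (A (Suc i)) (?D i) w a))" .
  qed
qed

section \<open>Induced matchings as Betti numbers\<close>

text \<open>
  Gaussian elimination, removing one equation and one unknown at a time.
\<close>

lemma underdetermined_system:
  fixes Y :: "'b \<Rightarrow> 'a \<Rightarrow> 'k::field"
  assumes "finite B" "finite A" "card B < card A"
  shows "\<exists>x. (\<exists>a\<in>A. x a \<noteq> 0) \<and> (\<forall>b\<in>B. (\<Sum>a\<in>A. Y b a * x a) = 0)"
  using assms
proof (induction B arbitrary: A Y)
  case empty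
  thus ?case by (intro exI[of _ "\<lambda>_. 1"]) (auto simp: card_gt_0_iff)
next
  case (insert b0 B)
  show ?case
  proof (cases "\<forall>a\<in>A. Y b0 a = 0")
    case True
    have "card B < card A" using insert by simp
    then obtain x where "\<exists>a\<in>A. x a \<noteq> 0" "\<forall>b\<in>B. (\<Sum>a\<in>A. Y b a * x a) = 0"
      using insert.IH[OF insert.prems(1)] by blast
    thus ?thesis using True by (intro exI[of _ x]) auto
  next
    case False
    then obtain a0 where a0: "a0 \<in> A" "Y b0 a0 \<noteq> 0" by blast
    have "card B < card (A - {a0})" using insert a0 by simp
    then obtain x where x: "\<exists>a\<in>A - {a0}. x a \<noteq> 0"
        "\<forall>b\<in>B. (\<Sum>a\<in>A - {a0}. (Y b a - Y b a0 * Y b0 a / Y b0 a0) * x a) = 0"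
      using insert.IH[of "A - {a0}" "\<lambda>b a. Y b a - Y b a0 * Y b0 a / Y b0 a0"] insert.prems(1) by blast
    define s where "s = (\<Sum>a\<in>A - {a0}. Y b0 a * x a)"
    let ?x = "x(a0 := - s / Y b0 a0)"
    have sum: "(\<Sum>a\<in>A. Y b a * ?x a) = Y b a0 * (- s / Y b0 a0) + (\<Sum>a\<in>A - {a0}. Y b a * x a)" for b
      using insert.prems(1) a0(1) by (subst sum.remove[of A a0]) (auto intro!: sum.cong)
    have "(\<Sum>a\<in>A. Y b0 a * ?x a) = 0" unfolding sum using a0(2) by (simp add: s_def[symmetric])
    moreover have "(\<Sum>a\<in>A. Y b a * ?x a) = 0" if "b \<in> B" for b
    proof -
      have "(\<Sum>a\<in>A - {a0}. (Y b a - Y b a0 * Y b0 a / Y b0 a0) * x a)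
          = (\<Sum>a\<in>A - {a0}. Y b a * x a) - Y b a0 / Y b0 a0 * s"
        unfolding s_def sum_distrib_left sum_subtractf[symmetric]
        by (intro sum.cong) (auto simp: algebra_simps)
      hence "(\<Sum>a\<in>A - {a0}. Y b a * x a) = Y b a0 / Y b0 a0 * s" using x(2) that by simp
      thus ?thesis unfolding sum by simp
    qed
    moreover have "\<exists>a\<in>A. ?x a \<noteq> 0" using x(1) by auto
    ultimately show ?thesis by (intro exI[of _ ?x]) auto
  qed
qed

text \<open>If \<open>B\<close> were smaller than \<open>A\<close>, then \<open>Y\<close> would have a nonzero kernel vector, which \<open>X\<close> cannot undo.\<close>

lemma card_le_if_left_inverse:
  fixes X :: "'a \<Rightarrow> 'b \<Rightarrow> 'k::field"
  assumes "finite A" "finite B"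
    and inv: "\<And>a a'. a \<in> A \<Longrightarrow> a' \<in> A \<Longrightarrow> (\<Sum>b\<in>B. X a b * Y b a') = (if a = a' then 1 else 0)"
  shows "card A \<le> card B"
proof (rule ccontr)
  assume "\<not> ?thesis"
  hence "card B < card A" by simp
  then obtain x where x: "\<exists>a\<in>A. x a \<noteq> 0" "\<forall>b\<in>B. (\<Sum>a\<in>A. Y b a * x a) = 0"
    using underdetermined_system[OF assms(2,1)] by blast
  have "x a = 0" if a: "a \<in> A" for a
  proof -
    have "x a = (\<Sum>a'\<in>A. (if a = a' then 1 else 0) * x a')"
      using assms(1) a by (simp add: if_distrib[of "\<lambda>y. y * _"] sum.delta cong: if_cong)
    also have "\<dots> = (\<Sum>a'\<in>A. \<Sum>b\<in>B. X a b * (Y b a' * x a'))"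
      using a by (intro sum.cong) (auto simp flip: inv simp: sum_distrib_right mult.assoc)
    also have "\<dots> = (\<Sum>b\<in>B. X a b * (\<Sum>a'\<in>A. Y b a' * x a'))"
      by (subst sum.swap) (simp add: sum_distrib_left)
    finally show ?thesis using x(2) by simp
  qed
  thus False using x(1) by blast
qed

text \<open>
  For edges with two elements, the condition on the cardinality says that the edges of \<open>M\<close> are
  pairwise disjoint.
\<close>

definition induced_matching :: "'v set set \<Rightarrow> 'v set set \<Rightarrow> bool" where
  "induced_matching E M \<longleftrightarrow> M \<subseteq> E \<and> card (\<Union>M) = 2 * card M \<and> (\<forall>e\<in>E. e \<subseteq> \<Union>M \<longrightarrow> e \<in> M)"

lemma const_mm:
  "Poly_Mapping.lookup (mm K A B l m) 0 =
    (\<Sum>k\<in>K. Poly_Mapping.lookup (A l k) 0 * Poly_Mapping.lookup (B k m :: ('v, 'k::field) mpoly) 0)"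
  by (simp add: mm_def lookup_sum const_term_mult)

context ordered_graph
begin

lemma same_cover:
  assumes "S \<subseteq> E" "T \<subseteq> S" "card (\<Union>T) = card (\<Union>S)"
  shows "\<Union>T = \<Union>S"
  using assms finite_covered[OF assms(1)] by (intro card_subset_eq) auto

text \<open>
  Of the facets of a matching \<open>M\<close> enlarged by an edge on its vertices, only \<open>M\<close> itself has the same
  multidegree: no other edge of \<open>M\<close> may be left out without uncovering a vertex.
\<close>

lemma enlarged_matching_facet:
  assumes M: "M \<in> faces E n" "card (\<Union>M) = 2 * n" and e: "e \<in> E" "e \<subseteq> \<Union>M" "e \<notin> M"
    and f: "f \<in> insert e M" "\<Union>(insert e M - {f}) = \<Union>(insert e M)"
  shows "f = e"
proof (rule ccontr)
  assume "f \<noteq> e"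
  hence fM: "f \<in> M" using f by auto
  have ME: "M \<subseteq> E" "card M = n" "finite M" using M(1) finite_face by (auto simp: faces_def)
  let ?R = "\<Union>(M - {f})"
  have f2: "card f = 2" and e2: "card e = 2" "finite e"
    using ME fM card_edge e finite_covered[of "{e}"] by auto
  have "f \<inter> ?R = {}" using matching_disjoint[of M f] ME M(2) fM by simp
  moreover have "f \<subseteq> e \<union> ?R"
  proof -
    have "insert e M - {f} = insert e (M - {f})" using \<open>f \<noteq> e\<close> by auto
    hence "\<Union>(insert e M) = e \<union> ?R" using f(2) by simp
    thus ?thesis using fM by auto
  qed
  ultimately have "f \<subseteq> e" by blast
  hence "f = e" using e2 f2 by (simp add: card_subset_eq)
  thus False using \<open>f \<noteq> e\<close> by simp
qed

lemma const_taylor_nonzero: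
  assumes "S \<subseteq> E" "Poly_Mapping.lookup (taylor rk i T S :: ('v, 'k::field) mpoly) 0 \<noteq> 0"
  obtains e where "e \<in> S" "T = S - {e}" "\<Union>T = \<Union>S"
proof -
  have "taylor rk i T S \<noteq> (0 :: ('v, 'k) mpoly)" using assms(2) by auto
  then obtain e where e: "e \<in> S" "T = S - {e}" by (rule taylor_nonzero)
  have "card (\<Union>T) = card (\<Union>S)"
    using homp_const_term[OF taylor_homp[OF assms(1)]] assms(2) by blast
  hence "\<Union>T = \<Union>S" using e by (intro same_cover[OF assms(1)]) auto
  thus ?thesis using e that by blast
qed

lemma finite_induced_matchings: "finite {M. induced_matching E M \<and> card M = n}"
  by (rule finite_subset[OF _ finite_faces[of n]]) (auto simp: induced_matching_def faces_def)

text \<open>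
  Modulo the variables, the Taylor resolution in homological position \<open>n\<close> and degree \<open>2n\<close> has the
  matchings with \<open>n\<close> edges as its basis, there is nothing one position below, and the boundary of
  a matching together with a further edge on the same vertices is, up to sign, that matching. What
  remains after dividing by these boundaries are the induced matchings. The constant terms of
  the comparison maps identify this space with the one spanned by the basis elements of degree \<open>2n\<close>
  of a minimal resolution, whose differential vanishes modulo the variables.
\<close>

theorem card_degree_eq_induced_matchings:
  fixes D :: "nat \<Rightarrow> 'b \<Rightarrow> 'b \<Rightarrow> ('v, 'k::field) mpoly"
  assumes res: "resolution V (edge_ideal V E) z B d D" and min: "minimal_entries B D"
  shows "card {l \<in> B (Suc c). d (Suc c) l = 2 * Suc c} = card {M. induced_matching E M \<and> card M = Suc c}"
proof -
  let ?I = "edge_ideal V E :: ('v, 'k) mpoly set"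
  let ?dT = "\<lambda>(i::nat) S. card (\<Union>S)" and ?T = "taylor rk :: nat \<Rightarrow> 'v set set \<Rightarrow> 'v set set \<Rightarrow> ('v, 'k) mpoly"
  interpret F: resolution V ?I z B d D by (rule res)
  interpret T: resolution V ?I "{}" "faces E" ?dT ?T by (rule taylor_resolution)
  interpret FT: resolution_pair V ?I z B d D "{}" "faces E" ?dT ?T ..
  interpret TF: resolution_pair V ?I "{}" "faces E" ?dT ?T z B d D ..
  obtain f where f: "f 0 {} z = 1" "\<And>i. FT.degree_preserving i i (f i)" "\<And>i. FT.commutes i (f i) (f (Suc i))"
    using FT.chain_map_exists by blast
  obtain g where g: "g 0 z {} = 1" "\<And>i. TF.degree_preserving i i (g i)" "\<And>i. TF.commutes i (g i) (g (Suc i))"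
    using TF.chain_map_exists by blast
  define n where "n = Suc c"
  define L where "L = {l \<in> B n. d n l = 2 * n}"
  define J where "J = {M. induced_matching E M \<and> card M = n}"
  have finL: "finite L" and finJ: "finite J" using F.finite_basis finite_induced_matchings
    by (auto simp: L_def J_def)
  have J_faces: "J \<subseteq> faces E n" and J_deg: "\<And>M. M \<in> J \<Longrightarrow> card (\<Union>M) = 2 * n"
    by (auto simp: J_def faces_def induced_matching_def)
  have L_B: "L \<subseteq> B n" by (auto simp: L_def)
  let ?c = "\<lambda>p :: ('v, 'k) mpoly. Poly_Mapping.lookup p 0"
  have D0: "?c (D i l m) = 0" if "l \<in> B i" "m \<in> B (Suc i)" "i > 0" for i l m
    using min that by (cases i) (auto simp: minimal_entries_def)

  \<comment> \<open>Modulo the variables, a matching that is not induced is up to sign a boundary, and boundaries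
    are sent to zero because the differential of the minimal resolution vanishes.\<close>
  have g_J: "M \<in> J" if M: "M \<in> faces E n" and l: "l \<in> L" and nz: "?c (g n l M) \<noteq> 0" for l M
  proof -
    have lB: "l \<in> B n" "d n l = 2 * n" using l by (auto simp: L_def)
    have "homp V (d n l) (card (\<Union>M)) (g n l M)" using g(2) lB(1) M by blast
    hence deg: "card (\<Union>M) = 2 * n" using nz homp_const_term lB(2) by metis
    have ME: "M \<subseteq> E" "card M = n" "finite M" using M finite_face by (auto simp: faces_def)
    have "e \<in> M" if e: "e \<in> E" "e \<subseteq> \<Union>M" for e
    proof (rule ccontr)
      assume eM: "e \<notin> M"
      let ?S = "insert e M"
      have S: "?S \<in> faces E (Suc n)" "?S \<subseteq> E" using ME e eM by (auto simp: faces_def)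
      have "(\<Sum>k\<in>B (Suc n). ?c (D n l k) * ?c (g (Suc n) k ?S)) = 0"
        by (intro sum.neutral) (use D0[of l n] lB n_def in auto)
      hence "?c (mm (B (Suc n)) (D n) (g (Suc n)) l ?S) = 0" by (simp add: const_mm)
      hence "?c (mm (faces E n) (g n) (?T n) l ?S) = 0" using g(3)[of n] lB(1) S(1) by simp
      hence "0 = (\<Sum>M'\<in>faces E n. ?c (g n l M') * ?c (?T n M' ?S))" by (simp add: const_mm)
      also have "\<dots> = (\<Sum>M'\<in>faces E n. if M' = M then ?c (g n l M) * ?c (?T n M ?S) else 0)"
      proof (intro sum.cong refl)
        fix M' assume "M' \<in> faces E n"
        have "M' = M" if nz': "?c (?T n M' ?S) \<noteq> 0"
        proof -
          obtain f where f: "f \<in> ?S" "M' = ?S - {f}" "\<Union>M' = \<Union>?S"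
            using const_taylor_nonzero[OF S(2) nz'] .
          hence "f = e" using enlarged_matching_facet[OF M deg e eM f(1)] by simp
          thus ?thesis using f eM by auto
        qed
        thus "?c (g n l M') * ?c (?T n M' ?S) = (if M' = M then ?c (g n l M) * ?c (?T n M ?S) else 0)"
          by auto
      qed
      also have "\<dots> = ?c (g n l M) * ?c (?T n M ?S)" using M finite_faces by simp
      finally have zero: "?c (?T n M ?S) = 0" using nz by simp
      have "?T n (?S - {e}) ?S = Poly_Mapping.single (sqf_mon (\<Union>?S - \<Union>(?S - {e}))) (sign rk ?S e)"
        by (rule taylor_remove[OF S(2)]) simp
      moreover have "?S - {e} = M" using eM by auto
      moreover have "\<Union>?S - \<Union>M = {}" using e by auto
      hence "sqf_mon (\<Union>?S - \<Union>M) = 0" by (simp only: sqf_mon_def sum.empty)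
      ultimately have "?T n M ?S = Poly_Mapping.single 0 (sign rk ?S e)" by metis
      hence "?c (?T n M ?S) \<noteq> 0" by (simp add: sign_def)
      with zero show False by simp
    qed
    thus ?thesis using ME deg by (simp add: J_def induced_matching_def)
  qed

  obtain h where h: "\<And>i. \<forall>l\<in>B (Suc i). \<forall>m\<in>B (Suc i).
        mm (faces E (Suc i)) (g (Suc i)) (f (Suc i)) l m - (if l = m then 1 else 0) =
        mm (B (Suc (Suc i))) (D (Suc i)) (h (Suc i)) l m + mm (B i) (h i) (D i) l m"
    using FT.composite_homotopic_to_identity[OF f(2,3,1), of g] g by blast
  have gf: "(\<Sum>M\<in>J. ?c (g n l M) * ?c (f n M l')) = (if l = l' then 1 else 0)" if ll: "l \<in> L" "l' \<in> L" for l l'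
  proof -
    have lB: "l \<in> B n" "l' \<in> B n" "d n l' = 2 * n" using ll by (auto simp: L_def)
    \<comment> \<open>For \<open>c = 0\<close> this is the augmentation, whose entries have positive degree.\<close>
    have low: "?c (D c k l') = 0" if "k \<in> B c" for k
    proof (cases "c = 0")
      case True
      have "homp V 0 (2 * n) (D 0 k l')"
        using F.entry_homp[of k 0 l'] that lB True F.basis_0 F.degree_0 by (simp add: n_def)
      thus ?thesis using True homp_const_term[of V 0 "2 * n"] by (simp add: n_def)
    qed (use D0[of k c l'] that lB n_def in auto)
    have "(\<Sum>M\<in>J. ?c (g n l M) * ?c (f n M l')) = (\<Sum>M\<in>faces E n. ?c (g n l M) * ?c (f n M l'))"
      using g_J[OF _ ll(1)] J_faces finite_faces by (intro sum.mono_neutral_left) auto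
    also have "\<dots> = ?c (mm (faces E n) (g n) (f n) l l')" by (simp add: const_mm)
    also have "mm (faces E n) (g n) (f n) l l' = (if l = l' then 1 else 0) +
        (mm (B (Suc n)) (D n) (h n) l l' + mm (B c) (h c) (D c) l l')"
      using h[of c] lB unfolding n_def by (auto simp: algebra_simps)
    also have "?c \<dots> = (if l = l' then 1 else 0)"
      using low D0[of l n] lB by (simp add: lookup_add const_mm n_def)
    finally show ?thesis .
  qed

  obtain h' where h': "\<And>i. \<forall>l\<in>faces E (Suc i). \<forall>m\<in>faces E (Suc i).
        mm (B (Suc i)) (f (Suc i)) (g (Suc i)) l m - (if l = m then 1 else 0) =
        mm (faces E (Suc (Suc i))) (?T (Suc i)) (h' (Suc i)) l m + mm (faces E i) (h' i) (?T i) l m"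
    using TF.composite_homotopic_to_identity[OF g(2,3,1), of f] f by blast
  have fg: "(\<Sum>l\<in>L. ?c (f n M l) * ?c (g n l M')) = (if M = M' then 1 else 0)" if MM: "M \<in> J" "M' \<in> J" for M M'
  proof -
    have MF: "M \<in> faces E n" "M' \<in> faces E n" using MM J_faces by auto
    have up: "?c (?T n M S) = 0" if "S \<in> faces E (Suc n)" for S
    proof (rule ccontr)
      assume "?c (?T n M S) \<noteq> 0"
      moreover have SE: "S \<subseteq> E" using that by (simp add: faces_def)
      ultimately obtain e where e: "e \<in> S" "M = S - {e}" "\<Union>M = \<Union>S"
        using const_taylor_nonzero[of S n M] by metis
      hence "e \<subseteq> \<Union>M" "e \<in> E" "e \<notin> M" using SE by auto
      thus False using MM(1) by (auto simp: J_def induced_matching_def)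
    qed
    have low: "?c (?T c N M') = 0" if "N \<in> faces E c" for N
    proof (rule ccontr)
      assume "?c (?T c N M') \<noteq> 0"
      moreover have "M' \<subseteq> E" using MF by (simp add: faces_def)
      ultimately obtain e where "\<Union>N = \<Union>M'" using const_taylor_nonzero[of M' c N] by metis
      moreover have "card (\<Union>N) \<le> 2 * c" using card_covered_le[of N] that by (auto simp: faces_def)
      ultimately show False using J_deg[OF MM(2)] by (simp add: n_def)
    qed
    have "?c (f n M l) = 0" if "l \<in> B n - L" for l
    proof (rule homp_const_term)
      show "homp V (card (\<Union>M)) (d n l) (f n M l)" using f(2) MF(1) that by blast
      show "card (\<Union>M) \<noteq> d n l" using that J_deg[OF MM(1)] by (auto simp: L_def)
    qed
    hence "(\<Sum>l\<in>L. ?c (f n M l) * ?c (g n l M')) = (\<Sum>l\<in>B n. ?c (f n M l) * ?c (g n l M'))"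
      using L_B F.finite_basis by (intro sum.mono_neutral_left) auto
    also have "\<dots> = ?c (mm (B n) (f n) (g n) M M')" by (simp add: const_mm)
    also have "mm (B n) (f n) (g n) M M' = (if M = M' then 1 else 0) +
        (mm (faces E (Suc n)) (?T n) (h' n) M M' + mm (faces E c) (h' c) (?T c) M M')"
      using h'[of c] MF unfolding n_def by (auto simp: algebra_simps)
    also have "?c \<dots> = (if M = M' then 1 else 0)"
      using low up by (simp add: lookup_add const_mm)
    finally show ?thesis .
  qed

  have "card L = card J"
    using card_le_if_left_inverse[OF finL finJ gf] card_le_if_left_inverse[OF finJ finL fg] by simp
  thus ?thesis by (simp add: L_def J_def n_def)
qed

end

section \<open>Graded Betti numbers of edge ideals\<close>

text \<open>
  Putting the ring itself in front of the modules \<open>R\<^bsup>r i\<^esup>\<close> moves these to position \<open>i + 1\<close> and makes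
  the augmentation the matrix in position \<open>0\<close>.
\<close>

definition shift_basis :: "(nat \<Rightarrow> nat) \<Rightarrow> nat \<Rightarrow> nat set" where
  "shift_basis r i = (case i of 0 \<Rightarrow> {0} | Suc j \<Rightarrow> {..<r j})"

definition shift_degree :: "(nat \<Rightarrow> nat \<Rightarrow> nat) \<Rightarrow> nat \<Rightarrow> nat \<Rightarrow> nat" where
  "shift_degree d i = (case i of 0 \<Rightarrow> \<lambda>_. 0 | Suc j \<Rightarrow> d j)"

definition shift_maps ::
  "(nat \<Rightarrow> ('v, 'k::field) mpoly) \<Rightarrow> (nat \<Rightarrow> nat \<Rightarrow> nat \<Rightarrow> ('v, 'k) mpoly) \<Rightarrow>
   nat \<Rightarrow> nat \<Rightarrow> nat \<Rightarrow> ('v, 'k) mpoly" where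
  "shift_maps e \<phi> i = (case i of 0 \<Rightarrow> \<lambda>_ m. e m | Suc j \<Rightarrow> \<phi> j)"

lemmas shift_defs = shift_basis_def shift_degree_def shift_maps_def

text \<open>
  Elements of \<open>free_mod\<close> are fixed outside of the index range, whereas the vectors in \<open>resolution\<close> are
  arbitrary there. The two readings of exactness agree, since neither the kernel condition \<open>Z\<close> nor
  the matrix depends on those values.
\<close>

lemma image_eq_iff_exact:
  fixes Z :: "(nat \<Rightarrow> ('v, 'k::field) mpoly) \<Rightarrow> bool"
  assumes "\<And>v v'. (\<And>l. l < r \<Longrightarrow> v l = v' l) \<Longrightarrow> Z v \<longleftrightarrow> Z v'"
    and A: "\<And>l m. l < r \<Longrightarrow> m < s \<Longrightarrow> A l m \<in> poly_ring V"
  shows "{v \<in> free_mod V r. Z v} = mat_map r s A ` free_mod V s \<longleftrightarrow>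
    (\<forall>v. polyvec V {..<r} v \<longrightarrow> (Z v \<longleftrightarrow> (\<exists>w. polyvec V {..<s} w \<and> (\<forall>l\<in>{..<r}. v l = mv {..<s} A w l))))"
    (is "?l \<longleftrightarrow> ?r")
proof -
  have fm: "v \<in> free_mod V r \<longleftrightarrow> polyvec V {..<r} v \<and> v \<in> extensional {..<r}" for v r
    by (auto simp: free_mod_def polyvec_def PiE_iff)
  have mm: "mat_map r s A w = restrict (mv {..<s} A w) {..<r}" for w
    by (auto simp: mat_map_def mv_def intro!: restrict_ext)
  have img: "v \<in> mat_map r s A ` free_mod V s \<longleftrightarrow>
      (\<exists>w. polyvec V {..<s} w \<and> (\<forall>l\<in>{..<r}. v l = mv {..<s} A w l))" if "v \<in> extensional {..<r}" for v
  proof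
    assume "v \<in> mat_map r s A ` free_mod V s"
    thus "\<exists>w. polyvec V {..<s} w \<and> (\<forall>l\<in>{..<r}. v l = mv {..<s} A w l)"
      by (auto simp: mm fm)
  next
    assume "\<exists>w. polyvec V {..<s} w \<and> (\<forall>l\<in>{..<r}. v l = mv {..<s} A w l)"
    then obtain w where w: "polyvec V {..<s} w" "\<forall>l\<in>{..<r}. v l = mv {..<s} A w l" by blast
    have "mv {..<s} A (restrict w {..<s}) l = mv {..<s} A w l" for l by (rule mv_cong) auto
    hence "v = mat_map r s A (restrict w {..<s})"
      using w(2) that by (intro extensionalityI[of v "{..<r}"]) (auto simp: mm)
    moreover have "restrict w {..<s} \<in> free_mod V s" using w(1) by (auto simp: fm polyvec_def)
    ultimately show "v \<in> mat_map r s A ` free_mod V s" by blast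
  qed
  have img_fm: "mat_map r s A ` free_mod V s \<subseteq> free_mod V r"
    using A by (auto simp: fm mm polyvec_def[of V "{..<r}"] intro!: polyvec_mv[where L = "{..<r}"])
  show ?thesis
  proof
    assume l: ?l
    show ?r
    proof (intro allI impI)
      fix v :: "nat \<Rightarrow> ('v, 'k) mpoly" assume v: "polyvec V {..<r} v"
      let ?v = "restrict v {..<r}"
      have "?v \<in> free_mod V r" using v by (auto simp: fm polyvec_def)
      hence "Z ?v \<longleftrightarrow> ?v \<in> mat_map r s A ` free_mod V s" using l by blast
      moreover have "Z ?v \<longleftrightarrow> Z v" by (rule assms(1)) auto
      ultimately show "Z v \<longleftrightarrow> (\<exists>w. polyvec V {..<s} w \<and> (\<forall>l\<in>{..<r}. v l = mv {..<s} A w l))"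
        using img[of ?v] by simp
    qed
  next
    assume r: ?r
    have "v \<in> {v \<in> free_mod V r. Z v} \<longleftrightarrow> v \<in> mat_map r s A ` free_mod V s" for v
    proof (cases "v \<in> free_mod V r")
      case True
      hence "polyvec V {..<r} v" "v \<in> extensional {..<r}" using fm by auto
      thus ?thesis using r img[of v] True by simp
    next
      case False
      thus ?thesis using img_fm by auto
    qed
    thus ?l by blast
  qed
qed

text \<open>
  Exactness in position \<open>0\<close> only speaks about polynomials in the variables \<open>V\<close>, so \<open>I\<close> must not have
  other elements.
\<close>

lemma graded_free_resolution_iff:
  assumes "I \<subseteq> poly_ring V"
  shows "graded_free_resolution V I r d e \<phi> \<longleftrightarrow>
    resolution V I 0 (shift_basis r) (shift_degree d) (shift_maps e \<phi>)"
proof -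
  let ?B = "shift_basis r" and ?d = "shift_degree d" and ?D = "shift_maps e \<phi>"
  have simps [simp]: "?B 0 = {0}" "?B (Suc i) = {..<r i}" "?d 0 l = 0" "?d (Suc i) l = d i l"
      "?D 0 l m = e m" "?D (Suc i) l m = \<phi> i l m" "?D (Suc i) = \<phi> i" for i l m
    by (simp_all add: shift_defs)
  define H where "H \<longleftrightarrow> (\<forall>i. \<forall>l\<in>?B i. \<forall>m\<in>?B (Suc i). homp V (?d i l) (?d (Suc i) m) (?D i l m))"
  define X where "X i \<longleftrightarrow> (\<forall>v. polyvec V (?B i) v \<longrightarrow> (cycle I 0 ?B ?D i v \<longleftrightarrow>
      (\<exists>w. polyvec V (?B (Suc i)) w \<and> (\<forall>b\<in>?B i. v b = mv (?B (Suc i)) (?D i) w b))))" for i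
  have res: "resolution V I 0 ?B ?d ?D \<longleftrightarrow> H \<and> (\<forall>i. X i)"
  proof
    assume "resolution V I 0 ?B ?d ?D"
    then interpret resolution V I 0 ?B ?d ?D .
    show "H \<and> (\<forall>i. X i)" unfolding H_def X_def using entry_homp exact by blast
  next
    assume *: "H \<and> (\<forall>i. X i)"
    have "finite (?B i)" for i by (cases i) auto
    thus "resolution V I 0 ?B ?d ?D" using * unfolding H_def X_def by unfold_locales auto
  qed
  have all_nat: "(\<forall>i. P i) \<longleftrightarrow> P 0 \<and> (\<forall>i. P (Suc i))" for P :: "nat \<Rightarrow> bool"
    by (metis nat.exhaust)
  have H: "H \<longleftrightarrow> (\<forall>m<r 0. e m \<in> poly_ring V \<and> (\<forall>s\<in>Poly_Mapping.keys (e m). mon_deg s = d 0 m)) \<and>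
     (\<forall>i. \<forall>l<r i. \<forall>m<r (Suc i).
        \<phi> i l m \<in> poly_ring V \<and> (\<forall>s\<in>Poly_Mapping.keys (\<phi> i l m). d i l + mon_deg s = d (Suc i) m))"
    unfolding H_def by (subst all_nat) (auto simp: homp_def)
  have X0: "X 0 \<longleftrightarrow> aug_map (r 0) e ` free_mod V (r 0) = I" if H
  proof -
    have aug: "aug_map (r 0) e w = mv {..<r 0} (?D 0) w 0" for w
      by (simp add: aug_map_def mv_def)
    have eR: "e m \<in> poly_ring V" if "m < r 0" for m using \<open>H\<close> that unfolding H by blast
    have img: "p \<in> aug_map (r 0) e ` free_mod V (r 0) \<longleftrightarrow>
        (\<exists>w. polyvec V {..<r 0} w \<and> p = mv {..<r 0} (?D 0) w 0)" for p
    proof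
      assume "\<exists>w. polyvec V {..<r 0} w \<and> p = mv {..<r 0} (?D 0) w 0"
      then obtain w where w: "polyvec V {..<r 0} w" "p = mv {..<r 0} (?D 0) w 0" by blast
      have "p = aug_map (r 0) e (restrict w {..<r 0})"
        unfolding aug w(2) by (rule mv_cong) auto
      moreover have "restrict w {..<r 0} \<in> free_mod V (r 0)"
        using w(1) by (auto simp: free_mod_def polyvec_def)
      ultimately show "p \<in> aug_map (r 0) e ` free_mod V (r 0)" by blast
    qed (auto simp: aug free_mod_def polyvec_def PiE_iff)
    have imgR: "aug_map (r 0) e ` free_mod V (r 0) \<subseteq> poly_ring V"
      by (auto simp: aug_map_def free_mod_def PiE_iff intro!: poly_ring_sum poly_ring_mult eR)
    have "X 0 \<longleftrightarrow> (\<forall>p\<in>poly_ring V. p \<in> I \<longleftrightarrow> p \<in> aug_map (r 0) e ` free_mod V (r 0))"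
      unfolding img X_def
    proof
      assume X: "\<forall>v. polyvec V (?B 0) v \<longrightarrow> (cycle I 0 ?B ?D 0 v \<longleftrightarrow>
        (\<exists>w. polyvec V (?B (Suc 0)) w \<and> (\<forall>b\<in>?B 0. v b = mv (?B (Suc 0)) (?D 0) w b)))"
      show "\<forall>p\<in>poly_ring V. p \<in> I \<longleftrightarrow> (\<exists>w. polyvec V {..<r 0} w \<and> p = mv {..<r 0} (?D 0) w 0)"
      proof
        fix p :: "('a, 'b) mpoly" assume "p \<in> poly_ring V"
        thus "p \<in> I \<longleftrightarrow> (\<exists>w. polyvec V {..<r 0} w \<and> p = mv {..<r 0} (?D 0) w 0)"
          using X[rule_format, of "\<lambda>_. p"] by (simp add: polyvec_def)
      qed
    qed (simp add: polyvec_def)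
    also have "\<dots> \<longleftrightarrow> aug_map (r 0) e ` free_mod V (r 0) = I" using assms imgR by blast
    finally show ?thesis .
  qed
  have X1: "X (Suc 0) \<longleftrightarrow> {v \<in> free_mod V (r 0). aug_map (r 0) e v = 0}
       = mat_map (r 0) (r 1) (\<phi> 0) ` free_mod V (r 1)" if H
    unfolding X_def
  proof (subst image_eq_iff_exact)
    show "aug_map (r 0) e v = 0 \<longleftrightarrow> aug_map (r 0) e v' = 0" if "\<And>l. l < r 0 \<Longrightarrow> v l = v' l" for v v'
      using that by (simp add: aug_map_def)
    show "\<phi> 0 l m \<in> poly_ring V" if "l < r 0" "m < r 1" for l m
      using \<open>H\<close> that unfolding H by auto
  qed (simp add: aug_map_def mv_def)
  have X2: "X (Suc (Suc i)) \<longleftrightarrow> {v \<in> free_mod V (r (Suc i)). mat_map (r i) (r (Suc i)) (\<phi> i) v = free_zero (r i)}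
            = mat_map (r (Suc i)) (r (Suc (Suc i))) (\<phi> (Suc i)) ` free_mod V (r (Suc (Suc i)))" if H for i
  proof -
    have zero: "mat_map (r i) (r (Suc i)) (\<phi> i) v = free_zero (r i) \<longleftrightarrow>
        (\<forall>l\<in>{..<r i}. mv {..<r (Suc i)} (\<phi> i) v l = 0)" for v
      by (auto simp: mat_map_def free_zero_def mv_def restrict_def fun_eq_iff)
    show ?thesis unfolding zero X_def
    proof (subst image_eq_iff_exact)
      show "(\<forall>l\<in>{..<r i}. mv {..<r (Suc i)} (\<phi> i) v l = 0) \<longleftrightarrow> (\<forall>l\<in>{..<r i}. mv {..<r (Suc i)} (\<phi> i) v' l = 0)"
        if "\<And>l. l < r (Suc i) \<Longrightarrow> v l = v' l" for v v'
      proof -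
        have "mv {..<r (Suc i)} (\<phi> i) v l = mv {..<r (Suc i)} (\<phi> i) v' l" for l
          by (rule mv_cong) (use that in auto)
        thus ?thesis by simp
      qed
      show "\<phi> (Suc i) l m \<in> poly_ring V" if "l < r (Suc i)" "m < r (Suc (Suc i))" for l m
        using \<open>H\<close> that unfolding H by auto
    qed simp
  qed
  have "resolution V I 0 ?B ?d ?D \<longleftrightarrow> H \<and> X 0 \<and> X (Suc 0) \<and> (\<forall>i. X (Suc (Suc i)))"
    unfolding res using all_nat[of X] all_nat[of "\<lambda>i. X (Suc i)"] by simp
  also have "\<dots> \<longleftrightarrow> graded_free_resolution V I r d e \<phi>"
  proof (cases H)
    case True
    note X = X0[OF True] X1[OF True] X2[OF True]
    note H' = H[THEN iffD1, OF True]
    show ?thesis unfolding graded_free_resolution_def X 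
      by (simp only: eqTrueI[OF H'[THEN conjunct1]] eqTrueI[OF H'[THEN conjunct2]] eqTrueI[OF True] simp_thms)
  next
    case False
    thus ?thesis unfolding graded_free_resolution_def H by blast
  qed
  finally show ?thesis by blast
qed

lemma minimal_graded_free_resolution_iff:
  assumes "I \<subseteq> poly_ring V"
  shows "minimal_graded_free_resolution V I r d e \<phi> \<longleftrightarrow>
    resolution V I 0 (shift_basis r) (shift_degree d) (shift_maps e \<phi>) \<and>
    minimal_entries (shift_basis r) (shift_maps e \<phi>)"
  unfolding minimal_graded_free_resolution_def graded_free_resolution_iff[OF assms]
  by (auto simp: minimal_entries_def shift_defs)

theorem graded_betti_eq_induced_matchings:
  fixes V :: "'v set" and E :: "'v set set"
  assumes V: "finite V" and E: "\<And>e. e \<in> E \<Longrightarrow> e \<subseteq> V \<and> card e = 2"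
  shows "graded_betti V (edge_ideal V E :: ('v, 'k::field) mpoly set) i (2 * (i + 1)) =
    card {M. induced_matching E M \<and> card M = i + 1}"
proof -
  have "E \<subseteq> Pow V" using E by auto
  hence "finite E" using V finite_subset by blast
  then obtain rk :: "'v set \<Rightarrow> nat" where rk: "inj_on rk E"
    using finite_imp_inj_to_nat_seg by blast
  interpret ordered_graph V E rk by unfold_locales (use V E rk in auto)
  let ?I = "edge_ideal V E :: ('v, 'k) mpoly set"
  have I: "?I \<subseteq> poly_ring V"
  proof
    fix p assume "p \<in> ?I"
    then obtain w where "\<forall>e\<in>E. w e \<in> poly_ring V" "p = (\<Sum>e\<in>E. Poly_Mapping.single (sqf_mon e) 1 * w e)"
      unfolding edge_ideal_iff by blast
    moreover have "Poly_Mapping.keys (sqf_mon e) \<subseteq> V" if "e \<in> E" for e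
      using E[OF that] finite_subset[OF _ V] by (auto simp: keys_sqf_mon)
    ultimately show "p \<in> poly_ring V" by (auto intro!: poly_ring_sum poly_ring_mult poly_ring_single)
  qed
  let ?b = "card {M. induced_matching E M \<and> card M = i + 1}"
  have unique: "card {l. l < r i \<and> d i l = 2 * (i + 1)} = ?b"
    if "minimal_graded_free_resolution V ?I r d e \<phi>" for r d e \<phi>
  proof -
    have "{l. l < r i \<and> d i l = 2 * (i + 1)} = {l \<in> shift_basis r (Suc i). shift_degree d (Suc i) l = 2 * Suc i}"
      by (simp add: shift_defs)
    thus ?thesis using that card_degree_eq_induced_matchings[of 0 "shift_basis r" "shift_degree d" "shift_maps e \<phi>" i]
      unfolding minimal_graded_free_resolution_iff[OF I] by simp
  qed
  have "\<exists>r d e \<phi>. minimal_graded_free_resolution V ?I r d e \<phi>"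
  proof -
    have empty: "faces E i = {}" if "i > card E" for i
    proof (rule ccontr)
      assume "faces E i \<noteq> {}"
      then obtain S where "S \<subseteq> E" "card S = i" by (auto simp: faces_def)
      thus False using that card_mono[OF finite_E, of S] by simp
    qed
    have "\<exists>(B :: nat \<Rightarrow> 'v set set set) D. resolution V ?I {} B (\<lambda>i S. card (\<Union>S)) D \<and> minimal_entries B D"
    proof (rule minimal_resolution_exists)
      show "resolution V ?I {} (faces E) (\<lambda>i S. card (\<Union>S)) (taylor rk)" by (rule taylor_resolution)
    qed (use empty in blast)
    then obtain B and D :: "nat \<Rightarrow> 'v set set \<Rightarrow> 'v set set \<Rightarrow> ('v, 'k) mpoly"
      where BD: "resolution V ?I {} B (\<lambda>i S. card (\<Union>S)) D" "minimal_entries B D"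
      by blast
    interpret F: resolution V ?I "{}" B "\<lambda>i S. card (\<Union>S)" D by (rule BD(1))
    let ?r = "\<lambda>i. card (B (Suc i))"
    have "\<exists>h. bij_betw h {..<?r i} (B (Suc i))" for i
      using ex_bij_betw_nat_finite[OF F.finite_basis] by (simp add: atLeast0LessThan)
    then obtain h where h: "\<And>i. bij_betw (h i) {..<?r i} (B (Suc i))" by metis
    have hB: "h i l \<in> B (Suc i)" if "l < ?r i" for i l using h[of i] that by (auto simp: bij_betw_def)
    define h' where "h' i = (case i of 0 \<Rightarrow> \<lambda>_. {} | Suc j \<Rightarrow> h j)" for i
    let ?d = "\<lambda>i l. card (\<Union>(h i l))" and ?e = "\<lambda>m. D 0 {} (h 0 m)"
      and ?\<phi> = "\<lambda>i l m. D (Suc i) (h i l) (h (Suc i) m)"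
    have "bij_betw (h' i) (shift_basis ?r i) (B i)" for i
      using h F.basis_0 by (cases i) (auto simp: h'_def shift_basis_def bij_betw_def)
    hence "resolution V ?I 0 (shift_basis ?r) (\<lambda>i l. card (\<Union>(h' i l))) (\<lambda>i l m. D i (h' i l) (h' (Suc i) m))"
      by (rule F.reindex) (simp add: shift_basis_def)
    also have "(\<lambda>i l. card (\<Union>(h' i l))) = shift_degree ?d"
      by (intro ext) (simp add: h'_def shift_degree_def split: nat.split)
    also have "(\<lambda>i l m. D i (h' i l) (h' (Suc i) m)) = shift_maps ?e ?\<phi>"
      by (intro ext) (simp add: h'_def shift_maps_def split: nat.split)
    finally have "resolution V ?I 0 (shift_basis ?r) (shift_degree ?d) (shift_maps ?e ?\<phi>)" .
    moreover have "minimal_entries (shift_basis ?r) (shift_maps ?e ?\<phi>)"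
      using BD(2) hB by (auto simp: minimal_entries_def shift_defs)
    ultimately show ?thesis unfolding minimal_graded_free_resolution_iff[OF I] by blast
  qed
  then obtain r d e \<phi> where res: "minimal_graded_free_resolution V ?I r d e \<phi>" by blast
  show ?thesis unfolding graded_betti_def
  proof (rule the_equality)
    show "\<exists>r d e \<phi>. minimal_graded_free_resolution V ?I r d e \<phi> \<and> ?b = card {l. l < r i \<and> d i l = 2 * (i + 1)}"
      by (intro exI[of _ r] exI[of _ d] exI[of _ e] exI[of _ \<phi>] conjI res unique[OF res, symmetric])
    fix b assume "\<exists>r d e \<phi>. minimal_graded_free_resolution V ?I r d e \<phi> \<and> b = card {l. l < r i \<and> d i l = 2 * (i + 1)}"
    then obtain r d e \<phi> where "minimal_graded_free_resolution V ?I r d e \<phi>"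
      "b = card {l. l < r i \<and> d i l = 2 * (i + 1)}" by blast
    thus "b = ?b" using unique by simp
  qed
qed

section \<open>Induced matchings of the graph\<close>

lemma (in finite_graph) induced_matching_edges_eq:
  assumes "induced_matching E M" "e \<in> M" "f \<in> M" "x \<in> e" "x \<in> f"
  shows "e = f"
  using matching_disjoint[of M f] assms by (auto simp: induced_matching_def)

lemma induced_matching_subset:
  assumes "finite_graph V E" "induced_matching E M" "M' \<subseteq> M"
  shows "induced_matching E M'"
proof -
  interpret finite_graph V E by fact
  have ME: "M \<subseteq> E" "finite M" using assms(2) finite_face by (auto simp: induced_matching_def)
  have disj: "e \<inter> f = {}" if "e \<in> M" "f \<in> M" "e \<noteq> f" for e f
    using induced_matching_edges_eq[OF assms(2) that(1,2)] that(3) by blast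
  have "card (\<Union>M') = (\<Sum>e\<in>M'. card e)"
  proof (rule card_Union_disjoint)
    show "pairwise disjnt M'" using disj assms(3) by (auto simp: pairwise_def disjnt_def)
    show "finite e" if "e \<in> M'" for e using that ME assms(3) finite_covered[of "{e}"] by auto
  qed
  also have "\<dots> = (\<Sum>e\<in>M'. 2)" using ME assms(3) card_edge by (intro sum.cong) auto
  finally have "card (\<Union>M') = 2 * card M'" by simp
  moreover have "e \<in> M'" if "e \<in> E" "e \<subseteq> \<Union>M'" for e
  proof -
    have "e \<subseteq> \<Union>M" using assms(3) that(2) by blast
    hence "e \<in> M" using assms(2) that(1) by (auto simp: induced_matching_def)
    moreover have "e \<noteq> {}" using card_edge[OF that(1)] by auto
    ultimately show ?thesis using that(2) disj assms(3) by blast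
  qed
  ultimately show ?thesis using ME assms(3) by (auto simp: induced_matching_def)
qed

text \<open>
  Starting from a minimum \<open>a\<close>, after \<open>s < t\<close> steps the value is at least \<open>a\<close>, at most \<open>a + s\<close> and congruent
  to \<open>a + s\<close> modulo \<open>t\<close>, so the function climbs with slope one for a whole period.
\<close>

lemma sawtooth_image:
  fixes f :: "int \<Rightarrow> int" and t r :: int
  assumes t: "t > 0" and per: "\<And>c. f (c + t) = f c" and step: "\<And>c. f (c + 1) \<le> f c + 1"
    and res: "\<And>c. t dvd f c - c - r"
  obtains a where "range f = {a..<a + t}"
proof -
  have per': "f (c mod t) = f c" for c
  proof -
    have "f (x + int m * t) = f x" for x m
    proof (induction m)
      case (Suc m)
      have "x + int (Suc m) * t = (x + int m * t) + t" by (simp add: algebra_simps)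
      thus ?case using Suc per by metis
    qed simp
    hence nn: "f (x + m * t) = f x" if "m \<ge> 0" for x m using that by (metis nonneg_int_cases)
    show ?thesis
    proof (cases "c div t \<ge> 0")
      case True
      thus ?thesis using nn[of "c div t" "c mod t"] by (simp add: algebra_simps)
    next
      case False
      thus ?thesis using nn[of "- (c div t)" c] by (simp add: minus_mult_div_eq_mod[symmetric] algebra_simps)
    qed
  qed
  have rng: "range f = f ` {0..<t}"
  proof
    show "range f \<subseteq> f ` {0..<t}"
    proof
      fix y assume "y \<in> range f"
      then obtain c where "y = f c" by blast
      hence "y = f (c mod t)" by (simp add: per')
      thus "y \<in> f ` {0..<t}" using t by auto
    qed
  qed auto
  define a where "a = Min (range f)"
  have fin: "finite (range f)" unfolding rng by simp
  have "a \<in> range f" unfolding a_def using fin by (intro Min_in) auto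
  then obtain c0 where c0: "a = f c0" by blast
  have lower: "a \<le> f c" for c unfolding a_def using fin by (intro Min_le) auto
  have upper: "f (c0 + int s) \<le> a + int s" for s
  proof (induction s)
    case (Suc s)
    have "c0 + int (Suc s) = (c0 + int s) + 1" by simp
    hence "f (c0 + int (Suc s)) \<le> f (c0 + int s) + 1" using step by metis
    thus ?case using Suc by simp
  qed (simp add: c0)
  have eq: "f (c0 + s) = a + s" if s: "0 \<le> s" "s < t" for s
  proof -
    have "f (c0 + s) \<le> a + s" using upper[of "nat s"] s by simp
    moreover have "a \<le> f (c0 + s)" by (rule lower)
    moreover have "t dvd - (a + s - f (c0 + s))"
      using dvd_diff[OF res[of "c0 + s"] res[of c0]] by (simp add: c0 algebra_simps)
    hence "t dvd a + s - f (c0 + s)" by (simp only: dvd_minus_iff)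
    ultimately show ?thesis using s zdvd_not_zless[of "a + s - f (c0 + s)" t] by linarith
  qed
  have "range f = {a..<a + t}"
  proof
    show "range f \<subseteq> {a..<a + t}"
    proof
      fix y assume "y \<in> range f"
      then obtain c where c: "y = f c" by blast
      let ?s = "(c - c0) mod t"
      have "y = f ((c0 + ?s) mod t)" by (simp add: c mod_simps per')
      hence "y = a + ?s" using eq[of ?s] t by (simp add: per')
      thus "y \<in> {a..<a + t}" using t by simp
    qed
    show "{a..<a + t} \<subseteq> range f"
    proof
      fix y assume "y \<in> {a..<a + t}"
      hence "y = f (c0 + (y - a))" using eq[of "y - a"] by simp
      thus "y \<in> range f" by blast
    qed
  qed
  thus ?thesis by (rule that)
qed

locale circulant =
  fixes t k :: nat
  assumes t: "t \<ge> 1" and k: "k \<ge> 4"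
begin

definition T :: int where "T = int t"
definition N :: int where "N = int (GA_size t k)"

abbreviation "V \<equiv> GA'_verts t k"
abbreviation "E \<equiv> GA'_edges t k"

lemma T_pos: "T \<ge> 1" using t by (simp add: T_def)

lemma N_eq: "N = T * (int k - 1) + 2"
  using k by (simp add: N_def GA_size_def T_def of_nat_diff)

lemma N_large: "N \<ge> 3 * T + 2"
proof -
  have "T * 3 \<le> T * (int k - 1)" using k T_pos by (intro mult_left_mono) auto
  thus ?thesis by (simp add: N_eq)
qed

lemma V_eq: "V = {0..<N}" by (simp add: GA'_verts_def N_def)

text \<open>The position of \<open>x\<close> after cutting the circle open at \<open>u\<close> and reading it clockwise.\<close>

definition pos :: "int \<Rightarrow> int \<Rightarrow> int" where
  "pos u x = (x - u) mod N"

lemma pos_range: "0 \<le> pos u x" "pos u x < N"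
  using N_large T_pos by (auto simp: pos_def)

lemma pos_shift: "pos u ((u + q) mod N) = q" if "0 \<le> q" "q < N"
  using that by (simp add: pos_def mod_simps)

lemma pos_inv: "x \<in> V \<Longrightarrow> (u + pos u x) mod N = x"
  by (simp add: pos_def mod_simps V_eq)

lemma mod_in_V: "x mod N \<in> V"
  using N_large T_pos by (simp add: V_eq)

lemma pos_inj: "x \<in> V \<Longrightarrow> y \<in> V \<Longrightarrow> pos u x = pos u y \<longleftrightarrow> x = y"
  using pos_inv by metis

lemma pos_eq_0_iff: "u \<in> V \<Longrightarrow> x \<in> V \<Longrightarrow> pos u x = 0 \<longleftrightarrow> x = u"
  using pos_inj[of x u u] by (simp add: pos_def)

lemma pos_diff: "pos u x \<le> pos u y \<Longrightarrow> pos x y = pos u y - pos u x"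
proof -
  assume "pos u x \<le> pos u y"
  hence "pos u y - pos u x = (pos u y - pos u x) mod N" using pos_range[of u x] pos_range[of u y] by simp
  also have "\<dots> = pos x y" by (simp add: pos_def mod_simps)
  finally show ?thesis ..
qed

lemma pos_swap:
  assumes "0 < pos x y"
  shows "pos y x = N - pos x y"
proof -
  have "pos y x = (- pos x y) mod N" by (simp add: pos_def mod_simps)
  also have "\<dots> = (N - pos x y) mod N" by simp
  also have "\<dots> = N - pos x y" using assms pos_range[of x y] by (intro mod_pos_pos_trivial) auto
  finally show ?thesis .
qed

definition chord :: "int \<Rightarrow> bool" where
  "chord \<delta> \<longleftrightarrow> T dvd \<delta> - 1 \<and> 1 < \<delta> \<and> \<delta> < N - 1"

lemma chord_iff: "chord \<delta> \<longleftrightarrow> (\<exists>j\<in>{1..k - 2}. \<delta> = 1 + int j * T)"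
proof
  assume c: "chord \<delta>"
  then obtain m where m: "\<delta> - 1 = T * m" by (auto simp: chord_def)
  have "0 < T * m" "T * m < T * (int k - 1)" using c m by (auto simp: chord_def N_eq)
  hence "0 < m" "m < int k - 1" using T_pos by (auto simp: zero_less_mult_iff mult_less_cancel_left)
  hence "nat m \<in> {1..k - 2}" "\<delta> = 1 + int (nat m) * T" using m by (auto simp: algebra_simps)
  thus "\<exists>j\<in>{1..k - 2}. \<delta> = 1 + int j * T" by blast
next
  assume "\<exists>j\<in>{1..k - 2}. \<delta> = 1 + int j * T"
  then obtain j where j: "1 \<le> j" "j \<le> k - 2" "\<delta> = 1 + int j * T" by auto
  have "0 < int j * T" using j T_pos by simp
  moreover have "int j * T < (int k - 1) * T" using j k T_pos by (intro mult_strict_right_mono) auto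
  ultimately show "chord \<delta>" using j(3) by (simp add: chord_def N_eq mult.commute)
qed

lemma chord_sym: "chord (N - \<delta>) \<longleftrightarrow> chord \<delta>"
proof -
  have "T dvd N - 2" by (simp add: N_eq)
  hence "T dvd N - \<delta> - 1 \<longleftrightarrow> T dvd \<delta> - 1" using dvd_diff_right_iff[of T "N - 2" "\<delta> - 1"]
    by (simp add: algebra_simps)
  thus ?thesis by (auto simp: chord_def)
qed

lemma edge_iff: "e \<in> E \<longleftrightarrow> (\<exists>a\<in>V. \<exists>b\<in>V. e = {a, b} \<and> chord (pos a b))"
proof -
  have link: "(\<exists>j\<in>{1..k - 2}. [b - a = 1 + int j * int t] (mod int (GA_size t k))) \<longleftrightarrow> chord (pos a b)" for a b
  proof -
    have "[b - a = 1 + int j * T] (mod N) \<longleftrightarrow> pos a b = 1 + int j * T" if "j \<in> {1..k - 2}" for j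
    proof -
      have "chord (1 + int j * T)" using that chord_iff by blast
      hence "(1 + int j * T) mod N = 1 + int j * T" by (simp add: chord_def)
      thus ?thesis by (simp add: cong_def pos_def)
    qed
    thus ?thesis by (auto simp: chord_iff T_def N_def)
  qed
  show ?thesis unfolding GA'_edges_def link by auto
qed

text \<open>
  Adjacency can be read off from positions on the circle cut open anywhere, because the set of chords is
  closed under \<open>\<delta> \<mapsto> N - \<delta>\<close>.
\<close>

lemma edge_pos_iff:
  assumes "x \<in> V" "y \<in> V" "pos u x < pos u y"
  shows "{x, y} \<in> E \<longleftrightarrow> chord (pos u y - pos u x)"
proof -
  have xy: "pos x y = pos u y - pos u x" using assms(3) by (intro pos_diff) simp
  hence "chord (pos y x) \<longleftrightarrow> chord (pos x y)" using assms(3) pos_swap[of x y] chord_sym by simp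
  thus ?thesis unfolding edge_iff xy[symmetric] using assms(1,2) by (auto simp: doubleton_eq_iff)
qed

lemma edge_oriented:
  assumes "e \<in> E"
  obtains x y where "e = {x, y}" "x \<in> V" "y \<in> V" "pos u x < pos u y" "chord (pos u y - pos u x)"
proof -
  obtain a b where ab: "a \<in> V" "b \<in> V" "e = {a, b}" "chord (pos a b)" using assms edge_iff by blast
  have "a \<noteq> b" using ab(4) by (auto simp: pos_def chord_def)
  hence "pos u a < pos u b \<or> pos u b < pos u a" using pos_inj[of a b u] ab by linarith
  thus ?thesis
  proof
    assume "pos u a < pos u b"
    thus ?thesis using that[of a b] ab assms edge_pos_iff[of a b u] by simp
  next
    assume "pos u b < pos u a"
    thus ?thesis using that[of b a] ab assms edge_pos_iff[of b a u] by (simp add: insert_commute)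
  qed
qed

sublocale finite_graph V E
proof
  show "finite V" by (simp add: V_eq)
  show "e \<subseteq> V" if "e \<in> E" for e using that edge_iff by auto
  show "card e = 2" if e: "e \<in> E" for e
  proof -
    obtain x y where "e = {x, y}" "pos 0 x < pos 0 y" using e by (rule edge_oriented)
    thus ?thesis by (auto simp: card_2_iff)
  qed
qed

text \<open>
  Otherwise all edges of the graph would belong to the matching, but vertices have more than one
  neighbour.
\<close>

lemma induced_matching_misses_vertex:
  assumes M: "induced_matching E M"
  obtains u where "u \<in> V" "u \<notin> \<Union>M"
proof -
  have "\<exists>u\<in>V. u \<notin> \<Union>M"
  proof (rule ccontr)
    assume "\<not> ?thesis"
    hence all: "V \<subseteq> \<Union>M" by blast
    have chords: "chord (1 + T)" "chord (1 + 2 * T)" using T_pos N_large by (auto simp: chord_def)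
    have "pos 0 x = x" if "0 \<le> x" "x < N" for x using that by (simp add: pos_def)
    hence "{0, x} \<in> E" if "chord x" for x
      using that edge_pos_iff[of 0 x 0] N_large T_pos by (auto simp: V_eq chord_def)
    hence "{0, 1 + T} \<in> E" "{0, 1 + 2 * T} \<in> E" using chords by blast+
    hence "{0, 1 + T} \<in> M" "{0, 1 + 2 * T} \<in> M"
      using M all edges_sub by (meson induced_matching_def subset_trans)+
    hence "{0, 1 + T} = {0, 1 + 2 * T}" using induced_matching_edges_eq[OF M] by blast
    thus False using T_pos by (auto simp: doubleton_eq_iff)
  qed
  thus ?thesis using that by blast
qed

end

text \<open>
  An induced matching seen from a vertex \<open>u\<close> outside of it. Each edge goes from the vertex
  \<open>left e\<close> clockwise to the vertex \<open>right e\<close> without meeting \<open>u\<close>.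
\<close>

locale cut_matching = circulant +
  fixes M :: "int set set" and u :: int and left right :: "int set \<Rightarrow> int"
  assumes M: "induced_matching E M" and u: "u \<in> V" "u \<notin> \<Union>M"
    and ends: "e \<in> M \<Longrightarrow> e = {left e, right e} \<and> pos u (left e) < pos u (right e)"
begin

lemma edge_in_M:
  assumes "x \<in> \<Union>M" "y \<in> \<Union>M" "T dvd pos u y - pos u x - 1" "pos u x + 1 < pos u y"
  shows "{x, y} \<in> M \<and> left {x, y} = x"
proof -
  have V: "x \<in> V" "y \<in> V" using assms(1,2) M edges_sub by (auto simp: induced_matching_def)
  have "pos u x \<noteq> 0" using assms(1) u V pos_eq_0_iff by blast
  hence "chord (pos u y - pos u x)" using assms(3,4) pos_range[of u x] pos_range[of u y]
    by (simp add: chord_def)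
  hence "{x, y} \<in> E" using edge_pos_iff[OF V, of u] assms(4) by simp
  hence inM: "{x, y} \<in> M" using M assms(1,2) by (auto simp: induced_matching_def)
  hence "{x, y} = {left {x, y}, right {x, y}}" "pos u (left {x, y}) < pos u (right {x, y})"
    using ends by blast+
  thus ?thesis using inM assms(4) by (auto simp: doubleton_eq_iff)
qed

lemma edge_ends:
  assumes "e \<in> M"
  shows "left e \<in> e" "right e \<in> e" "left e \<in> \<Union>M" "right e \<in> \<Union>M" "left e \<in> V" "right e \<in> V"
    "T dvd pos u (right e) - pos u (left e) - 1" "pos u (left e) + 1 < pos u (right e)"
proof -
  show mem: "left e \<in> e" "right e \<in> e" using ends[OF assms] by blast+
  thus "left e \<in> \<Union>M" "right e \<in> \<Union>M" using assms by blast+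
  have E: "e \<in> E" using assms M by (auto simp: induced_matching_def)
  thus V: "left e \<in> V" "right e \<in> V" using mem edges_sub by blast+
  have "chord (pos u (right e) - pos u (left e))"
    using edge_pos_iff[OF V, of u] ends[OF assms] E by metis
  thus "T dvd pos u (right e) - pos u (left e) - 1" "pos u (left e) + 1 < pos u (right e)"
    by (auto simp: chord_def)
qed

lemma same_edge: "e \<in> M \<Longrightarrow> f \<in> M \<Longrightarrow> x \<in> e \<Longrightarrow> x \<in> f \<Longrightarrow> e = f"
  using induced_matching_edges_eq[OF M] .

text \<open>
  If two edges start at positions that are congruent modulo \<open>t\<close>, then the earlier start is joined
  to the end of the other edge, and this third edge belongs to the matching and meets both.
\<close>

lemma residue_inj: "inj_on (\<lambda>e. pos u (left e) mod T) M"
proof (rule inj_onI)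
  have *: "e = f" if "e \<in> M" "f \<in> M" "pos u (left e) mod T = pos u (left f) mod T"
    "pos u (left e) \<le> pos u (left f)" for e f
  proof -
    have "T dvd pos u (left f) - pos u (left e)" using that(3) by (metis mod_eq_dvd_iff)
    hence "T dvd (pos u (right f) - pos u (left f) - 1) + (pos u (left f) - pos u (left e))"
      using edge_ends(7)[OF that(2)] by (rule dvd_add[rotated])
    hence "T dvd pos u (right f) - pos u (left e) - 1" by (simp add: algebra_simps)
    moreover have "pos u (left e) + 1 < pos u (right f)" using edge_ends(8)[OF that(2)] that(4) by linarith
    ultimately have g: "{left e, right f} \<in> M"
      using edge_in_M[of "left e" "right f"] edge_ends(3)[OF that(1)] edge_ends(4)[OF that(2)] by simp
    have "e = {left e, right f}" using same_edge[OF that(1) g edge_ends(1)[OF that(1)]] by simp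
    also have "\<dots> = f" using same_edge[OF g that(2) _ edge_ends(2)[OF that(2)]] by simp
    finally show "e = f" .
  qed
  fix e f assume "e \<in> M" "f \<in> M" "pos u (left e) mod T = pos u (left f) mod T"
  thus "e = f" using *[of e f] *[of f e] by (cases "pos u (left e) \<le> pos u (left f)") auto
qed

lemma card_le: "card M \<le> t"
proof -
  have "card M \<le> card {0..<T}"
    using T_pos by (intro card_inj_on_le[OF residue_inj]) auto
  thus ?thesis by (simp add: T_def)
qed

text \<open>
  If every residue occurs, the starts in consecutive residue classes satisfy the hypotheses of
  the lemma on sawtooth functions, because a larger step would be an edge between two starts.
  The same holds for the ends.
\<close>

lemma covered_positions:
  assumes "card M = t"
  obtains a b where "1 \<le> a" "a + T + 1 \<le> b" "b + T \<le> N"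
    "pos u ` \<Union>M = {a..<a + T} \<union> {b..<b + T}"
proof -
  have "(\<lambda>e. pos u (left e) mod T) ` M = {0..<T}"
  proof (rule card_subset_eq)
    show "card ((\<lambda>e. pos u (left e) mod T) ` M) = card {0..<T}"
      by (subst card_image[OF residue_inj]) (simp add: assms T_def)
  qed (use T_pos in auto)
  hence "\<exists>e\<in>M. pos u (left e) mod T = c mod T" for c
  proof -
    assume *: "(\<lambda>e. pos u (left e) mod T) ` M = {0..<T}"
    have "c mod T \<in> {0..<T}" using T_pos by simp
    thus ?thesis unfolding *[symmetric] by force
  qed
  then obtain ed where ed: "\<And>c. ed c \<in> M" "\<And>c. pos u (left (ed c)) mod T = c mod T" by metis
  have ed_unique: "ed c = e" if "e \<in> M" "pos u (left e) mod T = c mod T" for c e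
    using inj_onD[OF residue_inj, of "ed c" e] ed that by simp
  define X where "X c = pos u (left (ed c))" for c
  define Y where "Y c = pos u (right (ed c))" for c
  have per: "ed (c + T) = ed c" for c by (rule ed_unique) (simp_all add: ed)
  have resX: "T dvd X c - c - 0" for c using ed(2)[of c] by (simp add: X_def mod_eq_dvd_iff)
  have XY: "T dvd Y c - X c - 1" "X c + 1 < Y c" for c
    using edge_ends(7,8)[OF ed(1)] by (auto simp: X_def Y_def)
  have resY: "T dvd Y c - c - 1" for c
    using dvd_add[OF resX[of c] XY(1)[of c]] by (simp add: algebra_simps)
  have stepX: "X (c + 1) \<le> X c + 1" for c
  proof (rule ccontr)
    assume big: "\<not> ?thesis"
    moreover have "T dvd X (c + 1) - X c - 1"
      using dvd_diff[OF resX[of "c + 1"] resX[of c]] by (simp add: algebra_simps)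
    ultimately have e: "{left (ed c), left (ed (c + 1))} \<in> M"
      using edge_in_M[of "left (ed c)" "left (ed (c + 1))"] edge_ends ed(1) by (auto simp: X_def)
    have "ed c = ed (c + 1)" using same_edge[OF e] ed(1) edge_ends(1) by (metis insertCI)
    thus False using big by (simp add: X_def)
  qed
  have stepY: "Y (c + 1) \<le> Y c + 1" for c
  proof (rule ccontr)
    assume big: "\<not> ?thesis"
    moreover have "T dvd Y (c + 1) - Y c - 1"
      using dvd_diff[OF resY[of "c + 1"] resY[of c]] by (simp add: algebra_simps)
    ultimately have e: "{right (ed c), right (ed (c + 1))} \<in> M"
      using edge_in_M[of "right (ed c)" "right (ed (c + 1))"] edge_ends ed(1) by (auto simp: Y_def)
    have "ed c = ed (c + 1)" using same_edge[OF e] ed(1) edge_ends(2) by (metis insertCI)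
    thus False using big by (simp add: Y_def)
  qed
  obtain a where a: "range X = {a..<a + T}"
    by (rule sawtooth_image[of T X 0]) (use T_pos per resX stepX in \<open>auto simp: X_def\<close>)
  obtain b where b: "range Y = {b..<b + T}"
    by (rule sawtooth_image[of T Y 1]) (use T_pos per resY stepY in \<open>auto simp: Y_def\<close>)
  have "pos u ` \<Union>M = range X \<union> range Y"
  proof
    show "pos u ` \<Union>M \<subseteq> range X \<union> range Y"
    proof
      fix p assume "p \<in> pos u ` \<Union>M"
      then obtain e x where e: "e \<in> M" "x \<in> e" "p = pos u x" by blast
      have "ed (pos u (left e)) = e" by (rule ed_unique) (simp_all add: e)
      moreover have "x = left e \<or> x = right e" using ends[OF e(1)] e(2) by blast
      ultimately have "p = X (pos u (left e)) \<or> p = Y (pos u (left e))" using e(3) by (auto simp: X_def Y_def)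
      thus "p \<in> range X \<union> range Y" by blast
    qed
    show "range X \<union> range Y \<subseteq> pos u ` \<Union>M"
      using edge_ends(3,4)[OF ed(1)] by (auto simp: X_def Y_def)
  qed
  hence img: "pos u ` \<Union>M = {a..<a + T} \<union> {b..<b + T}" using a b by simp
  have inside: "1 \<le> p \<and> p < N" if p: "p \<in> pos u ` \<Union>M" for p
  proof -
    obtain x where x: "x \<in> \<Union>M" "p = pos u x" using p by (auto simp del: Union_iff)
    have "M \<subseteq> E" using M by (simp add: induced_matching_def)
    hence "x \<in> V" using Union_sub x(1) by blast
    moreover have "x \<noteq> u" using x(1) u(2) by blast
    ultimately have "p \<noteq> 0" using pos_eq_0_iff[OF u(1)] x(2) by simp
    thus ?thesis using x(2) pos_range[of u x] by simp
  qed
  have "b \<in> range Y" using b T_pos by simp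
  then obtain c where c: "b = Y c" by blast
  have "X c \<in> {a..<a + T}" using a by blast
  moreover have "X c + T + 1 \<le> Y c"
  proof -
    have "T dvd Y c - X c - 1" "0 < Y c - X c - 1" using XY[of c] by auto
    thus ?thesis using zdvd_imp_le by fastforce
  qed
  ultimately have "a + T + 1 \<le> b" using c by simp
  moreover have "1 \<le> a" using inside[of a] img T_pos by auto
  moreover have "b + T \<le> N" using inside[of "b + T - 1"] img T_pos by auto
  ultimately show ?thesis using img that by blast
qed

end

context circulant
begin

lemma cut_matching_exists:
  assumes "induced_matching E M"
  obtains u left right where "cut_matching t k M u left right"
proof -
  obtain u where u: "u \<in> V" "u \<notin> \<Union>M" using assms by (rule induced_matching_misses_vertex)
  have "\<exists>x y. e = {x, y} \<and> pos u x < pos u y" if "e \<in> M" for e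
  proof -
    have "e \<in> E" using assms that by (auto simp: induced_matching_def)
    thus ?thesis by (rule edge_oriented[of e u]) blast
  qed
  then obtain left right where "\<And>e. e \<in> M \<Longrightarrow> e = {left e, right e} \<and> pos u (left e) < pos u (right e)"
    by metis
  hence "cut_matching t k M u left right" by unfold_locales (use assms u in auto)
  thus ?thesis by (rule that)
qed

lemma card_induced_matching_le: "induced_matching E M \<Longrightarrow> card M \<le> t"
  using cut_matching_exists cut_matching.card_le by metis

definition arc :: "int \<Rightarrow> int set" where
  "arc x = {y \<in> V. pos x y < T}"

lemma arc_pos:
  assumes "0 \<le> a" "a + T \<le> N"
  shows "arc ((u + a) mod N) = {y \<in> V. a \<le> pos u y \<and> pos u y < a + T}"
proof -
  have "pos ((u + a) mod N) y = (pos u y - a) mod N" for y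
    by (simp add: pos_def mod_simps algebra_simps)
  moreover have "(pos u y - a) mod N < T \<longleftrightarrow> a \<le> pos u y \<and> pos u y < a + T" for y
  proof (cases "a \<le> pos u y")
    case True
    hence "(pos u y - a) mod N = pos u y - a" using pos_range[of u y] assms by simp
    thus ?thesis using True by arith
  next
    case False
    have "(pos u y - a) mod N = (pos u y - a + N) mod N" by simp
    also have "\<dots> = pos u y - a + N" using False pos_range[of u y] assms T_pos
      by (intro mod_pos_pos_trivial) auto
    finally show ?thesis using False pos_range[of u y] assms by simp
  qed
  ultimately show ?thesis by (simp add: arc_def)
qed

text \<open>Pairs of arcs of length \<open>t\<close> with gaps on both sides, each arc being given by its first vertex.\<close>

definition arc_pairs :: "(int \<times> int) set" where
  "arc_pairs = {(x, y). x \<in> V \<and> y \<in> V \<and> T + 1 \<le> pos x y \<and> pos x y \<le> N - T - 1}"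

definition arc_matching :: "int \<times> int \<Rightarrow> int set set" where
  "arc_matching = (\<lambda>(x, y). {e \<in> E. e \<subseteq> arc x \<union> arc y})"

lemma arcs_pos:
  assumes "(x, y) \<in> arc_pairs"
  shows "arc x \<union> arc y = {w \<in> V. pos x w \<in> {0..<T} \<union> {pos x y..<pos x y + T}}"
proof -
  have V: "x \<in> V" "y \<in> V" and d: "T + 1 \<le> pos x y" "pos x y \<le> N - T - 1"
    using assms by (auto simp: arc_pairs_def)
  have "arc y = {w \<in> V. pos x y \<le> pos x w \<and> pos x w < pos x y + T}"
    using arc_pos[of "pos x y" x] d pos_inv[OF V(2)] T_pos by simp
  moreover have "arc x = {w \<in> V. pos x w < T}" by (simp add: arc_def)
  ultimately show ?thesis using pos_range by auto
qed

lemma card_arc_pairs: "card arc_pairs = nat (N * (N - 2 * T - 1))"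
proof -
  let ?D = "{T + 1..N - T - 1}"
  have "bij_betw (\<lambda>(x, \<delta>). (x, (x + \<delta>) mod N)) (V \<times> ?D) arc_pairs"
  proof (rule bij_betwI[where g = "\<lambda>(x, y). (x, pos x y)"])
    show "(\<lambda>(x, \<delta>). (x, (x + \<delta>) mod N)) \<in> V \<times> ?D \<rightarrow> arc_pairs"
      using T_pos by (auto simp: arc_pairs_def mod_in_V pos_shift)
    show "(\<lambda>(x, y). (x, pos x y)) \<in> arc_pairs \<rightarrow> V \<times> ?D" by (auto simp: arc_pairs_def)
  qed (use T_pos in \<open>auto simp: arc_pairs_def pos_inv pos_shift\<close>)
  hence "card arc_pairs = card (V \<times> ?D)" by (simp add: bij_betw_same_card)
  also have "\<dots> = nat N * nat (N - 2 * T - 1)"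
    by (simp add: card_cartesian_product V_eq algebra_simps)
  also have "\<dots> = nat (N * (N - 2 * T - 1))"
    using N_large T_pos by (simp add: nat_mult_distrib)
  finally show ?thesis .
qed

text \<open>
  Within an arc no difference of positions is a chord. Between the two arcs, each vertex of the first
  has exactly one neighbour, determined by its position modulo \<open>t\<close>.
\<close>

lemma arc_matching_props:
  assumes xy: "(x, y) \<in> arc_pairs"
  shows "induced_matching E (arc_matching (x, y))" "card (arc_matching (x, y)) = t"
    "\<Union>(arc_matching (x, y)) = arc x \<union> arc y"
proof -
  let ?W = "arc x \<union> arc y" and ?M = "arc_matching (x, y)"
  define \<delta> where "\<delta> = pos x y"
  have d: "T + 1 \<le> \<delta>" "\<delta> \<le> N - T - 1" using xy by (auto simp: arc_pairs_def \<delta>_def)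
  have W: "?W = {w \<in> V. pos x w \<in> {0..<T} \<union> {\<delta>..<\<delta> + T}}"
    using arcs_pos[OF xy] by (simp add: \<delta>_def)
  define v where "v q = (x + q) mod N" for q
  have v: "v q \<in> V" "0 \<le> q \<Longrightarrow> q < N \<Longrightarrow> pos x (v q) = q" for q
    by (simp_all add: v_def mod_in_V pos_shift)
  have vpos: "v (pos x w) = w" if "w \<in> V" for w using that by (simp add: v_def pos_inv)
  define \<sigma> where "\<sigma> s = (s + 1 - \<delta>) mod T" for s
  have \<sigma>: "0 \<le> \<sigma> s" "\<sigma> s < T" for s using T_pos by (auto simp: \<sigma>_def)
  define m where "m s = {v s, v (\<delta> + \<sigma> s)}" for s
  have M_eq: "?M = m ` {0..<T}"
  proof
    show "m ` {0..<T} \<subseteq> ?M"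
    proof
      fix e assume "e \<in> m ` {0..<T}"
      then obtain s where s: "0 \<le> s" "s < T" "e = m s" by auto
      have p: "pos x (v s) = s" "pos x (v (\<delta> + \<sigma> s)) = \<delta> + \<sigma> s"
        using v(2)[of s] v(2)[of "\<delta> + \<sigma> s"] s d \<sigma>[of s] by auto
      have "T dvd \<sigma> s - (s + 1 - \<delta>)" unfolding \<sigma>_def by (metis mod_eq_dvd_iff mod_mod_trivial)
      hence "chord (\<delta> + \<sigma> s - s)" using s d \<sigma>[of s] by (simp add: chord_def algebra_simps)
      hence "e \<in> E" using edge_pos_iff[of "v s" "v (\<delta> + \<sigma> s)" x] p v(1) s d \<sigma>[of s] by (simp add: m_def)
      moreover have "e \<subseteq> ?W" unfolding W using p s d \<sigma>[of s] v(1) by (auto simp: m_def)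
      ultimately show "e \<in> ?M" by (simp add: arc_matching_def)
    qed
    show "?M \<subseteq> m ` {0..<T}"
    proof
      fix e assume "e \<in> ?M"
      hence e: "e \<in> E" "e \<subseteq> ?W" by (auto simp: arc_matching_def)
      obtain a b where ab: "e = {a, b}" "a \<in> V" "b \<in> V" "pos x a < pos x b" "chord (pos x b - pos x a)"
        using e(1) by (rule edge_oriented)
      have W': "pos x a \<in> {0..<T} \<union> {\<delta>..<\<delta> + T}" "pos x b \<in> {0..<T} \<union> {\<delta>..<\<delta> + T}"
        using e(2) ab(1) unfolding W by auto
      have long: "pos x b - pos x a - 1 \<ge> T"
        using ab(5) zdvd_imp_le by (fastforce simp: chord_def)
      hence s: "0 \<le> pos x a" "pos x a < T" and b: "\<delta> \<le> pos x b" "pos x b < \<delta> + T"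
        using W' d by auto
      have "T dvd (pos x b - \<delta>) - (pos x a + 1 - \<delta>)" using ab(5) by (simp add: chord_def algebra_simps)
      hence "(pos x b - \<delta>) mod T = \<sigma> (pos x a)" unfolding \<sigma>_def by (simp add: mod_eq_dvd_iff)
      hence "pos x b = \<delta> + \<sigma> (pos x a)" using b by simp
      hence "e = m (pos x a)" using ab vpos by (metis m_def)
      thus "e \<in> m ` {0..<T}" using s by auto
    qed
  qed
  have vinj: "v q = v q' \<longleftrightarrow> q = q'" if "0 \<le> q" "q < N" "0 \<le> q'" "q' < N" for q q'
    using v(2) that by metis
  have "inj_on m {0..<T}"
  proof (rule inj_onI)
    fix s s' assume s: "s \<in> {0..<T}" "s' \<in> {0..<T}" "m s = m s'"
    hence "v s = v s' \<or> v s = v (\<delta> + \<sigma> s')" by (auto simp: m_def doubleton_eq_iff)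
    thus "s = s'" using vinj[of s s'] vinj[of s "\<delta> + \<sigma> s'"] s d \<sigma>[of s'] by auto
  qed
  thus card: "card ?M = t" unfolding M_eq by (simp add: card_image T_def)
  have surj: "\<exists>s\<in>{0..<T}. \<sigma> s = s'" if "s' \<in> {0..<T}" for s'
  proof
    have "\<sigma> ((s' - 1 + \<delta>) mod T) = ((s' - 1 + \<delta>) mod T + (1 - \<delta>)) mod T" by (simp add: \<sigma>_def algebra_simps)
    also have "\<dots> = s' mod T" unfolding mod_add_left_eq by simp
    finally show "\<sigma> ((s' - 1 + \<delta>) mod T) = s'" using that by simp
    show "(s' - 1 + \<delta>) mod T \<in> {0..<T}" using T_pos by simp
  qed
  show cover: "\<Union>?M = ?W"
  proof
    show "\<Union>?M \<subseteq> ?W" by (auto simp: arc_matching_def)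
    show "?W \<subseteq> \<Union>?M"
    proof
      fix w assume "w \<in> ?W"
      hence w: "w \<in> V" "pos x w \<in> {0..<T} \<union> {\<delta>..<\<delta> + T}" unfolding W by auto
      show "w \<in> \<Union>?M"
      proof (cases "pos x w \<in> {0..<T}")
        case True
        have "w \<in> m (pos x w)" using vpos[OF w(1)] by (simp add: m_def)
        thus ?thesis using True unfolding M_eq by blast
      next
        case False
        hence "pos x w - \<delta> \<in> {0..<T}" using w(2) by auto
        then obtain s where s: "s \<in> {0..<T}" "\<sigma> s = pos x w - \<delta>" using surj by blast
        have "w \<in> m s" using vpos[OF w(1)] s(2) by (simp add: m_def)
        thus ?thesis using s(1) unfolding M_eq by blast
      qed
    qed
  qed
  have "bij_betw (pos x) ?W ({0..<T} \<union> {\<delta>..<\<delta> + T})"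
  proof (rule bij_betwI[where g = v])
    show "v \<in> {0..<T} \<union> {\<delta>..<\<delta> + T} \<rightarrow> ?W" unfolding W using v d T_pos by auto
    show "pos x (v q) = q" if "q \<in> {0..<T} \<union> {\<delta>..<\<delta> + T}" for q using that v(2)[of q] d T_pos by auto
  qed (auto simp: W vpos)
  hence "card ?W = card ({0..<T} \<union> {\<delta>..<\<delta> + T})" by (rule bij_betw_same_card)
  also have "\<dots> = card {0..<T} + card {\<delta>..<\<delta> + T}" using d by (intro card_Un_disjoint) auto
  finally have "card ?W = 2 * t" by (simp add: T_def)
  thus "induced_matching E ?M"
    using card cover by (auto simp: induced_matching_def arc_matching_def)
qed

text \<open>
  The gaps keep the first vertex of each arc from following the last one of the other, so the union
  of the arcs determines them.
\<close>

lemma arc_starts: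
  assumes xy: "(x, y) \<in> arc_pairs"
  shows "{w \<in> arc x \<union> arc y. (w - 1) mod N \<notin> arc x \<union> arc y} = {x, y}"
proof -
  define \<delta> where "\<delta> = pos x y"
  have V: "x \<in> V" "y \<in> V" using xy by (auto simp: arc_pairs_def)
  have d: "T + 1 \<le> \<delta>" "\<delta> \<le> N - T - 1" using xy by (auto simp: arc_pairs_def \<delta>_def)
  let ?P = "{0..<T} \<union> {\<delta>..<\<delta> + T}"
  have W: "arc x \<union> arc y = {w \<in> V. pos x w \<in> ?P}"
    using arcs_pos[OF xy] by (simp add: \<delta>_def)
  have pred: "pos x ((w - 1) mod N) = (if pos x w = 0 then N - 1 else pos x w - 1)" if "w \<in> V" for w
  proof -
    have "pos x ((w - 1) mod N) = (pos x w - 1) mod N" by (simp add: pos_def mod_simps algebra_simps)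
    moreover have "(- 1) mod N = N - 1" using N_large T_pos by (simp add: zmod_minus1)
    ultimately show ?thesis using pos_range[of x w] by simp
  qed
  have "w \<in> {w \<in> arc x \<union> arc y. (w - 1) mod N \<notin> arc x \<union> arc y} \<longleftrightarrow> w \<in> {x, y}" if w: "w \<in> V" for w
  proof -
    have "w \<in> {w \<in> arc x \<union> arc y. (w - 1) mod N \<notin> arc x \<union> arc y}
        \<longleftrightarrow> pos x w \<in> ?P \<and> (if pos x w = 0 then N - 1 else pos x w - 1) \<notin> ?P"
      unfolding W using w mod_in_V pred[OF w] by simp
    also have "\<dots> \<longleftrightarrow> pos x w = 0 \<or> pos x w = \<delta>" using d T_pos pos_range[of x w] by auto
    also have "\<dots> \<longleftrightarrow> w \<in> {x, y}"
      using pos_eq_0_iff[OF V(1) w] pos_inj[OF w V(2), of x] by (simp add: \<delta>_def)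
    finally show ?thesis .
  qed
  moreover have "arc x \<union> arc y \<subseteq> V" by (auto simp: arc_def)
  ultimately show ?thesis using V by blast
qed

lemma arc_pairs_sym: "(x, y) \<in> arc_pairs \<Longrightarrow> (y, x) \<in> arc_pairs"
proof -
  assume xy: "(x, y) \<in> arc_pairs"
  hence "pos y x = N - pos x y" using T_pos by (intro pos_swap) (auto simp: arc_pairs_def)
  thus ?thesis using xy by (auto simp: arc_pairs_def)
qed

lemma arc_matching_fibre:
  assumes "(x, y) \<in> arc_pairs"
  shows "{q \<in> arc_pairs. arc_matching q = arc_matching (x, y)} = {(x, y), (y, x)}"
proof
  show "{q \<in> arc_pairs. arc_matching q = arc_matching (x, y)} \<subseteq> {(x, y), (y, x)}"
  proof
    fix q assume q: "q \<in> {q \<in> arc_pairs. arc_matching q = arc_matching (x, y)}"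
    obtain x' y' where q': "q = (x', y')" by (cases q)
    have "arc x' \<union> arc y' = arc x \<union> arc y"
      using q arc_matching_props(3)[of x' y'] arc_matching_props(3)[OF assms] by (simp add: q')
    hence "{x', y'} = {x, y}" using q arc_starts[of x' y'] arc_starts[OF assms] by (simp add: q')
    thus "q \<in> {(x, y), (y, x)}" by (auto simp: q' doubleton_eq_iff)
  qed
  have "arc_matching (y, x) = arc_matching (x, y)" by (simp add: arc_matching_def Un_commute)
  thus "{(x, y), (y, x)} \<subseteq> {q \<in> arc_pairs. arc_matching q = arc_matching (x, y)}"
    using assms arc_pairs_sym by auto
qed

text \<open>
  An induced matching consists of all edges on its vertices, so it is determined by the two arcs
  that these form.
\<close>

lemma maximal_induced_matchings:
  "{M. induced_matching E M \<and> card M = t} = arc_matching ` arc_pairs"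
proof
  show "arc_matching ` arc_pairs \<subseteq> {M. induced_matching E M \<and> card M = t}"
    using arc_matching_props by auto
  show "{M. induced_matching E M \<and> card M = t} \<subseteq> arc_matching ` arc_pairs"
  proof
    fix M assume "M \<in> {M. induced_matching E M \<and> card M = t}"
    hence M: "induced_matching E M" "card M = t" by auto
    obtain u left right where cm: "cut_matching t k M u left right" using cut_matching_exists[OF M(1)] .
    obtain a b where ab: "1 \<le> a" "a + T + 1 \<le> b" "b + T \<le> N"
        "pos u ` \<Union>M = {a..<a + T} \<union> {b..<b + T}"
      using cut_matching.covered_positions[OF cm M(2)] .
    let ?x = "(u + a) mod N" and ?y = "(u + b) mod N"
    have "pos u ?x = a" "pos u ?y = b" using ab T_pos by (auto intro!: pos_shift)
    hence "pos ?x ?y = b - a" using pos_diff[of u ?x ?y] ab T_pos by simp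
    hence pair: "(?x, ?y) \<in> arc_pairs" using ab by (simp add: arc_pairs_def mod_in_V)
    have "\<Union>M \<subseteq> V" using M(1) edges_sub by (auto simp: induced_matching_def)
    hence "\<Union>M = {w \<in> V. pos u w \<in> pos u ` \<Union>M}" using pos_inj by blast
    also have "\<dots> = arc ?x \<union> arc ?y"
      unfolding ab(4) using ab T_pos by (subst (1 2) arc_pos) auto
    finally have "M = arc_matching (?x, ?y)"
      using M(1) by (auto simp: induced_matching_def arc_matching_def)
    thus "M \<in> arc_matching ` arc_pairs" using pair by blast
  qed
qed

theorem card_maximal_induced_matchings:
  "2 * card {M. induced_matching E M \<and> card M = t} = nat N * (t * (k - 3) + 1)"
proof -
  let ?J = "arc_matching ` arc_pairs"
  have fin: "finite arc_pairs"
    by (rule finite_subset[of _ "V \<times> V"]) (auto simp: arc_pairs_def V_eq)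
  have "arc_pairs = (\<Union>M\<in>?J. {q \<in> arc_pairs. arc_matching q = M})" by auto
  hence "card arc_pairs = card (\<Union>M\<in>?J. {q \<in> arc_pairs. arc_matching q = M})" by simp
  also have "\<dots> = (\<Sum>M\<in>?J. card {q \<in> arc_pairs. arc_matching q = M})"
    using fin by (intro card_UN_disjoint) auto
  also have "\<dots> = (\<Sum>M\<in>?J. 2)"
  proof (rule sum.cong[OF refl])
    fix M assume "M \<in> ?J"
    then obtain x y where xy: "(x, y) \<in> arc_pairs" "M = arc_matching (x, y)" by auto
    have "x \<noteq> y" using xy(1) T_pos by (auto simp: arc_pairs_def pos_def)
    thus "card {q \<in> arc_pairs. arc_matching q = M} = 2"
      unfolding xy(2) arc_matching_fibre[OF xy(1)] by simp
  qed
  finally have "2 * card ?J = nat (N * (N - 2 * T - 1))" by (simp add: card_arc_pairs)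
  also have "N - 2 * T - 1 = int (t * (k - 3) + 1)"
    using k by (simp add: N_eq T_def of_nat_diff algebra_simps)
  also have "nat (N * int (t * (k - 3) + 1)) = nat N * (t * (k - 3) + 1)"
    using N_large T_pos by (simp only: nat_mult_distrib nat_int)
  finally show ?thesis by (simp add: maximal_induced_matchings)
qed

end

theorem proposition4p3:
  fixes t k n :: nat and I :: "(int, 'k::field) mpoly set"
  assumes "t \<ge> 1" and "k \<ge> 4"
    and "n = t * (k - 1) + 2"
    and "I = edge_ideal (GA'_verts t k) (GA'_edges t k)"
  shows "(\<forall>i. graded_betti (GA'_verts t k) I i (2 * (i + 1)) = 0 \<longleftrightarrow> i \<ge> t) \<and>
         real (graded_betti (GA'_verts t k) I (t - 1) (2 * t)) =
           real n / 2 * real (t * (k - 3) + 1)"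
proof -
  interpret circulant t k using assms(1,2) by unfold_locales
  let ?J = "\<lambda>m. {M. induced_matching E M \<and> card M = m}"
  have betti: "graded_betti V I i (2 * (i + 1)) = card (?J (i + 1))" for i
    unfolding assms(4) by (rule graded_betti_eq_induced_matchings) (use finite_V edges_sub card_edge in auto)
  have fin: "finite (?J m)" for m
    by (rule finite_subset[of _ "Pow E"]) (auto simp: induced_matching_def finite_E)
  have count: "2 * card (?J t) = n * (t * (k - 3) + 1)"
    using card_maximal_induced_matchings unfolding N_def nat_int by (simp only: GA_size_def assms(3))
  hence "card (?J t) \<noteq> 0" using assms(3) by auto
  hence "?J t \<noteq> {}" by force
  then obtain M where M: "induced_matching E M" "card M = t" by blast
  have "card (?J (i + 1)) = 0 \<longleftrightarrow> i \<ge> t" for i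
  proof (cases "i \<ge> t")
    case True
    hence "?J (i + 1) = {}" using card_induced_matching_le by fastforce
    thus ?thesis using True by (simp only: card.empty refl)
  next
    case False
    \<comment> \<open>The smaller sizes are realised by subsets of a matching with \<open>t\<close> edges.\<close>
    then obtain M' where M': "M' \<subseteq> M" "card M' = i + 1"
      using obtain_subset_with_card_n[of "i + 1" M] M(2) by auto
    have "M' \<in> ?J (i + 1)" using induced_matching_subset[OF finite_graph_axioms M(1) M'(1)] M'(2) by simp
    hence "card (?J (i + 1)) \<noteq> 0" using fin by (metis card_0_eq empty_iff)
    thus ?thesis using False by simp
  qed
  moreover have "graded_betti V I (t - 1) (2 * t) = card (?J t)" using betti[of "t - 1"] assms(1) by simp
  moreover have "real (card (?J t)) = real n / 2 * real (t * (k - 3) + 1)"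
  proof -
    have "2 * real (card (?J t)) = real (n * (t * (k - 3) + 1))" unfolding count[symmetric] by simp
    thus ?thesis by (simp only: of_nat_mult)
  qed
  ultimately show ?thesis using betti by simp
qed

end
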